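(* For every $k\in\mathbb{N}$, Thompson's group $F$ has solvable $k$-simultaneous conjugacy problem: there is an algorithm which, given two $k$-tuples $(y_1,\dots,y_k)$ and $(z_1,\dots,z_k)$ of elements of $F$, determines whether or not there exists $g\in F$ with $g^{-1}y_ig=z_i$ for all $i=1,\dots,k$. Moreover, there is an algorithm which produces an effective solution (i.e. it outputs such an element $g$ whenever one exists) and enumerates all possible conjugators $g$.
   Context: Thompson's group $F$ is the group (under composition) of all orientation-preserving piecewise linear (i.e. piecewise affine) homeomorphisms of $[0,1]$ onto itself with finitely many breakpoints, all of them in $\mathbb{Z}[\frac12]$, and with all slopes integral powers of $2$. Equivalently $F=\langle x_0,x_1,x_2,\dots\mid x_nx_k=x_kx_{n+1}\ \forall k<n\rangle$. Elements are given to the algorithm as such piecewise linear maps. *)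

theory Defs
  imports "HOL-Analysis.Analysis" "HOL-Algebra.Bij" "HOL-Library.Nat_Bijection"
begin

section \<open>Algorithms\<close>

text \<open>
  Algorithms are programs for partial recursive functions (Kleene's mu-recursive functions)
  on tuples of natural numbers; \<open>None\<close> means that the computation does not terminate.
\<close>

datatype recf =
    Zero
  | Succ
  | Proj nat
  | Comp recf "recf list"
  | PrimRec recf recf
  | Mu recf

fun run :: "recf \<Rightarrow> nat list \<Rightarrow> nat option" where
  "run Zero xs = Some 0"
| "run Succ xs = (case xs of [] \<Rightarrow> None | x # _ \<Rightarrow> Some (Suc x))"
| "run (Proj i) xs = (if i < length xs then Some (xs ! i) else None)"
| "run (Comp p qs) xs =
     (if \<forall>q\<in>set qs. run q xs \<noteq> None then run p (map (\<lambda>q. the (run q xs)) qs) else None)"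
| "run (PrimRec p q) xs =
     (case xs of [] \<Rightarrow> None
      | n # ys \<Rightarrow> rec_nat (run p ys)
          (\<lambda>m r. case r of None \<Rightarrow> None | Some v \<Rightarrow> run q (m # v # ys)) n)"
| "run (Mu p) xs =
     (if \<exists>n. run p (n # xs) = Some 0 \<and> (\<forall>m<n. run p (m # xs) \<noteq> None)
      then Some (LEAST n. run p (n # xs) = Some 0) else None)"


section \<open>Thompson's group\<close>

definition dyadic_rationals :: "real set" where
  "dyadic_rationals = {of_int m / 2 ^ n | (m :: int) (n :: nat). True}"

definition affine_piece :: "(real \<Rightarrow> real) \<Rightarrow> real \<Rightarrow> real \<Rightarrow> bool" where
  "affine_piece f a b \<longleftrightarrow> (\<exists>(j :: int) c. \<forall>x\<in>{a..b}. f x = 2 powi j * x + c)"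

text \<open>
  The finite set \<open>B\<close> contains all breakpoints: \<open>f\<close> is affine, with slope an integral power of 2,
  on every interval whose interior misses \<open>B\<close>. Outside \<open>[0,1]\<close> the maps take the dummy value
  prescribed by \<^const>\<open>extensional\<close>, as in \<^const>\<open>BijGroup\<close>.
\<close>

definition thompson_F :: "(real \<Rightarrow> real) set" where
  "thompson_F = {f \<in> extensional {0..1}.
     (\<exists>g. homeomorphism {0..1} {0..1} f g) \<and>
     strict_mono_on {0..1} f \<and>
     (\<exists>B. finite B \<and> B \<subseteq> dyadic_rationals \<and>
        (\<forall>a b. 0 \<le> a \<and> a < b \<and> b \<le> 1 \<and> {a<..<b} \<inter> B = {} \<longrightarrow> affine_piece f a b))}"

definition thompson_group :: "(real \<Rightarrow> real) monoid" where
  "thompson_group = (BijGroup {0..1})\<lparr>carrier := thompson_F\<rparr>"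


section \<open>Finite descriptions of elements\<close>

definition dyadic :: "nat \<times> nat \<Rightarrow> real" where
  "dyadic p = real (fst p) / 2 ^ snd p"

text \<open>
  An element is given to an algorithm by a list of points \<open>(x, f x)\<close> of its graph, with \<open>x\<close>
  increasing from 0 to 1, between which it is affine; the coordinates are dyadic fractions.
  The points need not all be breakpoints, so an element has many descriptions.
\<close>

definition describes :: "((nat \<times> nat) \<times> (nat \<times> nat)) list \<Rightarrow> (real \<Rightarrow> real) \<Rightarrow> bool" where
  "describes ps f \<longleftrightarrow> f \<in> thompson_F \<and> ps \<noteq> [] \<and>
     (let xs = map (dyadic \<circ> fst) ps; ys = map (dyadic \<circ> snd) ps in
        hd xs = 0 \<and> last xs = 1 \<and> sorted_wrt (<) xs \<and>
        (\<forall>i<length ps. f (xs ! i) = ys ! i) \<and>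
        (\<forall>i. Suc i < length ps \<longrightarrow> affine_piece f (xs ! i) (xs ! Suc i)))"

definition encode_description :: "((nat \<times> nat) \<times> (nat \<times> nat)) list \<Rightarrow> nat" where
  "encode_description ps =
     list_encode (map (\<lambda>(p, q). prod_encode (prod_encode p, prod_encode q)) ps)"

definition codes :: "nat \<Rightarrow> (real \<Rightarrow> real) \<Rightarrow> bool" where
  "codes c f \<longleftrightarrow> (\<exists>ps. c = encode_description ps \<and> describes ps f)"


section \<open>The simultaneous conjugacy problem\<close>

definition conjugators :: "('a, 'b) monoid_scheme \<Rightarrow> 'a list \<Rightarrow> 'a list \<Rightarrow> 'a set" where
  "conjugators G ys zs =
     {g \<in> carrier G. list_all2 (\<lambda>y z. inv\<^bsub>G\<^esub> g \<otimes>\<^bsub>G\<^esub> y \<otimes>\<^bsub>G\<^esub> g = z) ys zs}"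

definition instance_codes ::
    "(nat \<Rightarrow> 'a \<Rightarrow> bool) \<Rightarrow> nat \<Rightarrow> nat list \<Rightarrow> 'a list \<Rightarrow> 'a list \<Rightarrow> bool" where
  "instance_codes code k cs ys zs \<longleftrightarrow>
     length ys = k \<and> length zs = k \<and> list_all2 code cs (ys @ zs)"

definition decides_simultaneous_conjugacy ::
    "('a, 'b) monoid_scheme \<Rightarrow> (nat \<Rightarrow> 'a \<Rightarrow> bool) \<Rightarrow> nat \<Rightarrow> recf \<Rightarrow> bool" where
  "decides_simultaneous_conjugacy G code k p \<longleftrightarrow>
     (\<forall>cs ys zs. instance_codes code k cs ys zs \<longrightarrow>
        run p cs = Some (if conjugators G ys zs = {} then 0 else 1))"

text \<open>
  The algorithm produces its outputs one after the other: on the additional argument \<open>n\<close> it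
  returns the \<open>n\<close>-th one. The value 0 reports that there is no conjugator and \<open>Suc c\<close> is the
  output \<open>c\<close>. In particular the argument \<open>n = 0\<close> yields a conjugator whenever there is one.
\<close>

definition solves_and_enumerates_simultaneous_conjugacy ::
    "('a, 'b) monoid_scheme \<Rightarrow> (nat \<Rightarrow> 'a \<Rightarrow> bool) \<Rightarrow> nat \<Rightarrow> recf \<Rightarrow> bool" where
  "solves_and_enumerates_simultaneous_conjugacy G code k p \<longleftrightarrow>
     (\<forall>cs ys zs. instance_codes code k cs ys zs \<longrightarrow>
        (if conjugators G ys zs = {} then \<forall>n. run p (n # cs) = Some 0
         else (\<forall>n. \<exists>c. \<exists>g\<in>conjugators G ys zs. run p (n # cs) = Some (Suc c) \<and> code c g) \<and>
              (\<forall>g\<in>conjugators G ys zs. \<exists>n c. run p (n # cs) = Some (Suc c) \<and> code c g)))"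


section \<open>Well-definedness\<close>

text \<open>
  \<^const>\<open>thompson_F\<close> is a subgroup of the group of bijections of \<open>[0,1]\<close>, each of its elements
  has a code, and a code determines the element.
\<close>

lemma dyadic_add: "x \<in> dyadic_rationals \<Longrightarrow> y \<in> dyadic_rationals \<Longrightarrow> x + y \<in> dyadic_rationals"
proof -
  assume "x \<in> dyadic_rationals" "y \<in> dyadic_rationals"
  then obtain m n m' n' where "x = of_int m / 2 ^ n" "y = of_int m' / 2 ^ n'"
    unfolding dyadic_rationals_def by blast
  then have "x + y = of_int (m * 2 ^ n' + m' * 2 ^ n) / 2 ^ (n + n')"
    by (simp add: add_divide_distrib power_add)
  then show ?thesis unfolding dyadic_rationals_def by blast
qed

lemma dyadic_minus: "x \<in> dyadic_rationals \<Longrightarrow> - x \<in> dyadic_rationals"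
proof -
  assume "x \<in> dyadic_rationals"
  then obtain m n where "x = of_int m / 2 ^ n"
    unfolding dyadic_rationals_def by blast
  then have "- x = of_int (- m) / 2 ^ n" by simp
  then show ?thesis unfolding dyadic_rationals_def by blast
qed

lemma dyadic_diff: "x \<in> dyadic_rationals \<Longrightarrow> y \<in> dyadic_rationals \<Longrightarrow> x - y \<in> dyadic_rationals"
  using dyadic_add[of x "- y"] dyadic_minus[of y] by simp

lemma dyadic_powi_mult:
  assumes "x \<in> dyadic_rationals" shows "2 powi j * x \<in> dyadic_rationals"
proof -
  obtain m n where x: "x = of_int m / 2 ^ n"
    using assms unfolding dyadic_rationals_def by blast
  show ?thesis
  proof (cases "j \<ge> 0")
    case True
    then have "2 powi j * x = of_int (m * 2 ^ nat j) / 2 ^ n"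
      using x by (simp add: power_int_def)
    then show ?thesis unfolding dyadic_rationals_def by blast
  next
    case False
    then have "2 powi j * x = of_int m / 2 ^ (n + nat (- j))"
      using x by (simp add: power_int_def power_add field_simps)
    then show ?thesis unfolding dyadic_rationals_def by blast
  qed
qed

lemma dyadic_powi_mult_iff: "2 powi j * x \<in> dyadic_rationals \<longleftrightarrow> x \<in> dyadic_rationals"
proof
  assume "2 powi j * x \<in> dyadic_rationals"
  then have "2 powi (- j) * (2 powi j * x) \<in> dyadic_rationals" by (rule dyadic_powi_mult)
  moreover have "2 powi (- j) * (2 powi j * x) = x"
    by (simp add: power_int_minus field_simps)
  ultimately show "x \<in> dyadic_rationals" by simp
qed (rule dyadic_powi_mult)

lemma zero_dyadic: "0 \<in> dyadic_rationals" and one_dyadic: "1 \<in> dyadic_rationals"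
proof -
  have "(0::real) = of_int 0 / 2 ^ 0" "(1::real) = of_int 1 / 2 ^ 0" by auto
  then show "0 \<in> dyadic_rationals" "1 \<in> dyadic_rationals" unfolding dyadic_rationals_def by blast+
qed

lemma thompson_F_Bij: "f \<in> thompson_F \<Longrightarrow> f \<in> Bij {0..1}"
  by (auto simp: thompson_F_def Bij_def bij_betw_def homeomorphism_def intro: strict_mono_on_imp_inj_on)

lemma thompson_F_ends:
  assumes "f \<in> thompson_F" shows "f 0 = 0" "f 1 = 1"
proof -
  have m: "strict_mono_on {0..1} f" and im: "f ` {0..1} = {0..1}"
    using assms thompson_F_Bij[OF assms] by (auto simp: thompson_F_def Bij_def bij_betw_def)
  have le: "f x \<le> f y" if "x \<in> {0..1}" "y \<in> {0..1}" "x \<le> y" for x y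
    using strict_mono_on_leD[OF m] that by blast
  have "0 \<in> f ` {0..1}" "1 \<in> f ` {0..1}" unfolding im by auto
  then obtain x y where "x \<in> {0..1}" "0 = f x" "y \<in> {0..1}" "1 = f y" by blast
  moreover have "f 0 \<in> {0..1}" "f 1 \<in> {0..1}" using im by auto
  ultimately show "f 0 = 0" "f 1 = 1"
    using le[of 0 x] le[of y 1] by auto
qed

lemma thompson_F_E0:
  assumes "f \<in> thompson_F"
  obtains B where "finite B" "B \<subseteq> dyadic_rationals"
    "\<And>a b. 0 \<le> a \<Longrightarrow> a < b \<Longrightarrow> b \<le> 1 \<Longrightarrow> {a<..<b} \<inter> B = {} \<Longrightarrow> affine_piece f a b"
proof -
  from assms have "\<exists>B. finite B \<and> B \<subseteq> dyadic_rationals \<and>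
      (\<forall>a b. 0 \<le> a \<and> a < b \<and> b \<le> 1 \<and> {a<..<b} \<inter> B = {} \<longrightarrow> affine_piece f a b)"
    unfolding thompson_F_def by (elim CollectE conjE)
  then show ?thesis
    by (elim exE conjE, intro that) (assumption | simp)+
qed

lemma thompson_F_dyadic_iff:
  assumes f: "f \<in> thompson_F" and x: "x \<in> {0..1}"
  shows "f x \<in> dyadic_rationals \<longleftrightarrow> x \<in> dyadic_rationals"
proof -
  obtain B where B: "finite B" "B \<subseteq> dyadic_rationals"
    and aff: "\<And>a b. 0 \<le> a \<Longrightarrow> a < b \<Longrightarrow> b \<le> 1 \<Longrightarrow> {a<..<b} \<inter> B = {} \<Longrightarrow> affine_piece f a b"
    using thompson_F_E0[OF f] by metis
  show ?thesis using x
  proof (induction "card (B \<inter> {0<..<x})" arbitrary: x rule: less_induct)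
    case less
    show ?case
    proof (cases "x = 0")
      case True then show ?thesis using thompson_F_ends[OF f] zero_dyadic by simp
    next
      case False
      let ?S = "insert 0 (B \<inter> {0<..<x})"
      define p where "p = Max ?S"
      have fin: "finite ?S" using B by simp
      have pin: "p \<in> ?S" unfolding p_def using fin by (intro Max_in) auto
      have pd: "p \<in> dyadic_rationals" using pin B zero_dyadic by auto
      have px: "0 \<le> p" "p < x" using pin False less.prems by auto
      have "f p \<in> dyadic_rationals"
      proof (cases "p = 0")
        case True then show ?thesis using thompson_F_ends[OF f] zero_dyadic by simp
      next
        case False
        then have "p \<in> B \<inter> {0<..<x}" using pin by auto
        then have "B \<inter> {0<..<p} \<subset> B \<inter> {0<..<x}" by auto
        then have "card (B \<inter> {0<..<p}) < card (B \<inter> {0<..<x})" using B by (intro psubset_card_mono) auto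
        then show ?thesis using less.hyps[of p] pd px less.prems by auto
      qed
      have "{p<..<x} \<inter> B = {}"
      proof (rule ccontr)
        assume "{p<..<x} \<inter> B \<noteq> {}"
        then obtain q where q: "q \<in> B" "p < q" "q < x" by auto
        then have "q \<in> ?S" using px by auto
        then have "q \<le> p" unfolding p_def using fin by (intro Max_ge) auto
        then show False using q by simp
      qed
      then have "affine_piece f p x" using px less.prems by (intro aff) auto
      then obtain j c where jc: "\<And>t. t \<in> {p..x} \<Longrightarrow> f t = 2 powi j * t + c"
        unfolding affine_piece_def by blast
      have "f p = 2 powi j * p + c" "f x = 2 powi j * x + c" using jc px by auto
      then have eq: "f x - f p = 2 powi j * (x - p)" by (simp add: algebra_simps)
      have "f x \<in> dyadic_rationals \<longleftrightarrow> f x - f p \<in> dyadic_rationals"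
        using \<open>f p \<in> dyadic_rationals\<close> dyadic_diff dyadic_add by (metis diff_add_cancel)
      also have "\<dots> \<longleftrightarrow> x - p \<in> dyadic_rationals" unfolding eq by (rule dyadic_powi_mult_iff)
      also have "\<dots> \<longleftrightarrow> x \<in> dyadic_rationals"
        using pd dyadic_diff dyadic_add by (metis diff_add_cancel)
      finally show ?thesis .
    qed
  qed
qed

lemma thompson_F_I:
  assumes "f \<in> extensional {0..1}" "homeomorphism {0..1} {0..1} f g" "strict_mono_on {0..1} f"
    "finite B" "B \<subseteq> dyadic_rationals"
    "\<And>a b. 0 \<le> a \<Longrightarrow> a < b \<Longrightarrow> b \<le> 1 \<Longrightarrow> {a<..<b} \<inter> B = {} \<Longrightarrow> affine_piece f a b"
  shows "f \<in> thompson_F"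
  unfolding thompson_F_def
  by (intro CollectI conjI exI[of _ g] exI[of _ B]) (use assms in simp_all)

lemma thompson_F_E:
  assumes "f \<in> thompson_F"
  obtains B where "finite B" "B \<subseteq> dyadic_rationals" "B \<subseteq> {0..1}"
    "\<And>a b. 0 \<le> a \<Longrightarrow> a < b \<Longrightarrow> b \<le> 1 \<Longrightarrow> {a<..<b} \<inter> B = {} \<Longrightarrow> affine_piece f a b"
proof -
  obtain B where B: "finite B" "B \<subseteq> dyadic_rationals"
    and aff: "\<And>a b. 0 \<le> a \<Longrightarrow> a < b \<Longrightarrow> b \<le> 1 \<Longrightarrow> {a<..<b} \<inter> B = {} \<Longrightarrow> affine_piece f a b"
    using thompson_F_E0[OF assms] by metis
  show ?thesis
  proof (rule that[of "B \<inter> {0..1}"])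
    fix a b :: real assume h: "0 \<le> a" "a < b" "b \<le> 1" "{a<..<b} \<inter> (B \<inter> {0..1}) = {}"
    have "{a<..<b} \<inter> B = {}"
    proof (rule ccontr)
      assume "{a<..<b} \<inter> B \<noteq> {}"
      then obtain q where "q \<in> B" "a < q" "q < b" by auto
      then have "q \<in> {a<..<b} \<inter> (B \<inter> {0..1})" using h(1-3) by auto
      then show False using h(4) by blast
    qed
    then show "affine_piece f a b" using h by (intro aff) auto
  qed (use B in auto)
qed

lemma thompson_F_compose:
  assumes f: "f \<in> thompson_F" and g: "g \<in> thompson_F"
  shows "compose {0..1} f g \<in> thompson_F"
proof -
  let ?h = "compose {0..1} f g"
  obtain f' g' where hf: "homeomorphism {0..1} {0..1} f f'" and hg: "homeomorphism {0..1} {0..1} g g'"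
    using f g unfolding thompson_F_def by auto
  have mf: "strict_mono_on {0..1} f" and mg: "strict_mono_on {0..1} g"
    using f g unfolding thompson_F_def by auto
  have gin: "\<And>x. x \<in> {0..1} \<Longrightarrow> g x \<in> {0..1}" using hg unfolding homeomorphism_def by blast
  obtain Bf where Bf: "finite Bf" "Bf \<subseteq> dyadic_rationals" "Bf \<subseteq> {0..1}"
    "\<And>a b. 0 \<le> a \<Longrightarrow> a < b \<Longrightarrow> b \<le> 1 \<Longrightarrow> {a<..<b} \<inter> Bf = {} \<Longrightarrow> affine_piece f a b"
    using thompson_F_E[OF f] by metis
  obtain Bg where Bg: "finite Bg" "Bg \<subseteq> dyadic_rationals" "Bg \<subseteq> {0..1}"
    "\<And>a b. 0 \<le> a \<Longrightarrow> a < b \<Longrightarrow> b \<le> 1 \<Longrightarrow> {a<..<b} \<inter> Bg = {} \<Longrightarrow> affine_piece g a b"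
    using thompson_F_E[OF g] by metis
  have inv: "g' y \<in> {0..1} \<and> g (g' y) = y" if "y \<in> {0..1}" for y
    using hg that unfolding homeomorphism_def by blast
  show ?thesis
  proof (rule thompson_F_I[where B = "Bg \<union> g' ` Bf" and g = "g' \<circ> f'"])
    show "?h \<in> extensional {0..1}" by simp
    show "homeomorphism {0..1} {0..1} ?h (g' \<circ> f')"
      by (rule homeomorphism_cong[OF homeomorphism_compose[OF hg hf]]) (auto simp: compose_def)
    show "strict_mono_on {0..1} ?h"
      using mf mg gin by (auto simp: strict_mono_on_def compose_def)
    show "finite (Bg \<union> g' ` Bf)" using Bf Bg by simp
    have "g' y \<in> dyadic_rationals" if "y \<in> Bf" for y
      using thompson_F_dyadic_iff[OF g, of "g' y"] inv[of y] subsetD[OF Bf(2) that] subsetD[OF Bf(3) that] by metis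
    then show "Bg \<union> g' ` Bf \<subseteq> dyadic_rationals" using Bg by auto
    fix a b :: real assume h: "0 \<le> a" "a < b" "b \<le> 1" "{a<..<b} \<inter> (Bg \<union> g' ` Bf) = {}"
    have "affine_piece g a b" using h by (intro Bg(4)) auto
    then obtain j c where jc: "\<And>t. t \<in> {a..b} \<Longrightarrow> g t = 2 powi j * t + c"
      unfolding affine_piece_def by blast
    have lt: "g a < g b" using mg h by (auto simp: strict_mono_on_def)
    have "{g a<..<g b} \<inter> Bf = {}"
    proof (rule ccontr)
      assume "{g a<..<g b} \<inter> Bf \<noteq> {}"
      then obtain y where y: "y \<in> Bf" "g a < y" "y < g b" by auto
      have i: "g' y \<in> {0..1}" "g (g' y) = y" using inv y Bf by auto
      have "a < g' y" using y i h strict_mono_on_less[OF mg, of a "g' y"] by auto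
      moreover have "g' y < b" using y i h strict_mono_on_less[OF mg, of "g' y" b] by auto
      ultimately show False using h y by auto
    qed
    then have "affine_piece f (g a) (g b)" using lt gin[of a] gin[of b] h by (intro Bf(4)) auto
    then obtain j' c' where jc': "\<And>t. t \<in> {g a..g b} \<Longrightarrow> f t = 2 powi j' * t + c'"
      unfolding affine_piece_def by blast
    have "?h t = 2 powi (j' + j) * t + (2 powi j' * c + c')" if t: "t \<in> {a..b}" for t
    proof -
      have "g t \<in> {g a..g b}"
        using t h strict_mono_on_leD[OF mg, of a t] strict_mono_on_leD[OF mg, of t b] by auto
      then show ?thesis using jc[OF t] jc' t h
        by (simp add: compose_def power_int_add algebra_simps)
    qed
    then show "affine_piece ?h a b" unfolding affine_piece_def by blast
  qed
qed

lemma thompson_F_inv: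
  assumes f: "f \<in> thompson_F"
  shows "(\<lambda>x\<in>{0..1}. inv_into {0..1} f x) \<in> thompson_F"
proof -
  let ?h = "\<lambda>x\<in>{0..1}. inv_into {0..1} f x"
  obtain f' where hf: "homeomorphism {0..1} {0..1} f f'"
    using f unfolding thompson_F_def by auto
  have mf: "strict_mono_on {0..1} f" using f unfolding thompson_F_def by auto
  have fin: "\<And>x. x \<in> {0..1} \<Longrightarrow> f x \<in> {0..1}" using hf unfolding homeomorphism_def by blast
  obtain Bf where Bf: "finite Bf" "Bf \<subseteq> dyadic_rationals" "Bf \<subseteq> {0..1}"
    "\<And>a b. 0 \<le> a \<Longrightarrow> a < b \<Longrightarrow> b \<le> 1 \<Longrightarrow> {a<..<b} \<inter> Bf = {} \<Longrightarrow> affine_piece f a b"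
    using thompson_F_E[OF f] by metis
  have bij: "bij_betw f {0..1} {0..1}" using thompson_F_Bij[OF f] by (simp add: Bij_def)
  have h1: "?h y \<in> {0..1} \<and> f (?h y) = y" if "y \<in> {0..1}" for y
    using that bij by (auto simp: bij_betw_def f_inv_into_f dest: inv_into_into[of y f "{0..1}"])
      (metis atLeastAtMost_iff inv_into_into)+
  have h2: "?h (f x) = x" if "x \<in> {0..1}" for x
    using that bij fin[OF that] by (auto simp: bij_betw_def inv_into_f_f)
  have eq: "f' y = ?h y" if "y \<in> {0..1}" for y
    using h1[OF that] hf unfolding homeomorphism_def by metis
  have less: "?h x < ?h y" if "x \<in> {0..1}" "y \<in> {0..1}" "x < y" for x y
    using h1[OF that(1)] h1[OF that(2)] that(3) strict_mono_on_less[OF mf, of "?h x" "?h y"] by metis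
  show ?thesis
  proof (rule thompson_F_I[where B = "f ` Bf" and g = f])
    show "?h \<in> extensional {0..1}" by (rule restrict_extensional)
    show "homeomorphism {0..1} {0..1} ?h f"
      by (rule homeomorphism_cong[OF homeomorphism_symD[OF hf]]) (use eq in auto)
    show "strict_mono_on {0..1} ?h" using less unfolding strict_mono_on_def by blast
    show "finite (f ` Bf)" using Bf by simp
    show "f ` Bf \<subseteq> dyadic_rationals" using thompson_F_dyadic_iff[OF f] Bf(2,3) by blast
    fix a b :: real assume h: "0 \<le> a" "a < b" "b \<le> 1" "{a<..<b} \<inter> f ` Bf = {}"
    have a: "?h a \<in> {0..1}" "f (?h a) = a" and b: "?h b \<in> {0..1}" "f (?h b) = b"
      using h1[of a] h1[of b] h by auto
    have "{?h a<..<?h b} \<inter> Bf = {}"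
    proof (rule ccontr)
      assume "{?h a<..<?h b} \<inter> Bf \<noteq> {}"
      then obtain y where y: "y \<in> Bf" "?h a < y" "y < ?h b"
        unfolding ex_in_conv[symmetric] by (elim exE IntE) (simp only: greaterThanLessThan_iff)
      have "f (?h a) < f y" "f y < f (?h b)"
        using strict_mono_onD[OF mf _ _ y(2)] strict_mono_onD[OF mf _ _ y(3)] y(1) a b Bf(3) by blast+
      then have "f y \<in> {a<..<b} \<inter> f ` Bf" using a b y(1) by auto
      then show False using h(4) by blast
    qed
    moreover have "?h a < ?h b" by (rule less) (use h in auto)
    ultimately have "affine_piece f (?h a) (?h b)"
      using a(1) b(1) unfolding atLeastAtMost_iff by (intro Bf(4)) blast+
    then obtain j c where jc: "\<And>t. t \<in> {?h a..?h b} \<Longrightarrow> f t = 2 powi j * t + c"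
      unfolding affine_piece_def by blast
    have "?h y = 2 powi (- j) * y + (- (2 powi (- j)) * c)" if y: "y \<in> {a..b}" for y
    proof -
      have "y \<in> {0..1}" using y h by auto
      moreover have "?h a \<le> ?h y" using less[of a y] y h by (cases "a = y") fastforce+
      moreover have "?h y \<le> ?h b" using less[of y b] y h by (cases "b = y") fastforce+
      ultimately have "y = 2 powi j * ?h y + c" using jc[of "?h y"] h1[of y] by (metis atLeastAtMost_iff)
      moreover have "v = 2 powi (- j) * w + (- (2 powi (- j)) * c)"
        if "w = 2 powi j * v + c" for v w :: real
        using that by (simp add: power_int_minus field_simps)
      ultimately show ?thesis by blast
    qed
    then show "affine_piece ?h a b" unfolding affine_piece_def by blast
  qed
qed

lemma thompson_F_id: "(\<lambda>x\<in>{0..1}. x) \<in> thompson_F"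
proof (rule thompson_F_I[where B = "{}" and g = "\<lambda>x. x"])
  show "homeomorphism {0..1} {0..1} (\<lambda>x\<in>{0..1}. x) (\<lambda>x::real. x)"
    by (rule homeomorphism_cong[OF homeomorphism_ident]) auto
  fix a b :: real assume "0 \<le> a" "a < b" "b \<le> 1"
  then have "\<forall>x\<in>{a..b}. (\<lambda>x\<in>{0..1}. x) x = 2 powi 0 * x + 0" by auto
  then show "affine_piece (\<lambda>x\<in>{0..1}. x) a b" unfolding affine_piece_def by blast
qed (auto simp: strict_mono_on_def)

lemma subgroup_thompson_F: "subgroup thompson_F (BijGroup {0..1})"
proof -
  interpret group "BijGroup {0..1::real}" by (rule group_BijGroup)
  show ?thesis
  proof (rule subgroup.intro)
    show "thompson_F \<subseteq> carrier (BijGroup {0..1})" using thompson_F_Bij by (auto simp: BijGroup_def)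
    show "x \<otimes>\<^bsub>BijGroup {0..1}\<^esub> y \<in> thompson_F" if "x \<in> thompson_F" "y \<in> thompson_F" for x y
      using that thompson_F_compose thompson_F_Bij by (simp add: BijGroup_def)
    show "\<one>\<^bsub>BijGroup {0..1}\<^esub> \<in> thompson_F" using thompson_F_id by (simp add: BijGroup_def)
    show "inv\<^bsub>BijGroup {0..1}\<^esub> x \<in> thompson_F" if "x \<in> thompson_F" for x
      using that thompson_F_inv thompson_F_Bij inv_BijGroup by metis
  qed
qed

theorem group_thompson_group: "group thompson_group"
  unfolding thompson_group_def
  by (rule subgroup.subgroup_is_group[OF subgroup_thompson_F group_BijGroup])

lemma nonneg_dyadic: 
  assumes "x \<in> dyadic_rationals" "x \<ge> 0" shows "\<exists>p. dyadic p = x"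
proof -
  obtain m n where x: "x = of_int m / 2 ^ n" using assms unfolding dyadic_rationals_def by blast
  have "of_int m = x * 2 ^ n" using x by simp
  then have "(0::real) \<le> of_int m" using assms(2) by simp
  then have "m \<ge> 0" by simp
  then have "dyadic (nat m, n) = x" using x by (simp add: dyadic_def)
  then show ?thesis ..
qed

theorem thompson_F_has_code:
  assumes f: "f \<in> thompson_F" shows "\<exists>c. codes c f"
proof -
  obtain B where B: "finite B" "B \<subseteq> dyadic_rationals" "B \<subseteq> {0..1}"
    "\<And>a b. 0 \<le> a \<Longrightarrow> a < b \<Longrightarrow> b \<le> 1 \<Longrightarrow> {a<..<b} \<inter> B = {} \<Longrightarrow> affine_piece f a b"
    using thompson_F_E[OF f] by metis
  let ?S = "insert 0 (insert 1 B)"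
  define xs where "xs = sorted_list_of_set ?S"
  have S: "finite ?S" "?S \<subseteq> dyadic_rationals" "?S \<subseteq> {0..1}"
    using B zero_dyadic one_dyadic by auto
  have sx: "set xs = ?S" and so: "sorted_wrt (<) xs"
    using set_sorted_list_of_set[OF S(1)] strict_sorted_list_of_set[of ?S] unfolding xs_def by simp_all
  have ne: "xs \<noteq> []" using sx by auto
  have less: "xs ! i < xs ! j" if "i < j" "j < length xs" for i j
    using so that by (simp add: sorted_wrt_nth_less)
  have "hd xs = 0"
  proof -
    obtain i where i: "i < length xs" "xs ! i = 0" using sx by (metis in_set_conv_nth insertI1)
    have "xs ! 0 \<ge> 0" using ne sx S(3) by (metis atLeastAtMost_iff length_greater_0_conv nth_mem subsetD)
    then have "i = 0" using less[of 0 i] i by (cases i) auto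
    then show ?thesis using i ne by (simp add: hd_conv_nth)
  qed
  have "last xs = 1"
  proof -
    obtain i where i: "i < length xs" "xs ! i = 1" using sx by (metis in_set_conv_nth insertI1 insertI2)
    have "xs ! (length xs - 1) \<le> 1" using ne sx S(3)
      by (metis atLeastAtMost_iff last_conv_nth last_in_set subsetD)
    then have "i = length xs - 1" using less[of i "length xs - 1"] i ne by (cases "i < length xs - 1") auto
    then show ?thesis using i ne by (simp add: last_conv_nth)
  qed
  define d where "d = (\<lambda>x. SOME p. dyadic p = x)"
  have d: "dyadic (d x) = x" if "x \<in> dyadic_rationals" "x \<ge> 0" for x
    unfolding d_def using nonneg_dyadic[OF that] by (rule someI_ex)
  define ps where "ps = map (\<lambda>x. (d x, d (f x))) xs"
  have fx: "f x \<in> dyadic_rationals \<and> f x \<ge> 0" if "x \<in> ?S" for x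
    using thompson_F_dyadic_iff[OF f, of x] that S thompson_F_Bij[OF f]
    by (fastforce simp: Bij_def bij_betw_def)
  have dx: "dyadic (d x) = x" "dyadic (d (f x)) = f x" if "x \<in> set xs" for x
    using that S sx fx[of x] by (auto intro!: d)
  have m1: "map (dyadic \<circ> fst) ps = xs" and m2: "map (dyadic \<circ> snd) ps = map f xs"
    unfolding ps_def by (auto simp: dx intro!: map_idI)
  have "affine_piece f (xs ! i) (xs ! Suc i)" if i: "Suc i < length ps" for i
  proof (rule B(4))
    have il: "Suc i < length xs" using i by (simp add: ps_def)
    have "xs ! i \<in> ?S" "xs ! Suc i \<in> ?S" using il sx nth_mem by (metis Suc_lessD)+
    then show "0 \<le> xs ! i" "xs ! Suc i \<le> 1" using S(3) by auto
    show "xs ! i < xs ! Suc i" using less il by simp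
    show "{xs ! i<..<xs ! Suc i} \<inter> B = {}"
    proof (rule ccontr)
      assume "{xs ! i<..<xs ! Suc i} \<inter> B \<noteq> {}"
      then obtain q where q: "q \<in> B" "xs ! i < q" "q < xs ! Suc i" by auto
      then obtain j where j: "j < length xs" "q = xs ! j" using sx by (metis in_set_conv_nth insertI2)
      have "i < j" using q j less[of j i] il by (cases "i < j"; cases "i = j") auto
      moreover have "j < Suc i" using q j less[of "Suc i" j] il by (cases "j < Suc i"; cases "j = Suc i") auto
      ultimately show False by simp
    qed
  qed
  then have "describes ps f"
    unfolding describes_def Let_def m1 m2
    using f ne so \<open>hd xs = 0\<close> \<open>last xs = 1\<close> by (auto simp: ps_def)
  then show ?thesis unfolding codes_def by blast
qed

theorem codes_unique:
  assumes "codes c f" "codes c g" shows "f = g"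
proof -
  obtain ps where f: "c = encode_description ps" "describes ps f" using assms codes_def by blast
  obtain qs where g: "c = encode_description qs" "describes qs g" using assms codes_def by blast
  have "inj (\<lambda>(p, q). prod_encode (prod_encode p, prod_encode q))"
    by (auto simp: inj_def)
  then have "ps = qs"
    using f g unfolding encode_description_def by (metis (no_types, lifting) inj_map_eq_map list_encode_eq)
  then have g': "describes ps g" using g by simp
  define xs where "xs = map (dyadic \<circ> fst) ps"
  have ff: "f \<in> thompson_F" and gg: "g \<in> thompson_F" and ne: "xs \<noteq> []" and e: "hd xs = 0" "last xs = 1"
    and so: "sorted_wrt (<) xs"
    and v: "\<And>i. i < length xs \<Longrightarrow> f (xs ! i) = g (xs ! i)"
    and af: "\<And>i. Suc i < length xs \<Longrightarrow> affine_piece f (xs ! i) (xs ! Suc i)"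
    and ag: "\<And>i. Suc i < length xs \<Longrightarrow> affine_piece g (xs ! i) (xs ! Suc i)"
    using f(2) g' unfolding describes_def Let_def xs_def by auto
  have "f x = g x" if x: "x \<in> {0..1}" for x
  proof (cases "x \<in> set xs")
    case True then show ?thesis using v by (metis in_set_conv_nth)
  next
    case False
    define P where "P = (\<lambda>i. i < length xs \<and> xs ! i \<le> x)"
    have P0: "P 0" using ne e x by (auto simp: P_def hd_conv_nth)
    define i where "i = (GREATEST i. P i)"
    have Pi: "P i" unfolding i_def by (rule GreatestI_nat[where P = P and b = "length xs", OF P0]) (auto simp: P_def)
    have mx: "k \<le> i" if "P k" for k unfolding i_def by (rule Greatest_le_nat[where P = P and b = "length xs", OF that]) (auto simp: P_def)
    have si: "Suc i < length xs"
    proof (rule ccontr)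
      assume "\<not> Suc i < length xs"
      then have "i = length xs - 1" using Pi by (auto simp: P_def)
      then have "xs ! i = 1" using e ne by (simp add: last_conv_nth)
      then have "x = xs ! i" using Pi x by (auto simp: P_def)
      then show False using False Pi by (auto simp: P_def)
    qed
    have lt: "xs ! i \<le> x" "x < xs ! Suc i" using Pi mx[of "Suc i"] si by (force simp: P_def not_le)+
    obtain j c where F: "\<forall>t\<in>{xs ! i..xs ! Suc i}. f t = 2 powi j * t + c" using af[OF si] affine_piece_def by blast
    obtain j' c' where G: "\<forall>t\<in>{xs ! i..xs ! Suc i}. g t = 2 powi j' * t + c'" using ag[OF si] affine_piece_def by blast
    have "2 powi j * (xs ! i) + c = 2 powi j' * (xs ! i) + c'"
      "2 powi j * (xs ! Suc i) + c = 2 powi j' * (xs ! Suc i) + c'"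
      using F G v[of i] v[of "Suc i"] si lt by auto
    then have "(2 powi j - 2 powi j') * (xs ! Suc i - xs ! i) = 0" by (simp add: algebra_simps)
    then have "2 powi j = (2 powi j' :: real)" using lt by auto
    moreover from this have "c = c'" using \<open>2 powi j * (xs ! i) + c = _\<close> by simp
    ultimately show ?thesis using F G lt by auto
  qed
  then show ?thesis using ff gg unfolding thompson_F_def by (auto intro: extensionalityI)
qed
end

theory Submission
  imports Defs
begin

text \<open>
  Conjugators can be bounded. Say that a map has level \<open>N\<close> if it is affine on each cell of the dyadic
  grid of mesh \<open>1 / 2 ^ N\<close>, with offsets in the grid and powers of 2 between \<open>1 / 2 ^ N\<close> and \<open>2 ^ N\<close> as slopes. If two
  tuples of maps of level \<open>N\<close> (with inverses of level \<open>N\<close>) are conjugate in Thompson's group, then some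
  conjugator has level \<open>conjugator_bound N\<close>, where \<open>conjugator_bound\<close> is a computable function: this is
  \<open>bounded_conjugator\<close>. A code bounds the level of its map, and a bound on the level bounds some code. So
  the conjugacy problem is decided by testing all codes below a computable bound, and conjugators
  are enumerated by testing all numbers. The equation \<open>y (g x) = g (z x)\<close> between maps of known level
  is tested on a finite grid.

  The bound arises as follows. A conjugator \<open>g\<close> maps the common fixed points of the maps \<open>z\<close> to those of the
  maps \<open>y\<close>. Let \<open>[p, p']\<close> be an interval between successive common fixed points of the \<open>z\<close>. Near \<open>p\<close>
  all maps are linear, and \<open>g\<close> is linear as far as they are (\<open>linear_right\<close>). From \<open>[p, c]\<close> the values of \<open>g\<close>
  propagate to \<open>[p, z c]\<close> by \<open>g = y g z\<^sup>-\<^sup>1\<close>. Every point is moved by some map, and by a definite amount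
  unless it is close to an end (\<open>gap\<close>); so after a bounded number of steps the linear part near \<open>p'\<close> is
  reached. Hence the slope of \<open>g\<close> at \<open>p\<close> bounds its level on the whole interval (\<open>moving_bound\<close>).

  It remains to bound one slope. If two of the maps do not commute on \<open>[p, p']\<close>, then \<open>g\<close> maps the
  first point where \<open>z\<^sub>1 z\<^sub>2\<close> and \<open>z\<^sub>2 z\<^sub>1\<close> differ to the first point where \<open>y\<^sub>1 y\<^sub>2\<close> and \<open>y\<^sub>2 y\<^sub>1\<close> differ.
  Moved towards \<open>p\<close>, this known point of the graph determines the slope (\<open>noncommuting_slope\<close>). If all maps
  commute, then composing \<open>g\<close> with one of them gives another conjugator, and in this way the slope is made
  small (\<open>commuting_adjust\<close>).

  At a common fixed point that is not dyadic, \<open>g\<close> has no breakpoint, so a bound on its slope passes from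
  one interval to the next (\<open>chain_spread\<close>). At a dyadic one the two sides are independent: in the
  commuting case \<open>g\<close> is therefore changed on a whole chain of intervals between dyadic fixed points. Where all
  points are fixed, any map will do (\<open>interval_map\<close>).
\<close>

section \<open>Powers of two and dyadic grids\<close>

lemma two_powi_add: "(2::real) powi (i + j) = 2 powi i * 2 powi j"
  by (simp add: power_int_add)

lemma two_powi_minus: "(2::real) powi (- i) * 2 powi i = 1" "(2::real) powi i * 2 powi (- i) = 1"
  using two_powi_add[of "-i" i] two_powi_add[of i "-i"] by simp_all

lemma two_powi_nat: "0 \<le> i \<Longrightarrow> (2::real) powi i = 2 ^ nat i"
  by (simp add: power_int_nonneg_exp)

lemma two_powi_mono: "i \<le> j \<Longrightarrow> (2::real) powi i \<le> 2 powi j"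
  by (rule power_int_increasing) auto

lemma two_powi_inj: "(2::real) powi i = 2 powi j \<Longrightarrow> i = j"
  using power_int_strict_increasing[of i j "2::real"] power_int_strict_increasing[of j i "2::real"]
  by (cases i j rule: linorder_cases) auto

lemma two_powi_bounds:
  assumes "\<bar>j\<bar> \<le> int d" shows "(2::real) powi j \<le> 2 ^ d" "1 / 2 ^ d \<le> (2::real) powi j"
proof -
  show "(2::real) powi j \<le> 2 ^ d" using two_powi_mono[of j "int d"] assms by simp
  have "(2::real) powi (- int d) \<le> 2 powi j" by (rule two_powi_mono) (use assms in auto)
  then show "1 / 2 ^ d \<le> (2::real) powi j" by (simp add: power_int_minus divide_inverse)
qed

lemma two_powi_boundsD:
  assumes "(2::real) powi j \<le> 2 ^ d" "1 / 2 ^ d \<le> (2::real) powi j" shows "\<bar>j\<bar> \<le> int d"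
proof (rule ccontr)
  assume "\<not> \<bar>j\<bar> \<le> int d"
  then consider "int d < j" | "j < - int d" by linarith
  then show False
  proof cases
    case 1 then show False using power_int_strict_increasing[of "int d" j "2::real"] assms by simp
  next
    case 2 then show False using power_int_strict_increasing[of j "- int d" "2::real"] assms
      by (simp add: power_int_minus divide_inverse)
  qed
qed

text \<open>
  Slope and offset of a map on a cell are read off from any two of its points. All gluing arguments
  rest on this: pieces that overlap in more than one point carry the same formula.
\<close>

lemma affine_unique:
  fixes x y a b :: real
  assumes "x \<noteq> y" "2 powi j * x + a = 2 powi j' * x + b" "2 powi j * y + a = 2 powi j' * y + b"
  shows "j = j'" "a = b"
proof -
  have "(2 powi j - 2 powi j') * (x - y) = 0" using assms(2,3) by (simp add: algebra_simps)
  then have "2 powi j = (2 powi j' :: real)" using assms(1) by simp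
  then show "j = j'" by (rule two_powi_inj)
  then show "a = b" using assms(2) by simp
qed

definition grid :: "nat \<Rightarrow> real set" where "grid M = {x. x * 2 ^ M \<in> \<int>}"

lemma gridI: "x * 2 ^ M \<in> \<int> \<Longrightarrow> x \<in> grid M" and gridD: "x \<in> grid M \<Longrightarrow> x * 2 ^ M \<in> \<int>"
  by (auto simp: grid_def)

lemma grid_E: assumes "x \<in> grid M" obtains i :: int where "x = of_int i / 2 ^ M"
  using gridD[OF assms] by (auto elim!: Ints_cases simp: field_simps)

lemma grid_frac [simp]: "of_int i / 2 ^ M \<in> grid M" by (simp add: grid_def)

lemma grid_add: "x \<in> grid M \<Longrightarrow> y \<in> grid M \<Longrightarrow> x + y \<in> grid M"
  and grid_diff: "x \<in> grid M \<Longrightarrow> y \<in> grid M \<Longrightarrow> x - y \<in> grid M"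
  by (auto simp: grid_def algebra_simps)

lemma grid_of_int [simp]: "of_int i \<in> grid M"
  using Ints_of_int[of "i * 2 ^ M"] by (simp add: grid_def)

lemma grid_01 [simp]: "0 \<in> grid M" "1 \<in> grid M"
  using grid_of_int[of 0 M] grid_of_int[of 1 M] by simp_all

lemma grid_mono: assumes "x \<in> grid M" "M \<le> M'" shows "x \<in> grid M'"
proof -
  have "x * 2 ^ M' = x * 2 ^ M * of_int (2 ^ (M' - M))" using assms(2) by (simp flip: power_add)
  then show ?thesis using assms(1) unfolding grid_def by (metis Ints_mult Ints_of_int mem_Collect_eq)
qed

lemma grid_powi: assumes "x \<in> grid M" "- int d \<le> j" shows "2 powi j * x \<in> grid (M + d)"
proof -
  have "(2::real) powi j * 2 ^ d = 2 powi (j + int d)" by (simp add: two_powi_add)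
  also have "\<dots> = of_int (2 ^ nat (j + int d))" using assms(2) by (simp add: two_powi_nat)
  finally have "2 powi j * x * 2 ^ (M + d) = x * 2 ^ M * of_int (2 ^ nat (j + int d))"
    by (simp add: power_add mult.assoc mult.left_commute)
  then show ?thesis using assms(1) unfolding grid_def by (metis Ints_mult Ints_of_int mem_Collect_eq)
qed

lemma grid_less_sep: assumes "x \<in> grid M" "y \<in> grid M" "x < y" shows "x + 1 / 2 ^ M \<le> y"
proof -
  obtain i j where ij: "x = of_int i / 2 ^ M" "y = of_int j / 2 ^ M" using assms grid_E by metis
  then have "i < j" using assms(3) by (simp add: divide_less_cancel)
  then have "(of_int i + 1 :: real) \<le> of_int j" by linarith
  then have "(of_int i + 1) / 2 ^ M \<le> (of_int j :: real) / 2 ^ M" by (simp add: divide_right_mono)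
  then show ?thesis unfolding ij by (simp add: add_divide_distrib)
qed

text \<open>
  The cells of level \<open>M\<close> are the closed intervals between consecutive points of \<^term>\<open>grid M\<close>. The
  index is an integer and the cell is not cut off at 0 and 1, so that no case distinctions arise at
  the ends of the unit interval.
\<close>

definition in_cell :: "nat \<Rightarrow> int \<Rightarrow> real \<Rightarrow> bool" where
  "in_cell M i x \<longleftrightarrow> of_int i \<le> x * 2 ^ M \<and> x * 2 ^ M \<le> of_int i + 1"

lemma in_cell_iff: "in_cell M i x \<longleftrightarrow> of_int i / 2 ^ M \<le> x \<and> x \<le> (of_int i + 1) / 2 ^ M"
  by (simp add: in_cell_def field_simps)

lemma in_cell_floor: "in_cell M \<lfloor>x * 2 ^ M\<rfloor> x"
  unfolding in_cell_def by linarith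

lemma in_cell_convex: "in_cell M i x \<Longrightarrow> in_cell M i y \<Longrightarrow> x \<le> t \<Longrightarrow> t \<le> y \<Longrightarrow> in_cell M i t"
  unfolding in_cell_iff by linarith

lemma div_cell:
  fixes t :: real assumes "of_int a \<le> t" "t \<le> of_int a + 1"
  shows "of_int (a div 2 ^ d) \<le> t / 2 ^ d" "t / 2 ^ d \<le> of_int (a div 2 ^ d) + 1"
proof -
  define b where "b = a div 2 ^ d"
  have "b * 2 ^ d \<le> a" "a < (b + 1) * 2 ^ d"
  proof -
    have "b * 2 ^ d + a mod 2 ^ d = a" unfolding b_def by (rule div_mult_mod_eq)
    moreover have "0 \<le> a mod 2 ^ d" "a mod 2 ^ d < 2 ^ d" by (simp_all add: pos_mod_sign pos_mod_bound)
    ultimately show "b * 2 ^ d \<le> a" "a < (b + 1) * 2 ^ d" unfolding distrib_right by linarith+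
  qed
  then have "b * 2 ^ d \<le> a" "a + 1 \<le> (b + 1) * 2 ^ d" by auto
  then have "of_int (b * 2 ^ d) \<le> (of_int a :: real)" "of_int (a + 1) \<le> (of_int ((b + 1) * 2 ^ d) :: real)"
    by (simp_all only: of_int_le_iff)
  then have "of_int b * 2 ^ d \<le> t" "t \<le> (of_int b + 1) * 2 ^ d" using assms by auto
  then show "of_int (a div 2 ^ d) \<le> t / 2 ^ d" "t / 2 ^ d \<le> of_int (a div 2 ^ d) + 1"
    unfolding b_def[symmetric] by (simp_all add: field_simps)
qed

text \<open>
  Cells are nested, because the endpoints of the coarser cells are grid points of the finer level.
\<close>

lemma in_cell_coarse:
  assumes "M \<le> M'" "in_cell M' i x" shows "in_cell M (i div 2 ^ (M' - M)) x"
proof -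
  have "x * 2 ^ M' / 2 ^ (M' - M) = x * 2 ^ M"
    using assms(1) by (simp add: power_diff field_simps)
  then show ?thesis using div_cell[of i "x * 2 ^ M'" "M' - M"] assms(2) unfolding in_cell_def by simp
qed

lemma unit_cell:
  fixes x :: real assumes "0 \<le> x" "x < 1"
  shows "0 \<le> \<lfloor>x * 2 ^ K\<rfloor>" "\<lfloor>x * 2 ^ K\<rfloor> + 1 \<le> 2 ^ K"
    "of_int \<lfloor>x * 2 ^ K\<rfloor> / 2 ^ K \<in> {0..1::real}" "of_int (\<lfloor>x * 2 ^ K\<rfloor> + 1) / 2 ^ K \<in> {0..1::real}"
proof -
  define i where "i = \<lfloor>x * 2 ^ K\<rfloor>"
  have i0: "0 \<le> i" using assms by (simp add: i_def)
  have "i < 2 ^ K" unfolding i_def floor_less_iff using assms by simp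
  then have i1: "i + 1 \<le> 2 ^ K" by linarith
  then have "of_int (i + 1) \<le> (of_int (2 ^ K) :: real)" by (simp only: of_int_le_iff)
  then have "of_int (i + 1) / 2 ^ K \<le> (1::real)" by simp
  moreover have "of_int i / 2 ^ K \<le> of_int (i + 1) / (2 ^ K :: real)" by (intro divide_right_mono) auto
  moreover have "(0::real) \<le> of_int i / 2 ^ K" using i0 by simp
  ultimately have "of_int i / 2 ^ K \<in> {0..1::real} \<and> of_int (i + 1) / 2 ^ K \<in> {0..1::real}"
    unfolding atLeastAtMost_iff by linarith
  then show "0 \<le> \<lfloor>x * 2 ^ K\<rfloor>" "\<lfloor>x * 2 ^ K\<rfloor> + 1 \<le> 2 ^ K"
    "of_int \<lfloor>x * 2 ^ K\<rfloor> / 2 ^ K \<in> {0..1::real}" "of_int (\<lfloor>x * 2 ^ K\<rfloor> + 1) / 2 ^ K \<in> {0..1::real}"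
    using i0 i1 by (simp_all add: i_def)
qed

section \<open>Maps of bounded level\<close>

text \<open>
  A map of level \<open>M\<close> is affine on every cell of level \<open>M\<close>, with a slope \<open>2 powi j\<close>, \<open>\<bar>j\<bar> \<le> M\<close>, and
  an offset in \<^term>\<open>grid M\<close>. One number thus bounds the slopes, the depth of the breakpoints and the
  depth of the values, and only finitely many maps of the unit interval have a given level. The set
  \<open>A\<close> lets a conjugator be controlled on a part of the interval, whose ends need not be dyadic.
\<close>

definition level :: "nat \<Rightarrow> (real \<Rightarrow> real) \<Rightarrow> real set \<Rightarrow> bool" where
  "level M f A \<longleftrightarrow> (\<forall>i. \<exists>j c. \<bar>j\<bar> \<le> int M \<and> c \<in> grid M \<and>
     (\<forall>x\<in>A. in_cell M i x \<longrightarrow> f x = 2 powi j * x + c))"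

lemma levelI:
  assumes "\<And>i. \<exists>j c. \<bar>j\<bar> \<le> int M \<and> c \<in> grid M \<and> (\<forall>x\<in>A. in_cell M i x \<longrightarrow> f x = 2 powi j * x + c)"
  shows "level M f A" using assms unfolding level_def by blast

lemma levelE:
  assumes "level M f A"
  obtains j c where "\<bar>j\<bar> \<le> int M" "c \<in> grid M" "\<And>x. x \<in> A \<Longrightarrow> in_cell M i x \<Longrightarrow> f x = 2 powi j * x + c"
  using assms unfolding level_def by meson

lemma level_subset: "level M f A \<Longrightarrow> B \<subseteq> A \<Longrightarrow> level M f B"
  unfolding level_def by (meson subsetD)

lemma level_cong: "level M f A \<Longrightarrow> (\<And>x. x \<in> A \<Longrightarrow> f x = h x) \<Longrightarrow> level M h A"
  unfolding level_def by (metis (no_types, lifting))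

lemma level_mono: assumes "level M f A" "M \<le> M'" shows "level M' f A"
proof (rule levelI)
  fix i
  obtain j c where jc: "\<bar>j\<bar> \<le> int M" "c \<in> grid M"
    "\<And>x. x \<in> A \<Longrightarrow> in_cell M (i div 2 ^ (M' - M)) x \<Longrightarrow> f x = 2 powi j * x + c" using levelE[OF assms(1)] by metis
  show "\<exists>j c. \<bar>j\<bar> \<le> int M' \<and> c \<in> grid M' \<and> (\<forall>x\<in>A. in_cell M' i x \<longrightarrow> f x = 2 powi j * x + c)"
    by (intro exI[of _ j] exI[of _ c] conjI ballI impI)
       (use jc assms(2) grid_mono in_cell_coarse in auto)
qed

lemma level_affine: "\<bar>j\<bar> \<le> int M \<Longrightarrow> c \<in> grid M \<Longrightarrow> (\<And>x. x \<in> A \<Longrightarrow> f x = 2 powi j * x + c) \<Longrightarrow> level M f A"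
  by (rule levelI) auto

text \<open>
  A cell of level \<open>N + 2 * M\<close> is so small that its image under \<open>g\<close> is an interval
  \<open>[a / 2 ^ E, (a + 1) / 2 ^ E]\<close> with \<open>E \<ge> N\<close> and an integer \<open>a\<close>, hence lies in one cell of level \<open>N\<close>.
\<close>

lemma level_comp:
  assumes g: "level M g A" and f: "level N f (g ` A)" shows "level (N + 2 * M) (\<lambda>x. f (g x)) A"
proof (rule levelI)
  fix i
  \<comment> \<open>the image of a cell of level \<open>K\<close> has length \<open>1 / 2 ^ E\<close>\<close>
  define K where "K = N + 2 * M"
  have KM: "M \<le> K" by (simp add: K_def)
  obtain j c where j: "\<bar>j\<bar> \<le> int M" and c: "c \<in> grid M"
    and gx: "\<And>x. x \<in> A \<Longrightarrow> in_cell M (i div 2 ^ (K - M)) x \<Longrightarrow> g x = 2 powi j * x + c" using levelE[OF g] by metis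
  define E where "E = nat (int K - j)"
  have E: "int E = int K - j" "M \<le> E" "N \<le> E" using j by (auto simp: E_def K_def)
  have cE: "c * 2 ^ E \<in> \<int>" using grid_mono[OF c E(2)] by (rule gridD)
  then obtain e where e: "c * 2 ^ E = of_int e" by (auto elim: Ints_cases)
  define i' where "i' = (i + e) div 2 ^ (E - N)"
  obtain j' c' where j': "\<bar>j'\<bar> \<le> int N" and c': "c' \<in> grid N"
    and fx: "\<And>x. x \<in> g ` A \<Longrightarrow> in_cell N i' x \<Longrightarrow> f x = 2 powi j' * x + c'" using levelE[OF f] by metis
  have "f (g x) = 2 powi (j' + j) * x + (2 powi j' * c + c')" if x: "x \<in> A" "in_cell K i x" for x
  proof -
    have gx': "g x = 2 powi j * x + c" using gx[OF x(1)] in_cell_coarse[OF KM x(2)] by blast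
    have "(2::real) powi j * 2 ^ E = 2 powi (j + int E)" by (simp add: two_powi_add)
    also have "\<dots> = 2 ^ K" using E(1) by simp
    finally have pw: "(2::real) powi j * 2 ^ E = 2 ^ K" .
    have "g x * 2 ^ E = x * (2 powi j * 2 ^ E) + c * 2 ^ E" unfolding gx' by (simp add: algebra_simps)
    then have "g x * 2 ^ E = x * 2 ^ K + of_int e" unfolding pw e .
    then have "in_cell E (i + e) (g x)" using x(2) unfolding in_cell_def by simp
    then have "in_cell N i' (g x)" unfolding i'_def by (rule in_cell_coarse[OF E(3)])
    then have "f (g x) = 2 powi j' * g x + c'" using fx x by blast
    then show ?thesis unfolding gx' by (simp add: two_powi_add algebra_simps)
  qed
  moreover have "2 powi j' * c + c' \<in> grid K"
  proof (rule grid_add)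
    have "2 powi j' * c \<in> grid (M + N)" using c j' by (intro grid_powi) auto
    then show "2 powi j' * c \<in> grid K" by (rule grid_mono) (simp add: K_def)
    show "c' \<in> grid K" using c' by (rule grid_mono) (simp add: K_def)
  qed
  moreover have "\<bar>j' + j\<bar> \<le> int K" using j j' by (simp add: K_def)
  ultimately show "\<exists>j c. \<bar>j\<bar> \<le> int (N + 2 * M) \<and> c \<in> grid (N + 2 * M) \<and>
      (\<forall>x\<in>A. in_cell (N + 2 * M) i x \<longrightarrow> f (g x) = 2 powi j * x + c)"
    unfolding K_def[symmetric] by blast
qed

text \<open>
  On each cell the slopes lie between \<open>1 / 2 ^ M\<close> and \<open>2 ^ M\<close>; the estimates add up over the cells
  between \<open>x\<close> and \<open>y\<close>. Monotonicity and continuity of such maps follow from these two bounds.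
\<close>

lemma level_slope:
  assumes f: "level M f {a..b}" and ab: "a \<le> x" "x \<le> y" "y \<le> b"
  shows "f y - f x \<le> 2 ^ M * (y - x)" "(y - x) / 2 ^ M \<le> f y - f x"
proof -
  have "f y - f x \<le> 2 ^ M * (y - x) \<and> (y - x) / 2 ^ M \<le> f y - f x"
    if "nat (\<lfloor>y * 2 ^ M\<rfloor> - \<lfloor>x * 2 ^ M\<rfloor>) \<le> n" "a \<le> x" "x \<le> y" "y \<le> b" for n x
    using that
  proof (induction n arbitrary: x)
    have same: "f y - f x \<le> 2 ^ M * (y - x) \<and> (y - x) / 2 ^ M \<le> f y - f x"
      if "in_cell M i x" "in_cell M i y" "x \<in> {a..b}" "y \<in> {a..b}" "x \<le> y" for i x y
    proof -
      obtain j c where j: "\<bar>j\<bar> \<le> int M" and fx: "\<And>x. x \<in> {a..b} \<Longrightarrow> in_cell M i x \<Longrightarrow> f x = 2 powi j * x + c"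
        using levelE[OF f] by metis
      have "f y - f x = 2 powi j * (y - x)" using fx that by (simp add: algebra_simps)
      moreover have "2 powi j * (y - x) \<le> 2 ^ M * (y - x)" "1 / 2 ^ M * (y - x) \<le> 2 powi j * (y - x)"
        using two_powi_bounds[OF j] that by (intro mult_right_mono; simp)+
      ultimately show ?thesis by simp
    qed
    {
      case 0
      have "\<lfloor>x * 2 ^ M\<rfloor> \<le> \<lfloor>y * 2 ^ M\<rfloor>" using 0 by (intro floor_mono) simp
      then have "\<lfloor>x * 2 ^ M\<rfloor> = \<lfloor>y * 2 ^ M\<rfloor>" using 0 by simp
      then show ?case using same[of "\<lfloor>x * 2 ^ M\<rfloor>" x y] in_cell_floor[of M x] in_cell_floor[of M y] 0 by simp
    next
      case (Suc n)
      define i where "i = \<lfloor>x * 2 ^ M\<rfloor>"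
      show ?case
      proof (cases "in_cell M i y")
        case True then show ?thesis using same[of i x y] in_cell_floor[of M x] Suc.prems by (simp add: i_def)
      next
        case False
        define w where "w = (of_int i + 1) / (2 ^ M :: real)"
        have w2: "w * 2 ^ M = of_int (i + 1)" by (simp add: w_def)
        have ic: "in_cell M i x" unfolding i_def by (rule in_cell_floor)
        then have xw: "x \<le> w" by (simp add: in_cell_iff w_def)
        have iy: "of_int i / 2 ^ M \<le> y" using ic Suc.prems unfolding in_cell_iff by linarith
        then have wy: "w < y" using False unfolding in_cell_iff w_def by linarith
        have "in_cell M i w" unfolding in_cell_def w2 by simp
        then have 1: "f w - f x \<le> 2 ^ M * (w - x) \<and> (w - x) / 2 ^ M \<le> f w - f x"
          using same[of i x w] ic xw wy Suc.prems by simp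
        have "\<lfloor>w * 2 ^ M\<rfloor> = i + 1" unfolding w2 by simp
        moreover have "i + 1 \<le> \<lfloor>y * 2 ^ M\<rfloor>" using wy w2 by (simp add: le_floor_iff w_def field_simps)
        ultimately have "nat (\<lfloor>y * 2 ^ M\<rfloor> - \<lfloor>w * 2 ^ M\<rfloor>) \<le> n" using Suc.prems(1) by (simp add: i_def)
        then have 2: "f y - f w \<le> 2 ^ M * (y - w) \<and> (y - w) / 2 ^ M \<le> f y - f w"
          using Suc.IH[of w] xw wy Suc.prems by simp
        have "2 ^ M * (w - x) + 2 ^ M * (y - w) = 2 ^ M * (y - x)" by (simp add: algebra_simps)
        moreover have "(w - x) / 2 ^ M + (y - w) / 2 ^ M = (y - x) / 2 ^ M" by (simp add: field_simps)
        ultimately show ?thesis using 1 2 by linarith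
      qed
    }
  qed
  then show "f y - f x \<le> 2 ^ M * (y - x)" "(y - x) / 2 ^ M \<le> f y - f x" using ab by blast+
qed

lemma level_strict: assumes "level M f {a..b}" "a \<le> x" "x < y" "y \<le> b" shows "f x < f y"
proof -
  have "0 < (y - x) / 2 ^ M" using assms by simp
  then show ?thesis using level_slope(2)[of M f a b x y] assms by linarith
qed

lemma level_less_iff: assumes "level M f {a..b}" "x \<in> {a..b}" "y \<in> {a..b}" shows "f x < f y \<longleftrightarrow> x < y"
  using assms level_strict[OF assms(1), of x y] level_strict[OF assms(1), of y x] by (cases x y rule: linorder_cases) auto

lemma level_le_iff: assumes "level M f {a..b}" "x \<in> {a..b}" "y \<in> {a..b}" shows "f x \<le> f y \<longleftrightarrow> x \<le> y"
  using level_less_iff[OF assms(1,3,2)] by linarith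

lemma level_eq_iff: assumes "level M f {a..b}" "x \<in> {a..b}" "y \<in> {a..b}" shows "f x = f y \<longleftrightarrow> x = y"
  using level_less_iff[OF assms] level_less_iff[OF assms(1,3,2)] by (cases x y rule: linorder_cases) auto

lemma level_continuous: assumes f: "level M f {a..b}" shows "continuous_on {a..b} f"
proof -
  have *: "dist (f x) (f y) \<le> 2 ^ M * dist x y" if "x \<in> {a..b}" "y \<in> {a..b}" "x \<le> y" for x y
    using level_slope(1)[OF f, of x y] level_le_iff[OF f, of x y] that by (simp add: dist_real_def)
  have "dist (f x) (f y) \<le> 2 ^ M * dist x y" if "x \<in> {a..b}" "y \<in> {a..b}" for x y
    using *[of x y] *[of y x] that by (cases "x \<le> y") (simp_all add: dist_commute)
  then have "(2 ^ M)-lipschitz_on {a..b} f" by (intro lipschitz_onI) auto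
  then show ?thesis by (rule lipschitz_on_continuous_on)
qed

lemma level_image: assumes f: "level M f {a..b}" and "a \<le> b" shows "f ` {a..b} = {f a..f b}"
proof
  show "f ` {a..b} \<subseteq> {f a..f b}" using level_le_iff[OF f] assms(2) by auto
  show "{f a..f b} \<subseteq> f ` {a..b}"
  proof
    fix y assume "y \<in> {f a..f b}"
    then show "y \<in> f ` {a..b}" using IVT'[of f a y b] level_continuous[OF f] assms(2) by fastforce
  qed
qed

lemma level_glue:
  assumes "level M f {a..b}" "level M f {b..c}" "b \<in> grid M" shows "level M f {a..c}"
proof (rule levelI)
  fix i :: int
  obtain k where k: "b = of_int k / 2 ^ M" using assms(3) grid_E by metis
  have sep: "x \<le> b" if "i < k" "in_cell M i x" for x
  proof -
    have "(of_int i + 1 :: real) \<le> of_int k" using that(1) by linarith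
    then have "(of_int i + 1) / 2 ^ M \<le> b" unfolding k by (simp add: divide_right_mono)
    then show ?thesis using that(2) unfolding in_cell_iff by linarith
  qed
  have sep': "b \<le> x" if "\<not> i < k" "in_cell M i x" for x
  proof -
    have "(of_int k :: real) \<le> of_int i" using that(1) by linarith
    then have "b \<le> of_int i / 2 ^ M" unfolding k by (simp add: divide_right_mono)
    then show ?thesis using that(2) unfolding in_cell_iff by linarith
  qed
  obtain j1 c1 where 1: "\<bar>j1\<bar> \<le> int M" "c1 \<in> grid M"
    "\<And>x. x \<in> {a..b} \<Longrightarrow> in_cell M i x \<Longrightarrow> f x = 2 powi j1 * x + c1" using levelE[OF assms(1)] by metis
  obtain j2 c2 where 2: "\<bar>j2\<bar> \<le> int M" "c2 \<in> grid M"
    "\<And>x. x \<in> {b..c} \<Longrightarrow> in_cell M i x \<Longrightarrow> f x = 2 powi j2 * x + c2" using levelE[OF assms(2)] by metis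
  show "\<exists>j c'. \<bar>j\<bar> \<le> int M \<and> c' \<in> grid M \<and> (\<forall>x\<in>{a..c}. in_cell M i x \<longrightarrow> f x = 2 powi j * x + c')"
  proof (cases "i < k")
    case True then show ?thesis using 1 sep[OF True] by (intro exI[of _ j1] exI[of _ c1]) auto
  next
    case False then show ?thesis using 2 sep'[OF False] by (intro exI[of _ j2] exI[of _ c2]) auto
  qed
qed

text \<open>
  Here the pieces are joined at a point \<open>c\<close> that need not be a grid point. The overlap \<open>[d, c]\<close>
  forces the affine formula to agree with the formula on the cell to the left of \<open>c\<close>, which bounds
  its slope and offset.
\<close>

lemma level_extend_affine:
  assumes f: "level M f {a..c}" and h: "\<And>x. d \<le> x \<Longrightarrow> x \<le> b \<Longrightarrow> f x = 2 powi j * x + e"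
    and le: "a \<le> d" "d < c" "c \<le> b"
  shows "level M f {a..b}"
proof -
  \<comment> \<open>the cell to the left of \<open>c\<close>, also when \<open>c\<close> is a grid point\<close>
  define i0 where "i0 = \<lceil>c * 2 ^ M\<rceil> - 1"
  have i0: "of_int i0 < c * 2 ^ M" "c * 2 ^ M \<le> of_int i0 + 1" unfolding i0_def by linarith+
  have i0': "of_int i0 / 2 ^ M < c" "c \<le> (of_int i0 + 1) / 2 ^ M" using i0 by (simp_all add: field_simps)
  define l where "l = max d (of_int i0 / 2 ^ M)"
  have l: "l < c" "d \<le> l" using i0' le by (auto simp: l_def)
  have cells: "in_cell M i0 l" "in_cell M i0 c" using i0' l by (auto simp: in_cell_iff l_def)
  have agree: "j1 = j \<and> e1 = e"
    if "\<And>x. x \<in> {a..c} \<Longrightarrow> in_cell M i0 x \<Longrightarrow> f x = 2 powi j1 * x + e1" for j1 e1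
    using that[of l] that[of c] h[of l] h[of c] l le cells affine_unique[of l c j1 e1 j e] by auto
  obtain j1 e1 where 1: "\<bar>j1\<bar> \<le> int M" "e1 \<in> grid M"
    "\<And>x. x \<in> {a..c} \<Longrightarrow> in_cell M i0 x \<Longrightarrow> f x = 2 powi j1 * x + e1" using levelE[OF f] by metis
  then have je: "\<bar>j\<bar> \<le> int M" "e \<in> grid M" using agree[OF 1(3)] by auto
  show ?thesis
  proof (rule levelI)
    fix i
    obtain j2 e2 where 2: "\<bar>j2\<bar> \<le> int M" "e2 \<in> grid M"
      "\<And>x. x \<in> {a..c} \<Longrightarrow> in_cell M i x \<Longrightarrow> f x = 2 powi j2 * x + e2" using levelE[OF f] by metis
    show "\<exists>j c'. \<bar>j\<bar> \<le> int M \<and> c' \<in> grid M \<and> (\<forall>x\<in>{a..b}. in_cell M i x \<longrightarrow> f x = 2 powi j * x + c')"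
    proof (cases "i < i0")
      case True
      have "x \<le> c" if "in_cell M i x" for x
      proof -
        have "(of_int i + 1 :: real) \<le> of_int i0" using True by linarith
        then have "(of_int i + 1) / 2 ^ M \<le> (of_int i0 :: real) / 2 ^ M" by (simp add: divide_right_mono)
        then show ?thesis using that i0' unfolding in_cell_iff by linarith
      qed
      then show ?thesis using 2 by (intro exI[of _ j2] exI[of _ e2]) auto
    next
      case False
      have "f x = 2 powi j * x + e" if x: "x \<in> {a..b}" "in_cell M i x" for x
      proof (cases "x \<le> d")
        case True
        have "(of_int i0 :: real) \<le> of_int i" using False by linarith
        then have "(of_int i0 :: real) / 2 ^ M \<le> of_int i / 2 ^ M" by (simp add: divide_right_mono)
        then have "of_int i0 / 2 ^ M \<le> x" using x(2) unfolding in_cell_iff by linarith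
        moreover have "x \<le> (of_int i0 + 1) / 2 ^ M" using True le i0' by linarith
        ultimately have "in_cell M i0 x" unfolding in_cell_iff by blast
        then show ?thesis using 1(3)[of x] agree[OF 1(3)] True le x by auto
      next
        case F: False then show ?thesis using h x by simp
      qed
      then show ?thesis using je by (intro exI[of _ j] exI[of _ e]) auto
    qed
  qed
qed

text \<open>
  If \<open>p\<close> is interior to a cell, both pieces are affine on a part of this cell, and the common formula
  around \<open>p\<close> makes them agree. So no grid point is needed where the map has no breakpoint.
\<close>

lemma level_glue_smooth:
  assumes f1: "level M f {a..p}" and f2: "level M f {p..b}" and p: "a < p" "p < b"
    and aff: "0 < \<epsilon>" "\<And>x. p - \<epsilon> \<le> x \<Longrightarrow> x \<le> p + \<epsilon> \<Longrightarrow> f x = 2 powi j * x + e"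
  shows "level M f {a..b}"
proof (rule levelI)
  fix i
  obtain j1 e1 where 1: "\<bar>j1\<bar> \<le> int M" "e1 \<in> grid M"
    "\<And>x. x \<in> {a..p} \<Longrightarrow> in_cell M i x \<Longrightarrow> f x = 2 powi j1 * x + e1" using levelE[OF f1] by metis
  obtain j2 e2 where 2: "\<bar>j2\<bar> \<le> int M" "e2 \<in> grid M"
    "\<And>x. x \<in> {p..b} \<Longrightarrow> in_cell M i x \<Longrightarrow> f x = 2 powi j2 * x + e2" using levelE[OF f2] by metis
  let ?u = "of_int i / (2 ^ M :: real)" and ?v = "(of_int i + 1) / (2 ^ M :: real)"
  consider "?v \<le> p" | "p \<le> ?u" | "?u < p" "p < ?v" by linarith
  then show "\<exists>j c'. \<bar>j\<bar> \<le> int M \<and> c' \<in> grid M \<and> (\<forall>x\<in>{a..b}. in_cell M i x \<longrightarrow> f x = 2 powi j * x + c')"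
  proof cases
    case 1 then show ?thesis using \<open>\<bar>j1\<bar> \<le> int M\<close> \<open>e1 \<in> grid M\<close> \<open>\<And>x. x \<in> {a..p} \<Longrightarrow> in_cell M i x \<Longrightarrow> f x = 2 powi j1 * x + e1\<close>
      by (intro exI[of _ j1] exI[of _ e1]) (auto simp: in_cell_iff)
  next
    case 2 then show ?thesis using \<open>\<bar>j2\<bar> \<le> int M\<close> \<open>e2 \<in> grid M\<close> \<open>\<And>x. x \<in> {p..b} \<Longrightarrow> in_cell M i x \<Longrightarrow> f x = 2 powi j2 * x + e2\<close>
      by (intro exI[of _ j2] exI[of _ e2]) (auto simp: in_cell_iff)
  next
    case 3
    define l where "l = max (max a ?u) (p - \<epsilon>)"
    define r where "r = min (min b ?v) (p + \<epsilon>)"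
    have l: "l < p" "a \<le> l" "p - \<epsilon> \<le> l" "?u \<le> l" using 3 p aff(1) by (auto simp: l_def)
    have r: "p < r" "r \<le> b" "r \<le> p + \<epsilon>" "r \<le> ?v" using 3 p aff(1) by (auto simp: r_def)
    have ic: "in_cell M i l" "in_cell M i p" "in_cell M i r" using l r 3 by (auto simp: in_cell_iff)
    have "j1 = j \<and> e1 = e" using affine_unique[of l p j1 e1 j e] 1(3)[of l] 1(3)[of p] aff(2)[of l] aff(2)[of p] ic l aff(1) by auto
    moreover have "j2 = j \<and> e2 = e" using affine_unique[of p r j2 e2 j e] 2(3)[of r] 2(3)[of p] aff(2)[of r] aff(2)[of p] ic r aff(1) by auto
    moreover have "f x = 2 powi j * x + e" if "x \<in> {a..b}" "in_cell M i x" for x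
      using 1(3)[of x] 2(3)[of x] that calculation by (cases "x \<le> p") auto
    ultimately show ?thesis using 1(1,2) by blast
  qed
qed

definition homeo :: "nat \<Rightarrow> (real \<Rightarrow> real) \<Rightarrow> bool" where
  "homeo M f \<longleftrightarrow> level M f {0..1} \<and> f 0 = 0 \<and> f 1 = 1"

lemma homeo_level: "homeo M f \<Longrightarrow> level M f {0..1}" and homeo_0: "homeo M f \<Longrightarrow> f 0 = 0" and homeo_1: "homeo M f \<Longrightarrow> f 1 = 1"
  by (auto simp: homeo_def)

lemma homeo_image: "homeo M f \<Longrightarrow> f ` {0..1} = {0..1}"
  using level_image[of M f 0 1] by (simp add: homeo_def)

lemma homeo_in: "homeo M f \<Longrightarrow> x \<in> {0..1} \<Longrightarrow> f x \<in> {0..1}"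
  using homeo_image by blast

lemma homeo_ex: assumes "homeo M f" "y \<in> {0..1}" obtains x where "x \<in> {0..1}" "f x = y"
  using homeo_image[OF assms(1)] assms(2) by (metis imageE)

lemma homeo_mono: "homeo M f \<Longrightarrow> M \<le> M' \<Longrightarrow> homeo M' f"
  using level_mono by (auto simp: homeo_def)

lemma homeo_comp: "homeo M g \<Longrightarrow> homeo N f \<Longrightarrow> homeo (N + 2 * M) (\<lambda>x. f (g x))"
  using level_comp[of M g "{0..1}" N f] homeo_image[of M g] by (auto simp: homeo_def)

text \<open>
  A cell of negative index, or of index at least \<open>2 ^ M\<close>, meets the unit interval in 0 or 1 at most,
  where the identity formula holds.
\<close>

lemma level_unitI:
  assumes "f 0 = 0" "f 1 = 1"
    and "\<And>i. 0 \<le> i \<Longrightarrow> i < 2 ^ M \<Longrightarrow> \<exists>j c. \<bar>j\<bar> \<le> int M \<and> c \<in> grid M \<and> (\<forall>x\<in>{0..1}. in_cell M i x \<longrightarrow> f x = 2 powi j * x + c)"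
  shows "level M f {0..1}"
proof (rule levelI)
  fix i :: int
  show "\<exists>j c. \<bar>j\<bar> \<le> int M \<and> c \<in> grid M \<and> (\<forall>x\<in>{0..1}. in_cell M i x \<longrightarrow> f x = 2 powi j * x + c)"
  proof (cases "0 \<le> i \<and> i < 2 ^ M")
    case True then show ?thesis using assms(3) by blast
  next
    case False
    have *: "x = 0 \<or> x = 1" if "x \<in> {0..1}" "in_cell M i x" for x
    proof -
      from False consider "i < 0" | "2 ^ M \<le> i" by linarith
      then show ?thesis
      proof cases
        case 1
        then have "(of_int i + 1 :: real) \<le> 0" by linarith
        then have "x * 2 ^ M \<le> 0" using that(2) unfolding in_cell_def by linarith
        moreover have "0 < x * 2 ^ M" if "0 < x" using that by (intro mult_pos_pos) simp_all
        ultimately have "x \<le> 0" by linarith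
        then show ?thesis using that(1) by simp
      next
        case 2
        then have "(of_int (2 ^ M) :: real) \<le> of_int i" by (simp only: of_int_le_iff)
        then have "(2 ^ M :: real) \<le> of_int i" by simp
        then have "1 * 2 ^ M \<le> x * 2 ^ M" using that(2) unfolding in_cell_def by linarith
        then have "1 \<le> x" by (rule mult_right_le_imp_le) simp
        then show ?thesis using that(1) by simp
      qed
    qed
    have "\<forall>x\<in>{0..1}. in_cell M i x \<longrightarrow> f x = 2 powi 0 * x + 0"
    proof (intro ballI impI)
      fix x :: real assume "x \<in> {0..1}" "in_cell M i x"
      then have "x = 0 \<or> x = 1" by (rule *)
      then show "f x = 2 powi 0 * x + 0" using assms by auto
    qed
    then show ?thesis by (intro exI[of _ 0]) auto
  qed
qed

text \<open>
  The images of the cells of \<open>f\<close> have their endpoints in \<^term>\<open>grid (2 * M)\<close>, so a cell of level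
  \<open>2 * M\<close> lies in one of them, and there the inverse is affine with the inverse slope.
\<close>

lemma homeo_inverse:
  assumes f: "homeo M f" and inv: "\<And>x. x \<in> {0..1} \<Longrightarrow> f' x \<in> {0..1} \<and> f (f' x) = x"
  shows "homeo (2 * M) f'"
proof -
  note L = homeo_level[OF f]
  have ends: "f' 0 = 0" "f' 1 = 1"
    using inv[of 0] inv[of 1] level_eq_iff[OF L, of "f' 0" 0] level_eq_iff[OF L, of "f' 1" 1] homeo_0[OF f] homeo_1[OF f] by auto
  have "level (2 * M) f' {0..1}"
  proof (rule level_unitI[where f = f', OF ends])
    fix i :: int
    let ?K = "2 * M"
    assume i: "0 \<le> i" "i < 2 ^ ?K"
    show "\<exists>j c. \<bar>j\<bar> \<le> int ?K \<and> c \<in> grid ?K \<and> (\<forall>x\<in>{0..1}. in_cell ?K i x \<longrightarrow> f' x = 2 powi j * x + c)"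
    proof -
      define a where "a = of_int i / (2 ^ ?K :: real)"
      define b where "b = of_int (i + 1) / (2 ^ ?K :: real)"
      have "i + 1 \<le> 2 ^ ?K" using i by linarith
      then have "(of_int (i + 1) :: real) \<le> of_int (2 ^ ?K)" by (simp only: of_int_le_iff)
      then have ab: "0 \<le> a" "a < b" "b \<le> 1" using i by (auto simp: a_def b_def field_simps)
      define w where "w = f' a"
      have w: "w \<in> {0..1}" "f w = a" using inv[of a] ab by (auto simp: w_def)
      define i0 where "i0 = \<lfloor>w * 2 ^ M\<rfloor>"
      obtain j c where j: "\<bar>j\<bar> \<le> int M" and c: "c \<in> grid M"
        and fx: "\<And>x. x \<in> {0..1} \<Longrightarrow> in_cell M i0 x \<Longrightarrow> f x = 2 powi j * x + c" using levelE[OF L] by metis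
      define r where "r = of_int (i0 + 1) / (2 ^ M :: real)"
      have wr: "w < r" unfolding r_def i0_def by (simp add: field_simps, linarith)
      have w1: "w < 1" using w ab homeo_1[OF f] by (cases "w = 1") auto
      have icw: "in_cell M i0 w" unfolding i0_def by (rule in_cell_floor)
      have r1: "r \<le> 1" using unit_cell(4)[of w M] w(1) w1 by (simp add: r_def i0_def)
      have icr: "in_cell M i0 r" by (simp add: in_cell_def r_def)
      have fr: "f r = 2 powi j * r + c" using fx icr r1 wr w by auto
      have "r \<in> grid M" unfolding r_def by (rule grid_frac)
      then have "2 powi j * r \<in> grid (M + M)" using j by (intro grid_powi) auto
      moreover have "c \<in> grid (M + M)" using c by (rule grid_mono) simp
      ultimately have "f r \<in> grid ?K" unfolding fr by (metis grid_add mult_2)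
      moreover have "a \<in> grid ?K" unfolding a_def by (rule grid_frac)
      moreover have "a < f r" using level_strict[OF L, of w r] w wr r1 by auto
      ultimately have "a + 1 / 2 ^ ?K \<le> f r" using grid_less_sep by blast
      then have br: "b \<le> f r" by (simp add: a_def b_def field_simps)
      have "f' y = 2 powi (- j) * y + (- (2 powi (- j) * c))" if y: "y \<in> {0..1}" "in_cell ?K i y" for y
      proof -
        have yab: "a \<le> y" "y \<le> b" using y(2) unfolding in_cell_iff a_def b_def by auto
        have fy: "f' y \<in> {0..1}" "f (f' y) = y" using inv y by auto
        have "w \<le> f' y" "f' y \<le> r" using level_le_iff[OF L, of w "f' y"] level_le_iff[OF L, of "f' y" r] fy w yab br r1 wr by auto
        then have "in_cell M i0 (f' y)" using in_cell_convex icw icr by blast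
        then have "y = 2 powi j * f' y + c" using fx fy by metis
        then have "2 powi (-j) * y = (2 powi (-j) * 2 powi j) * f' y + 2 powi (-j) * c" by (metis distrib_left mult.assoc)
        then show ?thesis by (simp add: two_powi_minus)
      qed
      moreover have "- (2 powi (- j) * c) \<in> grid ?K"
      proof -
        have "2 powi (- j) * c \<in> grid (M + M)" using c j by (intro grid_powi) auto
        then have "0 - 2 powi (- j) * c \<in> grid (M + M)" by (intro grid_diff) auto
        then show ?thesis by (simp add: mult_2)
      qed
      moreover have "\<bar>- j\<bar> \<le> int ?K" using j by simp
      ultimately show ?thesis by blast
    qed
  qed
  then show ?thesis using ends by (simp add: homeo_def)
qed

definition right_slope :: "(real \<Rightarrow> real) \<Rightarrow> real \<Rightarrow> int \<Rightarrow> bool" where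
  "right_slope f p m \<longleftrightarrow> (\<exists>\<epsilon>>0. \<forall>x. p \<le> x \<and> x \<le> p + \<epsilon> \<longrightarrow> f x = f p + 2 powi m * (x - p))"

text \<open>
  Conjugation with the reflection of the unit interval turns statements about right ends into
  statements about left ends.
\<close>

definition flip :: "(real \<Rightarrow> real) \<Rightarrow> real \<Rightarrow> real" where "flip f x = 1 - f (1 - x)"

lemma flip_flip [simp]: "flip (flip f) = f" by (auto simp: flip_def)

lemma level_flip: assumes "level M f {a..b}" shows "level M (flip f) {1 - b..1 - a}"
proof (rule levelI)
  fix i
  obtain j c where j: "\<bar>j\<bar> \<le> int M" and c: "c \<in> grid M"
    and fx: "\<And>x. x \<in> {a..b} \<Longrightarrow> in_cell M (2 ^ M - 1 - i) x \<Longrightarrow> f x = 2 powi j * x + c" using levelE[OF assms] by metis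
  have "flip f x = 2 powi j * x + (1 - 2 powi j * 1 - c)" if x: "x \<in> {1 - b..1 - a}" "in_cell M i x" for x
  proof -
    have "in_cell M (2 ^ M - 1 - i) (1 - x)" using x(2) unfolding in_cell_def by (simp add: algebra_simps)
    then have "f (1 - x) = 2 powi j * (1 - x) + c" using fx x(1) by auto
    then show ?thesis by (simp add: flip_def algebra_simps)
  qed
  moreover have "1 - 2 powi j * 1 - c \<in> grid M"
  proof -
    have "2 powi j * 1 \<in> grid (0 + M)" using j by (intro grid_powi) auto
    then show ?thesis using c by (intro grid_diff) auto
  qed
  ultimately show "\<exists>j c. \<bar>j\<bar> \<le> int M \<and> c \<in> grid M \<and> (\<forall>x\<in>{1 - b..1 - a}. in_cell M i x \<longrightarrow> flip f x = 2 powi j * x + c)"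
    using j by blast
qed

lemma homeo_flip: "homeo M f \<Longrightarrow> homeo M (flip f)"
  using level_flip[of M f 0 1] by (auto simp: homeo_def flip_def)

lemma level_right_slope:
  assumes f: "level M f {p..b}" and "p < b"
  obtains m where "\<bar>m\<bar> \<le> int M" "right_slope f p m" "f p - 2 powi m * p \<in> grid M"
proof -
  obtain j c where j: "\<bar>j\<bar> \<le> int M" "c \<in> grid M"
    and fx: "\<And>x. x \<in> {p..b} \<Longrightarrow> in_cell M \<lfloor>p * 2 ^ M\<rfloor> x \<Longrightarrow> f x = 2 powi j * x + c" using levelE[OF f] by metis
  define r where "r = (of_int \<lfloor>p * 2 ^ M\<rfloor> + 1) / (2 ^ M :: real)"
  have npair: "p < r" unfolding r_def by (simp add: field_simps, linarith)
  have ic: "in_cell M \<lfloor>p * 2 ^ M\<rfloor> p" by (rule in_cell_floor)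
  have fp: "f p = 2 powi j * p + c" using fx ic assms(2) by auto
  have "f x = f p + 2 powi j * (x - p)" if "p \<le> x" "x \<le> p + (min r b - p)" for x
  proof -
    have "in_cell M \<lfloor>p * 2 ^ M\<rfloor> x" using ic that unfolding in_cell_iff r_def by auto
    then have "f x = 2 powi j * x + c" using that by (intro fx) auto
    then show ?thesis unfolding fp by (simp add: right_diff_distrib)
  qed
  moreover have "0 < min r b - p" using npair assms(2) by simp
  ultimately have "right_slope f p j" unfolding right_slope_def by blast
  moreover have "f p - 2 powi j * p = c" unfolding fp by simp
  ultimately show ?thesis using that[of j] j by simp
qed

lemma right_slope_unique: assumes "right_slope f p m" "right_slope f p m'" shows "m = m'"
proof -
  obtain e where e: "e > 0" "\<And>x. p \<le> x \<and> x \<le> p + e \<Longrightarrow> f x = f p + 2 powi m * (x - p)" using assms(1) unfolding right_slope_def by blast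
  obtain e' where e': "e' > 0" "\<And>x. p \<le> x \<and> x \<le> p + e' \<Longrightarrow> f x = f p + 2 powi m' * (x - p)" using assms(2) unfolding right_slope_def by blast
  define x where "x = p + min e e'"
  have "2 powi m * (x - p) = 2 powi m' * (x - p)" "x - p \<noteq> 0" using e(2)[of x] e'(2)[of x] e(1) e'(1) by (auto simp: x_def)
  then show ?thesis using two_powi_inj[of m m'] by simp
qed

section \<open>Common fixed points of a family of maps\<close>

definition Fix :: "(real \<Rightarrow> real) set \<Rightarrow> real set" where
  "Fix Z = {x \<in> {0..1}. \<forall>z\<in>Z. z x = x}"

text \<open>
  An interval between two successive common fixed points.
\<close>

definition moving :: "(real \<Rightarrow> real) set \<Rightarrow> real \<Rightarrow> real \<Rightarrow> bool" where
  "moving Z p p' \<longleftrightarrow> p \<in> Fix Z \<and> p' \<in> Fix Z \<and> p < p' \<and> (\<forall>x. p < x \<and> x < p' \<longrightarrow> x \<notin> Fix Z)"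

text \<open>
  An affine map with slope \<open>2 powi j\<close>, \<open>0 < \<bar>j\<bar> \<le> N\<close>, and offset in \<^term>\<open>grid N\<close> fixes a single
  point, and that point belongs to this set: the equation \<open>2 powi j * r + c = r\<close> has the denominator
  \<open>2 powi j - 1\<close>. The set contains the grid (take \<open>i = 1\<close>), and two of its elements differ by
  at least \<open>sep N\<close>.
\<close>

definition fix_rats :: "nat \<Rightarrow> real set" where
  "fix_rats N = {r. \<exists>i\<in>{1..N}. r * (2 ^ N * (2 ^ i - 1)) \<in> \<int>}"

definition sep :: "nat \<Rightarrow> real" where "sep N = 1 / 2 ^ (3 * N)"

lemma sep_pos [simp]: "0 < sep N" and sep_nonneg [simp]: "0 \<le> sep N" by (simp_all add: sep_def)

lemma Ints_pos_ge1: "(x::real) \<in> \<int> \<Longrightarrow> 0 < x \<Longrightarrow> 1 \<le> x"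
  by (auto elim!: Ints_cases)

lemma Ints_pow2m1: "(2 ^ i - 1 :: real) \<in> \<int>" by simp

lemma fix_rats_sep: assumes "r \<in> fix_rats N" "s \<in> fix_rats N" "r < s" shows "r + sep N \<le> s"
proof -
  obtain i k where i: "i \<in> {1..N}" "r * (2 ^ N * (2 ^ i - 1)) \<in> \<int>" and k: "k \<in> {1..N}" "s * (2 ^ N * (2 ^ k - 1)) \<in> \<int>"
    using assms by (auto simp: fix_rats_def)
  let ?d = "2 ^ N * (2 ^ i - 1) * (2 ^ k - 1) :: real"
  have "(s - r) * ?d = s * (2 ^ N * (2 ^ k - 1)) * (2 ^ i - 1) - r * (2 ^ N * (2 ^ i - 1)) * (2 ^ k - 1)"
    by (simp add: algebra_simps)
  also have "\<dots> \<in> \<int>" using Ints_mult[OF k(2) Ints_pow2m1[of i]] Ints_mult[OF i(2) Ints_pow2m1[of k]] by (rule Ints_diff)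
  finally have int: "(s - r) * ?d \<in> \<int>" .
  have pos: "(1::real) < 2 ^ i" "(1::real) < 2 ^ k" using i k by (auto intro: one_less_power)
  then have "0 < (s - r) * ?d" using assms(3) by simp
  then have "1 \<le> (s - r) * ?d" using int Ints_pos_ge1 by blast
  have "?d \<le> 2 ^ N * 2 ^ N * 2 ^ N"
  proof (intro mult_mono)
    have "(2::real) ^ i \<le> 2 ^ N" "(2::real) ^ k \<le> 2 ^ N" using i k by (intro power_increasing; simp)+
    then show "(2::real) ^ i - 1 \<le> 2 ^ N" "(2::real) ^ k - 1 \<le> 2 ^ N" by linarith+
  qed (use pos in auto)
  also have "2 ^ N * 2 ^ N * 2 ^ N = (2::real) ^ (3 * N)" by (simp flip: power_add add: numeral_3_eq_3)
  finally have "(s - r) * ?d \<le> (s - r) * 2 ^ (3 * N)" using assms(3) by (intro mult_left_mono) simp_all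
  with \<open>1 \<le> (s - r) * ?d\<close> have "1 \<le> (s - r) * 2 ^ (3 * N)" by linarith
  then show ?thesis by (simp add: sep_def field_simps)
qed

lemma grid_fix_rats: "1 \<le> N \<Longrightarrow> x \<in> grid N \<Longrightarrow> x \<in> fix_rats N"
  unfolding fix_rats_def grid_def by (auto intro!: bexI[of _ 1])

lemma affine_fix_fix_rats:
  assumes "\<bar>j\<bar> \<le> int N" "c \<in> grid N" "2 powi j * r + c = r" "j \<noteq> 0" shows "r \<in> fix_rats N"
proof (cases "0 < j")
  case True
  define i where "i = nat j"
  have i: "1 \<le> i" "i \<le> N" "2 ^ i * r + c = r" using True assms(1,3) by (auto simp: i_def two_powi_nat)
  have "r * (2 ^ i - 1) = - c" using i(3) by (simp add: algebra_simps)
  then have "2 ^ N * (r * (2 ^ i - 1)) = 2 ^ N * - c" by simp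
  then have "r * (2 ^ N * (2 ^ i - 1)) = - (c * 2 ^ N)" by (simp add: mult_ac)
  moreover have "- (c * 2 ^ N) \<in> \<int>" using gridD[OF assms(2)] by (rule Ints_minus)
  ultimately have "r * (2 ^ N * (2 ^ i - 1)) \<in> \<int>" by (simp only:)
  then show ?thesis using i(1,2) unfolding fix_rats_def by (intro CollectI bexI[of _ i]) simp_all
next
  case False
  define i where "i = nat (- j)"
  have ji: "j = - int i" using False by (simp add: i_def)
  have i: "1 \<le> i" "i \<le> N" using False assms(1,4) by (auto simp: i_def)
  have "r / 2 ^ i + c = r" using assms(3) by (simp add: ji power_int_minus divide_inverse mult.commute)
  then have "r * (2 ^ i - 1) = c * 2 ^ i" by (simp add: field_simps)
  then have "2 ^ N * (r * (2 ^ i - 1)) = 2 ^ N * (c * 2 ^ i)" by simp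
  then have "r * (2 ^ N * (2 ^ i - 1)) = c * 2 ^ N * 2 ^ i" by (simp add: mult_ac)
  moreover have "c * 2 ^ N * 2 ^ i \<in> \<int>" using gridD[OF assms(2)] by (rule Ints_mult) simp
  ultimately have "r * (2 ^ N * (2 ^ i - 1)) \<in> \<int>" by (simp only:)
  then show ?thesis using i unfolding fix_rats_def by (intro CollectI bexI[of _ i]) simp_all
qed

text \<open>
  The denominator of a dyadic number is a power of 2, and an odd factor cancels no part of it.
\<close>

lemma odd_denominator:
  fixes t :: real assumes "t * of_int b \<in> \<int>" "odd b" "t \<in> grid M" shows "t \<in> \<int>"
proof -
  obtain e where e: "t = of_int e / 2 ^ M" using assms(3) grid_E by metis
  obtain k where k: "t * of_int b = of_int k" using assms(1) by (auto elim: Ints_cases)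
  have "of_int (e * b) = (of_int (k * 2 ^ M) :: real)" using k unfolding e by (simp add: field_simps)
  then have "e * b = k * 2 ^ M" by (simp only: of_int_eq_iff)
  then have "2 ^ M dvd e * b" by simp
  moreover have "coprime (2 ^ M) b" using assms(2) by simp
  ultimately have "2 ^ M dvd e" using coprime_dvd_mult_left_iff by blast
  then obtain u where "e = 2 ^ M * u" by (elim dvdE)
  then have "t = of_int u" unfolding e by simp
  then show ?thesis by simp
qed

lemma fix_rats_grid: assumes "x \<in> fix_rats N" "x \<in> grid M" shows "x \<in> grid N"
proof -
  obtain i where i: "i \<in> {1..N}" "x * (2 ^ N * (2 ^ i - 1)) \<in> \<int>" using assms(1) by (auto simp: fix_rats_def)
  have "x * 2 ^ M * 2 ^ N \<in> \<int>" using gridD[OF assms(2)] by (rule Ints_mult) simp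
  then have "x * 2 ^ N \<in> grid M" by (intro gridI) (simp add: mult.assoc mult.commute[of "2 ^ M"])
  moreover have "x * 2 ^ N * of_int (2 ^ i - 1) \<in> \<int>" using i(2) by (simp add: mult.assoc)
  ultimately have "x * 2 ^ N \<in> \<int>" using odd_denominator[of "x * 2 ^ N" "2 ^ i - 1" M] i(1) by simp
  then show ?thesis by (rule gridI)
qed

lemma powi_gap: "j \<noteq> 0 \<Longrightarrow> 1 / 2 \<le> \<bar>(2::real) powi j - 1\<bar>"
  using two_powi_mono[of 1 j] two_powi_mono[of j "-1"] by (cases "0 < j") (auto simp: abs_if power_int_minus)

text \<open>
  The family is closed under inverses, so that a point which some map moves can be moved to the left
  and to the right.
\<close>

locale map_family =
  fixes N :: nat and Z :: "(real \<Rightarrow> real) set"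
  assumes N1: "1 \<le> N" and Z_homeo: "z \<in> Z \<Longrightarrow> homeo N z"
    and Z_inverse: "z \<in> Z \<Longrightarrow> \<exists>z'\<in>Z. \<forall>x\<in>{0..1}. z' (z x) = x \<and> z (z' x) = x"
begin

lemma z_affine:
  assumes "z \<in> Z"
  obtains j c where "\<bar>j\<bar> \<le> int N" "c \<in> grid N" "\<And>x. x \<in> {0..1} \<Longrightarrow> in_cell N i x \<Longrightarrow> z x = 2 powi j * x + c"
  using levelE[OF homeo_level[OF Z_homeo[OF assms]]] by metis

text \<open>
  A map that fixes a point outside \<^term>\<open>fix_rats N\<close> has slope 1 on the cell around this point, so
  it is the identity there.
\<close>

lemma fixed_cell:
  assumes "x \<in> Fix Z" "x \<notin> fix_rats N" "t \<in> {0..1}" "in_cell N \<lfloor>x * 2 ^ N\<rfloor> t" shows "t \<in> Fix Z"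
proof -
  have "z t = t" if z: "z \<in> Z" for z
  proof -
    obtain j c where jc: "\<bar>j\<bar> \<le> int N" "c \<in> grid N"
      "\<And>t. t \<in> {0..1} \<Longrightarrow> in_cell N \<lfloor>x * 2 ^ N\<rfloor> t \<Longrightarrow> z t = 2 powi j * t + c" using z_affine[OF z] by metis
    have x: "2 powi j * x + c = x" using jc(3)[of x] in_cell_floor assms(1) z by (auto simp: Fix_def)
    then have "j = 0" using affine_fix_fix_rats[OF jc(1,2)] assms(2) by blast
    then show ?thesis using x jc(3)[OF assms(3,4)] by simp
  qed
  then show ?thesis using assms(3) by (simp add: Fix_def)
qed

lemma two_fixed_cell:
  assumes "a \<in> Fix Z" "b \<in> Fix Z" "a \<noteq> b" "in_cell N i a" "in_cell N i b" "t \<in> {0..1}" "in_cell N i t"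
  shows "t \<in> Fix Z"
proof -
  have "z t = t" if z: "z \<in> Z" for z
  proof -
    obtain j c where jc: "\<And>x'. x' \<in> {0..1} \<Longrightarrow> in_cell N i x' \<Longrightarrow> z x' = 2 powi j * x' + c" using z_affine[OF z] by metis
    have "2 powi j * a + c = 2 powi 0 * a + 0" "2 powi j * b + c = 2 powi 0 * b + 0"
      using jc[of a] jc[of b] assms z by (auto simp: Fix_def)
    then have "j = 0" "c = 0" using affine_unique[of a b j c 0 0] assms(3) by auto
    then show ?thesis using jc[OF assms(6,7)] by simp
  qed
  then show ?thesis using assms(6) by (simp add: Fix_def)
qed

text \<open>
  Otherwise \<open>fixed_cell\<close> would provide common fixed points inside the interval.
\<close>

lemma moving_fix_rats: assumes m: "moving Z p p'" shows "p \<in> fix_rats N" "p' \<in> fix_rats N"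
proof -
  have pp: "p \<in> Fix Z" "p' \<in> Fix Z" "p < p'" "p \<in> {0..1}" "p' \<in> {0..1}" and no: "\<And>x. p < x \<Longrightarrow> x < p' \<Longrightarrow> x \<notin> Fix Z"
    using m by (auto simp: moving_def Fix_def)
  show "p \<in> fix_rats N"
  proof (rule ccontr)
    assume np: "p \<notin> fix_rats N"
    define r where "r = (of_int \<lfloor>p * 2 ^ N\<rfloor> + 1) / (2 ^ N :: real)"
    have npair: "p < r" unfolding r_def by (simp add: field_simps, linarith)
    define x where "x = (p + min r p') / 2"
    have x: "p < x" "x < p'" "x < r" using npair pp by (auto simp: x_def)
    have "in_cell N \<lfloor>p * 2 ^ N\<rfloor> x" using in_cell_floor[of N p] x unfolding in_cell_iff r_def by auto
    then have "x \<in> Fix Z" using fixed_cell[OF pp(1) np, of x] x pp by auto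
    then show False using no x by blast
  qed
  show "p' \<in> fix_rats N"
  proof (rule ccontr)
    assume np: "p' \<notin> fix_rats N"
    define r where "r = of_int \<lfloor>p' * 2 ^ N\<rfloor> / (2 ^ N :: real)"
    have "r \<in> grid N" unfolding r_def by simp
    then have "r \<noteq> p'" using np grid_fix_rats[OF N1] by blast
    moreover have "r \<le> p'" using in_cell_floor[of N p'] unfolding in_cell_iff r_def by simp
    ultimately have npair: "r < p'" by simp
    define x where "x = (p' + max r p) / 2"
    have x: "p < x" "x < p'" "r < x" using npair pp by (auto simp: x_def)
    have "in_cell N \<lfloor>p' * 2 ^ N\<rfloor> x" using in_cell_floor[of N p'] x unfolding in_cell_iff r_def by auto
    then have "x \<in> Fix Z" using fixed_cell[OF pp(2) np, of x] x pp by auto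
    then show False using no x by blast
  qed
qed

lemma moving_length: assumes "moving Z p p'" shows "p + sep N \<le> p'"
  using fix_rats_sep moving_fix_rats[OF assms] assms by (auto simp: moving_def)

text \<open>
  All endpoints of cells lie in \<^term>\<open>fix_rats N\<close>, so none of them lies strictly between \<open>p\<close> and
  \<open>p + sep N\<close>: each map is linear around \<open>p\<close> on this whole segment.
\<close>

lemma right_germ:
  assumes m: "moving Z p p'" and z: "z \<in> Z"
  obtains j where "\<bar>j\<bar> \<le> int N" "\<And>x. p \<le> x \<Longrightarrow> x \<le> p + sep N \<Longrightarrow> z x = p + 2 powi j * (x - p)"
proof -
  let ?i = "\<lfloor>p * 2 ^ N\<rfloor>"
  have pp: "p \<in> {0..1}" "p' \<in> {0..1}" "z p = p" using m z by (auto simp: moving_def Fix_def)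
  obtain j c where jc: "\<bar>j\<bar> \<le> int N" "\<And>t. t \<in> {0..1} \<Longrightarrow> in_cell N ?i t \<Longrightarrow> z t = 2 powi j * t + c"
    using z_affine[OF z] by metis
  define r where "r = of_int (?i + 1) / (2 ^ N :: real)"
  have "p < r" unfolding r_def by (simp add: field_simps, linarith)
  moreover have "r \<in> fix_rats N" unfolding r_def by (intro grid_fix_rats N1 grid_frac)
  ultimately have r: "p + sep N \<le> r" using moving_fix_rats(1)[OF m] fix_rats_sep by blast
  have zp: "2 powi j * p + c = p" using jc(2)[of p] in_cell_floor pp by simp
  have "z x = p + 2 powi j * (x - p)" if x: "p \<le> x" "x \<le> p + sep N" for x
  proof -
    have "in_cell N ?i x" using in_cell_floor[of N p] x r unfolding in_cell_iff r_def by auto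
    moreover have "x \<in> {0..1}" using x pp moving_length[OF m] by auto
    ultimately have "z x = 2 powi j * x + c" using jc by blast
    then show ?thesis using zp by (simp add: algebra_simps)
  qed
  then show ?thesis using that jc(1) by blast
qed

text \<open>
  The point \<open>p + sep N / 2\<close> is moved by some map; its slope at \<open>p\<close> is not 1, and the inverse has
  the inverse slope. So one map contracts towards \<open>p\<close> and another one expands.
\<close>

lemma right_germs:
  assumes m: "moving Z p p'"
  obtains z j z' where "z \<in> Z" "z' \<in> Z" "j > 0" "j \<le> int N"
    "\<And>x. p \<le> x \<Longrightarrow> x \<le> p + sep N \<Longrightarrow> z x = p + 2 powi (- j) * (x - p)"
    "\<And>x. p \<le> x \<Longrightarrow> x \<le> p + sep N \<Longrightarrow> z' x = p + 2 powi j * (x - p)"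
proof -
  have pp: "p \<in> {0..1}" "p' \<in> {0..1}" using m by (auto simp: moving_def Fix_def)
  note len = moving_length[OF m]
  define u where "u = p + sep N / 2"
  have sp: "sep N > 0" by simp
  have u: "p < u" "u < p + sep N" using sp unfolding u_def by linarith+
  have u01: "u \<in> {0..1}" using u len pp by auto
  have "u \<notin> Fix Z" using m len u by (auto simp: moving_def)
  then obtain z where z: "z \<in> Z" "z u \<noteq> u" using u01 by (auto simp: Fix_def)
  obtain j where j: "\<bar>j\<bar> \<le> int N" and zj: "\<And>x. p \<le> x \<Longrightarrow> x \<le> p + sep N \<Longrightarrow> z x = p + 2 powi j * (x - p)"
    using right_germ[OF m z(1)] by metis
  have j0: "j \<noteq> 0" using z(2) zj[of u] u by auto
  obtain z' where z': "z' \<in> Z" and inv: "\<And>x. x \<in> {0..1} \<Longrightarrow> z' (z x) = x \<and> z (z' x) = x" using Z_inverse[OF z(1)] by blast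
  obtain k where k: "\<bar>k\<bar> \<le> int N" and zk: "\<And>x. p \<le> x \<Longrightarrow> x \<le> p + sep N \<Longrightarrow> z' x = p + 2 powi k * (x - p)"
    using right_germ[OF m z'] by metis
  \<comment> \<open>close enough to \<open>p\<close> that both \<open>z\<close> and its inverse follow their linear formulas\<close>
  define e where "e = min (sep N) (2 powi (- j) * sep N)"
  have e: "0 < e" "e \<le> sep N" "2 powi j * e \<le> sep N"
  proof -
    show "0 < e" "e \<le> sep N" using sp by (auto simp: e_def)
    have "2 powi j * e \<le> 2 powi j * (2 powi (- j) * sep N)" by (intro mult_left_mono) (auto simp: e_def)
    also have "\<dots> = sep N" by (simp only: mult.assoc[symmetric] two_powi_minus mult_1)
    finally show "2 powi j * e \<le> sep N" .
  qed
  have "z (p + e) = p + 2 powi j * e" using zj[of "p + e"] e by simp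
  moreover have "z' (p + 2 powi j * e) = p + 2 powi k * (2 powi j * e)" using zk[of "p + 2 powi j * e"] e by simp
  moreover have "z' (z (p + e)) = p + e" using inv[of "p + e"] e pp len by auto
  ultimately have "2 powi k * 2 powi j * e = e" by simp
  then have "(2::real) powi (k + j) = 2 powi 0" using e by (simp add: two_powi_add)
  then have "k + j = 0" by (rule two_powi_inj)
  then have kj: "k = - j" by simp
  show ?thesis
  proof (cases "j > 0")
    case True then show ?thesis using that[of z' z j] z(1) z' zj zk kj j by auto
  next
    case False then show ?thesis using that[of z z' "-j"] z(1) z' zj zk kj j j0 by auto
  qed
qed

text \<open>
  On the cell of \<open>c\<close> every map is a translation or a dilation about a centre in \<^term>\<open>fix_rats N\<close>,
  and a dilation moves \<open>c\<close> by at least half of the distance to its centre. If \<open>c\<close> is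
  \<open>\<kappa>\<close>-close to the centre \<open>r\<close> of one map, then \<open>r\<close> lies in the interior of the moving interval, so
  another map moves \<open>r\<close>; it is a translation, or its centre has distance at least \<open>sep N\<close> from \<open>r\<close>.
\<close>

lemma gap:
  assumes m: "moving Z p p'" and \<kappa>: "0 < \<kappa>" "\<kappa> \<le> sep N" and c: "p + \<kappa> \<le> c" "c \<le> p' - \<kappa>"
  obtains z where "z \<in> Z" "\<kappa> / 4 \<le> \<bar>z c - c\<bar>"
proof -
  have pp: "p \<in> {0..1}" "p' \<in> {0..1}" using m by (auto simp: moving_def Fix_def)
  have c01: "0 < c" "c < 1" "c \<in> {0..1}" using c \<kappa> pp by auto
  have sepN: "sep N \<le> 1 / 2 ^ N" by (simp add: sep_def field_simps)
  define i where "i = \<lfloor>c * 2 ^ N\<rfloor>"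
  have ic: "in_cell N i c" unfolding i_def by (rule in_cell_floor)
  have "c \<notin> Fix Z" using m c \<kappa> by (auto simp: moving_def)
  then obtain z0 where z0: "z0 \<in> Z" "z0 c \<noteq> c" using c01 by (auto simp: Fix_def)
  have translation: "\<kappa> / 4 \<le> \<bar>d\<bar>" if "d \<in> grid N" "d \<noteq> 0" for d :: real
  proof -
    have "d * 2 ^ N \<in> \<int>" using that by (simp add: grid_def)
    then have "1 \<le> \<bar>d * 2 ^ N\<bar>" using Ints_nonzero_abs_ge1[of "d * 2 ^ N"] that by simp
    then have "1 / 2 ^ N \<le> \<bar>d\<bar>" by (simp add: abs_mult field_simps)
    then show ?thesis using sepN \<kappa> by linarith
  qed
  have centre: "\<exists>r\<in>fix_rats N. 2 powi j * r + d = r \<and> (\<forall>x. \<bar>2 powi j * x + d - x\<bar> \<ge> \<bar>x - r\<bar> / 2)"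
    if "\<bar>j\<bar> \<le> int N" "d \<in> grid N" "j \<noteq> 0" for j d
  proof -
    have nz: "(2::real) powi j - 1 \<noteq> 0" using powi_gap[OF that(3)] by auto
    define r where "r = - d / (2 powi j - 1)"
    have "r * (2 powi j - 1) = - d" using nz by (simp add: r_def)
    then have r: "2 powi j * r + d = r" by (simp add: algebra_simps)
    have "\<bar>2 powi j * x + d - x\<bar> \<ge> \<bar>x - r\<bar> / 2" for x
    proof -
      have "2 powi j * x + d - x = (2 powi j - 1) * (x - r)" using r by (simp add: algebra_simps)
      then have "\<bar>2 powi j * x + d - x\<bar> = \<bar>2 powi j - 1\<bar> * \<bar>x - r\<bar>" by (simp add: abs_mult)
      also have "\<dots> \<ge> 1 / 2 * \<bar>x - r\<bar>" using powi_gap[OF that(3)] by (intro mult_right_mono) auto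
      finally show ?thesis by simp
    qed
    then show ?thesis using affine_fix_fix_rats[OF that(1,2) r that(3)] r by blast
  qed
  obtain j0 d0 where j0: "\<bar>j0\<bar> \<le> int N" "d0 \<in> grid N"
    and f0: "\<And>x. x \<in> {0..1} \<Longrightarrow> in_cell N i x \<Longrightarrow> z0 x = 2 powi j0 * x + d0" using z_affine[OF z0(1)] by metis
  show ?thesis
  proof (cases "j0 = 0")
    case True
    then have "z0 c - c = d0" using f0[OF c01(3) ic] by simp
    then show ?thesis using translation[of d0] j0 z0 that[of z0] by auto
  next
    case False
    obtain r where r: "r \<in> fix_rats N" "2 powi j0 * r + d0 = r"
      and gr: "\<And>x. \<bar>2 powi j0 * x + d0 - x\<bar> \<ge> \<bar>x - r\<bar> / 2" using centre[OF j0 False] by blast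
    have g0: "\<bar>z0 c - c\<bar> \<ge> \<bar>c - r\<bar> / 2" using gr[of c] f0[OF c01(3) ic] by simp
    show ?thesis
    proof (cases "\<kappa> \<le> \<bar>c - r\<bar>")
      case True then show ?thesis using g0 z0(1) \<kappa> by (intro that[of z0]) auto
    next
      case near: False
      have "in_cell N i r"
      proof (rule ccontr)
        assume "\<not> in_cell N i r"
        then consider "r < of_int i / 2 ^ N" | "of_int (i + 1) / 2 ^ N < r" unfolding in_cell_iff by force
        then show False
        proof cases
          case 1
          then have "r + sep N \<le> of_int i / 2 ^ N" using fix_rats_sep[OF r(1) grid_fix_rats[OF N1 grid_frac]] by blast
          then show False using ic near \<kappa> unfolding in_cell_iff by linarith
        next
          case 2
          then have "of_int (i + 1) / 2 ^ N + sep N \<le> r" using fix_rats_sep[OF grid_fix_rats[OF N1 grid_frac] r(1)] by blast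
          then show False using ic near \<kappa> unfolding in_cell_iff by simp
        qed
      qed
      moreover have r01: "p < r" "r < p'" "r \<in> {0..1}" using near c \<kappa> pp by auto
      moreover have "r \<notin> Fix Z" using m r01 by (auto simp: moving_def)
      ultimately obtain z1 where z1: "z1 \<in> Z" "z1 r \<noteq> r" by (auto simp: Fix_def)
      obtain j1 d1 where j1: "\<bar>j1\<bar> \<le> int N" "d1 \<in> grid N"
        and f1: "\<And>x. x \<in> {0..1} \<Longrightarrow> in_cell N i x \<Longrightarrow> z1 x = 2 powi j1 * x + d1" using z_affine[OF z1(1)] by metis
      have z1r: "2 powi j1 * r + d1 \<noteq> r" using f1 r01 \<open>in_cell N i r\<close> z1(2) by auto
      show ?thesis
      proof (cases "j1 = 0")
        case True
        then have "z1 c - c = d1" "d1 \<noteq> 0" using f1[OF c01(3) ic] z1r by auto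
        then show ?thesis using translation[of d1] j1 z1 that[of z1] by auto
      next
        case False
        obtain s where s: "s \<in> fix_rats N" "2 powi j1 * s + d1 = s"
          and gs: "\<And>x. \<bar>2 powi j1 * x + d1 - x\<bar> \<ge> \<bar>x - s\<bar> / 2" using centre[OF j1 False] by blast
        have g1: "\<bar>z1 c - c\<bar> \<ge> \<bar>c - s\<bar> / 2" using gs[of c] f1[OF c01(3) ic] by simp
        have "r \<noteq> s" using s z1r by auto
        then have "sep N \<le> \<bar>r - s\<bar>" using fix_rats_sep[OF r(1) s(1)] fix_rats_sep[OF s(1) r(1)] by (cases "r < s") auto
        then have "sep N / 2 \<le> \<bar>c - r\<bar> \<or> sep N / 2 \<le> \<bar>c - s\<bar>" by linarith
        then show ?thesis
        proof
          assume "sep N / 2 \<le> \<bar>c - r\<bar>"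
          then have "sep N / 2 / 2 \<le> \<bar>c - r\<bar> / 2" by (rule divide_right_mono) simp
          also note g0
          finally have "\<kappa> / 4 \<le> \<bar>z0 c - c\<bar>" using \<kappa> by (simp add: abs_if split: if_splits)
          then show ?thesis by (rule that[OF z0(1)])
        next
          assume "sep N / 2 \<le> \<bar>c - s\<bar>"
          then have "sep N / 2 / 2 \<le> \<bar>c - s\<bar> / 2" by (rule divide_right_mono) simp
          also note g1
          finally have "\<kappa> / 4 \<le> \<bar>z1 c - c\<bar>" using \<kappa> by (simp add: abs_if split: if_splits)
          then show ?thesis by (rule that[OF z1(1)])
        qed
      qed
    qed
  qed
qed

text \<open>
  If \<open>z\<close> moves \<open>c\<close> to the left by \<open>\<epsilon>\<close>, then its inverse moves \<open>c\<close> to the right by at least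
  \<open>\<epsilon> / 2 ^ N\<close>, as \<open>z\<close> expands distances by the factor \<open>2 ^ N\<close> at most.
\<close>

lemma inverse_displacement:
  assumes z: "z \<in> Z" "c \<in> {0..1}" "\<epsilon> \<ge> 0"
  shows "z c \<le> c - \<epsilon> \<Longrightarrow> \<exists>z'\<in>Z. c + \<epsilon> / 2 ^ N \<le> z' c" "c + \<epsilon> \<le> z c \<Longrightarrow> \<exists>z'\<in>Z. z' c \<le> c - \<epsilon> / 2 ^ N"
proof -
  note L = homeo_level[OF Z_homeo[OF z(1)]]
  obtain z' where z': "z' \<in> Z" and inv: "\<And>x. x \<in> {0..1} \<Longrightarrow> z (z' x) = x" using Z_inverse[OF z(1)] by blast
  have w: "z' c \<in> {0..1}" using homeo_in[OF Z_homeo[OF z'] z(2)] .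
  {
    assume h: "z c \<le> c - \<epsilon>"
    then have "c \<le> z' c" using level_le_iff[OF L, of c "z' c"] inv[OF z(2)] w z by auto
    then have "z (z' c) - z c \<le> 2 ^ N * (z' c - c)" using level_slope(1)[OF L, of c "z' c"] w z by auto
    then have "\<epsilon> \<le> 2 ^ N * (z' c - c)" using h inv[OF z(2)] by simp
    then have "c + \<epsilon> / 2 ^ N \<le> z' c" by (simp add: field_simps)
    then show "\<exists>z'\<in>Z. c + \<epsilon> / 2 ^ N \<le> z' c" using z' by blast
  next
    assume h: "c + \<epsilon> \<le> z c"
    then have "z' c \<le> c" using level_le_iff[OF L, of "z' c" c] inv[OF z(2)] w z by auto
    then have "z c - z (z' c) \<le> 2 ^ N * (c - z' c)" using level_slope(1)[OF L, of "z' c" c] w z by auto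
    then have "\<epsilon> \<le> 2 ^ N * (c - z' c)" using h inv[OF z(2)] by simp
    then have "z' c \<le> c - \<epsilon> / 2 ^ N" by (simp add: field_simps)
    then show "\<exists>z'\<in>Z. z' c \<le> c - \<epsilon> / 2 ^ N" using z' by blast
  }
qed

lemma steps:
  assumes m: "moving Z p p'" and \<kappa>: "0 < \<kappa>" "\<kappa> \<le> sep N" and c: "p + \<kappa> \<le> c" "c \<le> p' - \<kappa>"
  shows "\<exists>z\<in>Z. c + \<kappa> / 2 ^ (N + 2) \<le> z c" "\<exists>z\<in>Z. z c \<le> c - \<kappa> / 2 ^ (N + 2)"
proof -
  have pp: "p \<in> {0..1}" "p' \<in> {0..1}" using m by (auto simp: moving_def Fix_def)
  have c01: "c \<in> {0..1}" using c \<kappa> pp by auto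
  obtain z where z: "z \<in> Z" "\<kappa> / 4 \<le> \<bar>z c - c\<bar>" using gap[OF assms] by metis
  have le: "\<kappa> / 2 ^ (N + 2) \<le> \<kappa> / 4" using \<kappa> by (simp add: field_simps)
  have eq: "\<kappa> / 4 / 2 ^ N = \<kappa> / 2 ^ (N + 2)" by (simp add: power_add)
  have k0: "0 \<le> \<kappa> / 4" using \<kappa> by simp
  note ID = inverse_displacement[OF z(1) c01 k0, unfolded eq]
  show "\<exists>z\<in>Z. c + \<kappa> / 2 ^ (N + 2) \<le> z c"
  proof (cases "z c \<ge> c")
    case True then show ?thesis using z le by (intro bexI[of _ z]) auto
  next
    case False then show ?thesis using z ID(1) by auto
  qed
  show "\<exists>z\<in>Z. z c \<le> c - \<kappa> / 2 ^ (N + 2)"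
  proof (cases "z c \<ge> c")
    case True then show ?thesis using z ID(2) by auto
  next
    case False then show ?thesis using z le by (intro bexI[of _ z]) auto
  qed
qed

end

lemma Fix_flip: "x \<in> Fix (flip ` Z) \<longleftrightarrow> 1 - x \<in> Fix Z"
  unfolding Fix_def by (auto simp: flip_def)

lemma moving_flip: "moving Z p p' \<Longrightarrow> moving (flip ` Z) (1 - p') (1 - p)"
  unfolding moving_def Fix_flip by auto

section \<open>Conjugators near the ends of a moving interval\<close>

text \<open>
  The pairs in \<open>R\<close> are pairs \<open>(z, y)\<close> of maps, and \<open>y = g z g\<^sup>-\<^sup>1\<close> is required for each of them. A
  conjugator thus maps the dynamics of the first components to the dynamics of the second ones.
\<close>

definition conjugates :: "((real \<Rightarrow> real) \<times> (real \<Rightarrow> real)) set \<Rightarrow> (real \<Rightarrow> real) \<Rightarrow> bool" where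
  "conjugates R g \<longleftrightarrow> (\<exists>M. homeo M g) \<and> (\<forall>(z, y)\<in>R. \<forall>x\<in>{0..1}. y (g x) = g (z x))"

lemma conjugatesD: "conjugates R g \<Longrightarrow> (z, y) \<in> R \<Longrightarrow> x \<in> {0..1} \<Longrightarrow> y (g x) = g (z x)"
  unfolding conjugates_def by blast

lemma conjugates_less_iff: assumes "conjugates R g" "x \<in> {0..1}" "x' \<in> {0..1}" shows "g x < g x' \<longleftrightarrow> x < x'"
  using assms level_less_iff homeo_level unfolding conjugates_def by metis

lemma conjugates_eq_iff: assumes "conjugates R g" "x \<in> {0..1}" "x' \<in> {0..1}" shows "g x = g x' \<longleftrightarrow> x = x'"
  using assms level_eq_iff homeo_level unfolding conjugates_def by metis

lemma conjugates_le_iff: assumes "conjugates R g" "x \<in> {0..1}" "x' \<in> {0..1}" shows "g x \<le> g x' \<longleftrightarrow> x \<le> x'"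
  using conjugates_less_iff[OF assms(1,3,2)] by linarith

lemma conjugates_in: assumes "conjugates R g" "x \<in> {0..1}" shows "g x \<in> {0..1}"
  using assms homeo_in unfolding conjugates_def by blast

lemma conjugates_ex: assumes "conjugates R g" "y \<in> {0..1}" obtains x where "x \<in> {0..1}" "g x = y"
  using assms homeo_ex unfolding conjugates_def by metis

locale conjugacy =
  fixes N :: nat and R :: "((real \<Rightarrow> real) \<times> (real \<Rightarrow> real)) set"
  assumes N1: "1 \<le> N" and R_homeo: "(z, y) \<in> R \<Longrightarrow> homeo N z \<and> homeo N y"
    and R_inverse: "(z, y) \<in> R \<Longrightarrow> \<exists>z' y'. (z', y') \<in> R \<and>
      (\<forall>x\<in>{0..1}. z' (z x) = x \<and> z (z' x) = x \<and> y' (y x) = x \<and> y (y' x) = x)"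
begin

lemma z_family: "map_family N (fst ` R)"
proof
  show "\<exists>z'\<in>fst ` R. \<forall>x\<in>{0..1}. z' (z x) = x \<and> z (z' x) = x" if z: "z \<in> fst ` R" for z
  proof -
    obtain y where "(z, y) \<in> R" using z by auto
    then obtain z' y' where "(z', y') \<in> R" "\<forall>x\<in>{0..1}. z' (z x) = x \<and> z (z' x) = x" using R_inverse by blast
    then show ?thesis by (intro bexI[of _ z']) force+
  qed
qed (use N1 R_homeo in auto)

lemma y_family: "map_family N (snd ` R)"
proof
  show "\<exists>z'\<in>snd ` R. \<forall>x\<in>{0..1}. z' (y x) = x \<and> y (z' x) = x" if y: "y \<in> snd ` R" for y
  proof -
    obtain z where "(z, y) \<in> R" using y by auto
    then obtain z' y' where "(z', y') \<in> R" "\<forall>x\<in>{0..1}. y' (y x) = x \<and> y (y' x) = x" using R_inverse by blast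
    then show ?thesis by (intro bexI[of _ y']) force+
  qed
qed (use N1 R_homeo in auto)

abbreviation "Zs \<equiv> fst ` R"
abbreviation "Ys \<equiv> snd ` R"

sublocale zf: map_family N Zs by (rule z_family)
sublocale yf: map_family N Ys by (rule y_family)

definition Rflip where "Rflip = map_prod flip flip ` R"

lemma fst_Rflip: "fst ` Rflip = flip ` Zs"
  unfolding Rflip_def by force+

lemma conjugacy_flip: "conjugacy N Rflip"
proof
  show "1 \<le> N" by (rule N1)
  show "homeo N z \<and> homeo N y" if "(z, y) \<in> Rflip" for z y
    using that R_homeo homeo_flip unfolding Rflip_def by auto
  show "\<exists>z' y'. (z', y') \<in> Rflip \<and> (\<forall>x\<in>{0..1}. z' (z x) = x \<and> z (z' x) = x \<and> y' (y x) = x \<and> y (y' x) = x)"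
    if Rflip: "(z, y) \<in> Rflip" for z y
  proof -
    obtain w where w: "w \<in> R" "(z, y) = map_prod flip flip w" using Rflip unfolding Rflip_def by (elim imageE)
    obtain u v where "w = (u, v)" by (cases w)
    then have uv: "(u, v) \<in> R" "z = flip u" "y = flip v" using w by simp_all
    obtain u' v' where uv': "(u', v') \<in> R" and inv: "\<And>x. x \<in> {0..1} \<Longrightarrow> u' (u x) = x \<and> u (u' x) = x \<and> v' (v x) = x \<and> v (v' x) = x"
      using R_inverse[OF uv(1)] by blast
    have "(flip u', flip v') \<in> Rflip" using uv'(1) unfolding Rflip_def by force
    moreover have "\<forall>x\<in>{0..1}. flip u' (z x) = x \<and> z (flip u' x) = x \<and> flip v' (y x) = x \<and> y (flip v' x) = x"
      using inv unfolding uv by (auto simp: flip_def)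
    ultimately show ?thesis by blast
  qed
qed

lemma conjugates_flip: assumes "conjugates R g" shows "conjugates Rflip (flip g)"
proof -
  have "\<exists>M. homeo M (flip g)" using assms homeo_flip unfolding conjugates_def by blast
  moreover have "y (flip g x) = flip g (z x)" if zy': "(z, y) \<in> Rflip" and x: "x \<in> {0..1}" for z y x
  proof -
    obtain w where w: "w \<in> R" "(z, y) = map_prod flip flip w" using zy' unfolding Rflip_def by (elim imageE)
    obtain u v where "w = (u, v)" by (cases w)
    then have uv: "(u, v) \<in> R" "z = flip u" "y = flip v" using w by simp_all
    show ?thesis using conjugatesD[OF assms uv(1), of "1 - x"] x unfolding uv by (simp add: flip_def)
  qed
  ultimately show ?thesis unfolding conjugates_def by blast
qed

lemma R_inverse_apply:
  assumes "conjugates R g" "(z, y) \<in> R"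
  obtains z' y' where "(z', y') \<in> R" "\<And>x. x \<in> {0..1} \<Longrightarrow> z (z' x) = x" "\<And>x. x \<in> {0..1} \<Longrightarrow> z' (z x) = x"
    "\<And>x. x \<in> {0..1} \<Longrightarrow> g x = y (g (z' x))"
proof -
  obtain z' y' where zy': "(z', y') \<in> R" and inv: "\<And>x. x \<in> {0..1} \<Longrightarrow> z' (z x) = x \<and> z (z' x) = x" using R_inverse[OF assms(2)] by blast
  have "g x = y (g (z' x))" if "x \<in> {0..1}" for x
  proof -
    have "z' x \<in> {0..1}" using homeo_in R_homeo[OF zy'] that by blast
    then have "y (g (z' x)) = g (z (z' x))" by (rule conjugatesD[OF assms])
    then show ?thesis using inv[OF that] by simp
  qed
  then show ?thesis using that zy' inv by blast
qed

lemma conjugates_Fix: assumes g: "conjugates R g" and x: "x \<in> {0..1}" shows "g x \<in> Fix Ys \<longleftrightarrow> x \<in> Fix Zs"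
proof -
  have "y (g x) = g x \<longleftrightarrow> z x = x" if "(z, y) \<in> R" for z y
  proof -
    have "z x \<in> {0..1}" using homeo_in R_homeo[OF that] x by blast
    then show ?thesis using conjugatesD[OF g that x] conjugates_eq_iff[OF g _ x] by simp
  qed
  then show ?thesis using conjugates_in[OF g x] x unfolding Fix_def by force
qed

lemma conjugates_moving: assumes g: "conjugates R g" and m: "moving Zs p p'" shows "moving Ys (g p) (g p')"
proof -
  have pp: "p \<in> {0..1}" "p' \<in> {0..1}" "p < p'" "p \<in> Fix Zs" "p' \<in> Fix Zs" using m by (auto simp: moving_def Fix_def)
  have "v \<notin> Fix Ys" if v: "g p < v" "v < g p'" for v
  proof -
    have "v \<in> {0..1}" using conjugates_in[OF g pp(1)] conjugates_in[OF g pp(2)] v by auto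
    then obtain x where x: "x \<in> {0..1}" "g x = v" using conjugates_ex[OF g] by metis
    have "p < x" "x < p'" using v x conjugates_less_iff[OF g] pp by metis+
    then show ?thesis using m conjugates_Fix[OF g x(1)] x(2) by (auto simp: moving_def)
  qed
  then show ?thesis using conjugates_Fix[OF g] conjugates_less_iff[OF g pp(1,2)] pp by (auto simp: moving_def)
qed

lemma conjugates_right_slope: assumes "conjugates R g" "p \<in> {0..1}" "p < 1" obtains m where "right_slope g p m"
proof -
  obtain M where "level M g {0..1}" using assms homeo_level unfolding conjugates_def by blast
  then have "level M g {p..1}" by (rule level_subset) (use assms in auto)
  then show ?thesis using level_right_slope assms(3) that by metis
qed

text \<open>
  Let \<open>z\<close> contract towards \<open>p\<close>. As \<open>g\<close> is linear close to \<open>p\<close>, the corresponding \<open>y\<close> has the same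
  slope at \<open>g p\<close>. The relation \<open>y (g x) = g (z x)\<close> then transfers the formula for \<open>g\<close> from \<open>z x\<close> to
  \<open>x\<close>, so it holds as long as \<open>z\<close> and \<open>y\<close> are linear. The length of this range does not depend
  on \<open>g\<close>.
\<close>

lemma linear_right:
  assumes g: "conjugates R g" and m: "moving Zs p p'" and k: "right_slope g p k"
    and x: "p \<le> x" "x \<le> p + sep N" and v: "2 powi k * (x - p) \<le> sep N"
  shows "g x = g p + 2 powi k * (x - p)"
proof -
  define q where "q = g p"
  have my: "moving Ys q (g p')" unfolding q_def by (rule conjugates_moving[OF g m])
  have p01: "p \<in> {0..1}" "p + sep N \<le> 1" using m zf.moving_length[OF m] by (auto simp: moving_def Fix_def)
  have q01: "q \<in> {0..1}" "q + sep N \<le> 1" using my yf.moving_length[OF my] by (auto simp: moving_def Fix_def)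
  obtain z j where z: "z \<in> Zs" "j > 0" and zj: "\<And>x. p \<le> x \<Longrightarrow> x \<le> p + sep N \<Longrightarrow> z x = p + 2 powi (- j) * (x - p)"
    using zf.right_germs[OF m] by metis
  obtain y where zy: "(z, y) \<in> R" using z by auto
  have "y \<in> Ys" using zy by force
  then obtain l where yl: "\<And>v. q \<le> v \<Longrightarrow> v \<le> q + sep N \<Longrightarrow> y v = q + 2 powi l * (v - q)"
    using yf.right_germ[OF my] by metis
  obtain \<epsilon> where \<epsilon>: "\<epsilon> > 0" and ge: "\<And>x. p \<le> x \<Longrightarrow> x \<le> p + \<epsilon> \<Longrightarrow> g x = q + 2 powi k * (x - p)"
    using k unfolding right_slope_def q_def by blast
  have half: "0 < (2::real) powi (- j)" "(2::real) powi (- j) \<le> 1 / 2"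
    using two_powi_mono[of "-j" "-1"] z(2) by (auto simp: power_int_minus)
  \<comment> \<open>compare both sides of \<open>y (g x) = g (z x)\<close> at a point \<open>p + d\<close> where all maps involved are linear\<close>
  have lj: "l = - j"
  proof -
    define d where "d = min (sep N) (min \<epsilon> (2 powi (- k) * sep N))"
    have d: "0 < d" "d \<le> sep N" "d \<le> \<epsilon>" "2 powi k * d \<le> sep N"
    proof -
      show "0 < d" "d \<le> sep N" "d \<le> \<epsilon>" using \<epsilon> by (auto simp: d_def)
      have "2 powi k * d \<le> 2 powi k * (2 powi (- k) * sep N)" by (intro mult_left_mono) (auto simp: d_def)
      also have "\<dots> = sep N" by (simp only: mult.assoc[symmetric] two_powi_minus mult_1)
      finally show "2 powi k * d \<le> sep N" .
    qed
    have dj: "0 \<le> 2 powi (- j) * d" "2 powi (- j) * d \<le> d" using half d(1) mult_right_mono[of "2 powi (- j)" 1 d] by auto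
    have "z (p + d) = p + 2 powi (- j) * d" using zj[of "p + d"] d by simp
    moreover have "g (p + 2 powi (- j) * d) = q + 2 powi k * (2 powi (- j) * d)" using ge[of "p + 2 powi (- j) * d"] d dj by simp
    moreover have "g (p + d) = q + 2 powi k * d" using ge[of "p + d"] d by simp
    moreover have "y (q + 2 powi k * d) = q + 2 powi l * (2 powi k * d)" using yl[of "q + 2 powi k * d"] d by simp
    moreover have "y (g (p + d)) = g (z (p + d))" using d p01 by (intro conjugatesD[OF g zy]) auto
    ultimately have "q + 2 powi k * (2 powi (- j) * d) = q + 2 powi l * (2 powi k * d)" by metis
    then have "(2 powi k * d) * 2 powi (- j) = (2 powi k * d) * 2 powi l" by (simp only: mult_ac add_left_cancel)
    moreover have "2 powi k * d \<noteq> 0" using d by simp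
    ultimately have "(2::real) powi l = 2 powi (- j)" by (metis mult_left_cancel)
    then show ?thesis by (rule two_powi_inj)
  qed
  have Ly: "level N y {0..1}" using R_homeo[OF zy] homeo_level by blast
  \<comment> \<open>the distance to \<open>p\<close> at least halves under \<open>z\<close>, so it falls below \<open>\<epsilon>\<close> after \<open>n\<close> steps\<close>
  have main: "g x = q + 2 powi k * (x - p)"
    if "x - p \<le> 2 ^ n * \<epsilon>" "p \<le> x" "x \<le> p + sep N" "2 powi k * (x - p) \<le> sep N" for n x
    using that
  proof (induction n arbitrary: x)
    case 0 then show ?case using ge by simp
  next
    case (Suc n)
    have zx: "z x = p + 2 powi (- j) * (x - p)" using zj Suc.prems by blast
    have le: "0 \<le> 2 powi (- j) * (x - p)" "2 powi (- j) * (x - p) \<le> (x - p) / 2"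
      using half Suc.prems mult_right_mono[of "2 powi (- j)" "1/2" "x - p"] by auto
    have le2: "2 powi k * (2 powi (- j) * (x - p)) \<le> 2 powi k * (x - p)"
      using le Suc.prems by (intro mult_left_mono) auto
    have "g (z x) = q + 2 powi k * (z x - p)"
    proof (rule Suc.IH)
      show "2 powi k * (z x - p) \<le> sep N" using order.trans[OF le2 Suc.prems(4)] unfolding zx by (simp only: add_diff_cancel_left')
    qed (use le Suc.prems in \<open>simp_all add: zx\<close>)
    then have "g (z x) = q + 2 powi (- j) * (2 powi k * (x - p))" unfolding zx by simp
    also have "\<dots> = y (q + 2 powi k * (x - p))"
      using yl[of "q + 2 powi k * (x - p)"] Suc.prems unfolding lj by simp
    finally have "y (g x) = y (q + 2 powi k * (x - p))" using conjugatesD[OF g zy, of x] Suc.prems p01 by auto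
    moreover have "g x \<in> {0..1}" "q + 2 powi k * (x - p) \<in> {0..1}"
      using conjugates_in[OF g, of x] Suc.prems p01 q01 by auto
    ultimately show ?case using level_eq_iff[OF Ly] by blast
  qed
  obtain n where "(x - p) / \<epsilon> < 2 ^ n" using real_arch_pow[of 2] by force
  then have "x - p \<le> 2 ^ n * \<epsilon>" using \<epsilon> by (simp add: field_simps)
  then show ?thesis using main x v unfolding q_def by blast
qed

lemma linear_right':
  assumes g: "conjugates R g" and m: "moving Zs p p'" and k: "right_slope g p k"
    and x: "p \<le> x" "x \<le> p + sep N" and v: "g x \<le> g p + sep N"
  shows "g x = g p + 2 powi k * (x - p)"
proof (cases "2 powi k * (x - p) \<le> sep N")
  case True then show ?thesis by (rule linear_right[OF g m k x])
next
  case False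
  \<comment> \<open>the point where the linear formula reaches \<open>g p + sep N\<close>\<close>
  define w where "w = p + 2 powi (- k) * sep N"
  have p01: "p \<in> {0..1}" "p + sep N \<le> 1" using m zf.moving_length[OF m] by (auto simp: moving_def Fix_def)
  have "2 powi k * (w - p) = sep N" unfolding w_def by (simp add: mult.assoc[symmetric] two_powi_minus)
  moreover from this have "2 powi k * (w - p) < 2 powi k * (x - p)" using False by linarith
  then have "w < x" by simp
  moreover have "p \<le> w" by (simp add: w_def)
  ultimately have "g w = g p + sep N" using linear_right[OF g m k, of w] x by simp
  moreover have "g w < g x" using \<open>w < x\<close> \<open>p \<le> w\<close> x p01 conjugates_less_iff[OF g, of w x] by auto
  ultimately show ?thesis using v by simp
qed


lemma linear_left:
  assumes g: "conjugates R g" and m: "moving Zs p p'"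
  obtains k where "\<And>x. p' - sep N \<le> x \<Longrightarrow> x \<le> p' \<Longrightarrow> g p' - sep N \<le> g x \<Longrightarrow> g x = g p' - 2 powi k * (p' - x)"
proof -
  interpret r: conjugacy N Rflip by (rule conjugacy_flip)
  have m': "moving (fst ` Rflip) (1 - p') (1 - p)" unfolding fst_Rflip by (rule moving_flip[OF m])
  have g': "conjugates Rflip (flip g)" by (rule conjugates_flip[OF g])
  have "1 - p' \<in> {0..1}" "1 - p' < 1" using m by (auto simp: moving_def Fix_def)
  then obtain k where k: "right_slope (flip g) (1 - p') k" using r.conjugates_right_slope[OF g'] by metis
  have "g x = g p' - 2 powi k * (p' - x)" if "p' - sep N \<le> x" "x \<le> p'" "g p' - sep N \<le> g x" for x
    using r.linear_right'[OF g' m' k, of "1 - x"] that by (simp add: flip_def)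
  then show ?thesis using that by blast
qed

text \<open>
  On \<open>[p, z c]\<close> the conjugator equals \<open>y g z\<^sup>-\<^sup>1\<close>, which involves only its values on \<open>[p, c]\<close>.
\<close>

lemma propagate_right:
  assumes g: "conjugates R g" and m: "moving Zs p p'" and c: "p < c" "c < p'" and zy: "(z, y) \<in> R" and lt: "c < z c"
    and L: "level M g {p..c}"
  shows "level (2 * M + 5 * N) g {p..z c}" "z c < p'"
proof -
  obtain z' y' where zy': "(z', y') \<in> R" and inv: "\<And>x. x \<in> {0..1} \<Longrightarrow> z' (z x) = x"
    and ge: "\<And>x. x \<in> {0..1} \<Longrightarrow> g x = y (g (z' x))" using R_inverse_apply[OF g zy] by metis
  have pp: "p \<in> {0..1}" "p' \<in> {0..1}" "c \<in> {0..1}" using m c by (auto simp: moving_def Fix_def)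
  have "p' \<in> Fix Zs" "p \<in> Fix Zs" "z \<in> Zs" "z' \<in> Zs" using m zy zy' by (simp_all add: moving_def image_iff) force+
  then have fp: "z p' = p'" "z' p = p" unfolding Fix_def by blast+
  have Lz: "level N z {0..1}" and Lz': "level N z' {0..1}" and Ly: "level N y {0..1}" using R_homeo[OF zy] R_homeo[OF zy'] homeo_level by auto
  show "z c < p'" using level_less_iff[OF Lz pp(3,2)] fp c by simp
  then have zc: "z c \<in> {0..1}" using lt pp by auto
  have sub: "{p..z c} \<subseteq> {0..1}" using zc pp by auto
  have "z' ` {p..z c} = {z' p..z' (z c)}" by (rule level_image[OF level_subset[OF Lz' sub]]) (use lt c in simp)
  then have im: "z' ` {p..z c} = {p..c}" unfolding fp inv[OF pp(3)] .
  have L1: "level (M + 2 * N) (\<lambda>x. g (z' x)) {p..z c}"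
    by (rule level_comp[OF level_subset[OF Lz' sub]]) (simp only: im L)
  have "g (z' x) \<in> {0..1}" if "x \<in> {p..z c}" for x
    using conjugates_in[OF g] homeo_in R_homeo[OF zy'] that sub by blast
  then have "(\<lambda>x. g (z' x)) ` {p..z c} \<subseteq> {0..1}" by blast
  then have "level (N + 2 * (M + 2 * N)) (\<lambda>x. y (g (z' x))) {p..z c}"
    by (intro level_comp[OF L1] level_subset[OF Ly])
  moreover have "N + 2 * (M + 2 * N) = 2 * M + 5 * N" by simp
  ultimately have "level (2 * M + 5 * N) (\<lambda>x. y (g (z' x))) {p..z c}" by (simp only:)
  then show "level (2 * M + 5 * N) g {p..z c}"
    by (rule level_cong) (use ge sub in \<open>metis subsetD\<close>)
qed

text \<open>
  The level of a linear map bounds its offset \<open>c = g p - 2 powi k * p\<close> as well. This offset is dyadic, since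
  \<open>g\<close> is a map of some level, while \<open>p\<close> and \<open>g p\<close> are in \<^term>\<open>fix_rats N\<close>: multiplied by
  \<open>2 ^ (N + s)\<close> and by odd numbers, \<open>c\<close> becomes an integer. By \<open>odd_denominator\<close> the odd factors can
  be dropped.
\<close>

lemma initial_level:
  assumes g: "conjugates R g" and m: "moving Zs p p'" and k: "right_slope g p k" and s: "\<bar>k\<bar> \<le> int s"
  shows "level (N + s) g {p..p + sep N / 2 ^ s}"
proof -
  note my = conjugates_moving[OF g m]
  have pp: "p \<in> {0..1}" "p < 1" using m by (auto simp: moving_def Fix_def)
  obtain M where "level M g {0..1}" using g homeo_level unfolding conjugates_def by blast
  then have "level M g {p..1}" by (rule level_subset) (use pp in auto)
  then obtain k' where "right_slope g p k'" "g p - 2 powi k' * p \<in> grid M" using level_right_slope pp(2) by metis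
  then have off: "g p - 2 powi k * p \<in> grid M" using right_slope_unique[OF k] by simp
  note b = two_powi_bounds[OF s]
  have lin: "g x = g p + 2 powi k * (x - p)" if "p \<le> x" "x \<le> p + sep N / 2 ^ s" for x
  proof (rule linear_right[OF g m k that(1)])
    have "(1::real) \<le> 2 ^ s" by simp
    then have "sep N * 1 \<le> sep N * 2 ^ s" by (intro mult_left_mono) auto
    then have "sep N / 2 ^ s \<le> sep N" by (simp add: divide_le_eq)
    then show "x \<le> p + sep N" using that by linarith
    have "2 powi k * (x - p) \<le> 2 ^ s * (sep N / 2 ^ s)" using that b by (intro mult_mono) auto
    then show "2 powi k * (x - p) \<le> sep N" by simp
  qed
  define c where "c = g p - 2 powi k * p"
  have dc: "c \<in> grid M" unfolding c_def by (rule off)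
  obtain i where i: "i \<in> {1..N}" "p * (2 ^ N * (2 ^ i - 1)) \<in> \<int>" using zf.moving_fix_rats(1)[OF m] by (auto simp: fix_rats_def)
  obtain l where l: "l \<in> {1..N}" "g p * (2 ^ N * (2 ^ l - 1)) \<in> \<int>" using yf.moving_fix_rats(1)[OF my] by (auto simp: fix_rats_def)
  have ks: "2 powi k * 2 ^ s = (2 ^ nat (k + int s) :: real)"
    using s two_powi_add[of k "int s"] by (simp add: two_powi_nat[symmetric])
  have "c * 2 ^ (N + s) * ((2 ^ i - 1) * (2 ^ l - 1)) =
      g p * (2 ^ N * (2 ^ l - 1)) * (2 ^ s * (2 ^ i - 1)) - p * (2 ^ N * (2 ^ i - 1)) * ((2 powi k * 2 ^ s) * (2 ^ l - 1))"
    unfolding c_def by (simp add: algebra_simps power_add)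
  also have "\<dots> \<in> \<int>"
  proof (rule Ints_diff)
    have "(2 ^ s * (2 ^ i - 1) :: real) \<in> \<int>" by (rule Ints_mult) simp_all
    then show "g p * (2 ^ N * (2 ^ l - 1)) * (2 ^ s * (2 ^ i - 1)) \<in> \<int>" by (rule Ints_mult[OF l(2)])
    have "((2 powi k * 2 ^ s) * (2 ^ l - 1) :: real) \<in> \<int>" unfolding ks by (rule Ints_mult) simp_all
    then show "p * (2 ^ N * (2 ^ i - 1)) * ((2 powi k * 2 ^ s) * (2 ^ l - 1)) \<in> \<int>" by (rule Ints_mult[OF i(2)])
  qed
  finally have int: "c * 2 ^ (N + s) * of_int ((2 ^ i - 1) * (2 ^ l - 1)) \<in> \<int>"
    by (simp only: of_int_mult of_int_diff of_int_power of_int_numeral of_int_1)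
  have "c * 2 ^ M * 2 ^ (N + s) \<in> \<int>" using gridD[OF dc] by (rule Ints_mult) simp
  then have "c * 2 ^ (N + s) \<in> grid M" by (intro gridI) (simp only: mult_ac)
  then have "c * 2 ^ (N + s) \<in> \<int>" using odd_denominator[OF int] i(1) l(1) by simp
  then have cg: "c \<in> grid (N + s)" by (rule gridI)
  show "level (N + s) g {p..p + sep N / 2 ^ s}"
  proof (rule level_affine[of k _ c])
    show "g x = 2 powi k * x + c" if "x \<in> {p..p + sep N / 2 ^ s}" for x
      using lin[of x] that unfolding c_def by (simp add: right_diff_distrib)
  qed (use s cg in auto)
qed

end

section \<open>The first point where two maps do not commute\<close>

text \<open>
  Consider the leftmost cell on which the maps differ at some point. They agree at its left end
  \<open>c\<close>, so they differ everywhere else on this cell, both being affine there.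
\<close>

lemma first_difference:
  assumes L1: "level K f1 {p..p'}" and L2: "level K f2 {p..p'}"
    and init: "0 < \<epsilon>" "\<And>x. p \<le> x \<Longrightarrow> x \<le> p + \<epsilon> \<Longrightarrow> f1 x = f2 x"
    and x0: "x0 \<in> {p..p'}" "f1 x0 \<noteq> f2 x0"
  obtains c where "c \<in> grid K" "p < c" "c < p'" "\<And>x. p \<le> x \<Longrightarrow> x \<le> c \<Longrightarrow> f1 x = f2 x"
    "\<And>x. c < x \<Longrightarrow> x \<le> c + 1 / 2 ^ K \<Longrightarrow> x \<le> p' \<Longrightarrow> f1 x \<noteq> f2 x"
proof -
  define D where "D i \<longleftrightarrow> (\<exists>x\<in>{p..p'}. in_cell K i x \<and> f1 x \<noteq> f2 x)" for i
  define b where "b = \<lfloor>p * 2 ^ K\<rfloor> - 1"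
  have Db: "b \<le> i" if Di: "D i" for i
  proof -
    obtain x where x: "x \<in> {p..p'}" "in_cell K i x" using Di unfolding D_def by blast
    have "p * 2 ^ K \<le> x * 2 ^ K" using x(1) by simp
    then have "p * 2 ^ K \<le> of_int i + 1" using x(2) unfolding in_cell_def by linarith
    then show ?thesis unfolding b_def by linarith
  qed
  have ex: "D \<lfloor>x0 * 2 ^ K\<rfloor>" unfolding D_def using x0 in_cell_floor by blast
  define n where "n = (LEAST n. D (b + int n))"
  have "D (b + int (nat (\<lfloor>x0 * 2 ^ K\<rfloor> - b)))" using ex Db[OF ex] by simp
  then have Dn: "D (b + int n)" unfolding n_def by (rule LeastI)
  define i where "i = b + int n"
  have Di: "D i" using Dn by (simp add: i_def)
  have min: "\<not> D k" if "k < i" for k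
  proof
    assume Dk: "D k"
    then have "D (b + int (nat (k - b)))" using Db[OF Dk] by simp
    then have "n \<le> nat (k - b)" unfolding n_def by (rule Least_le)
    then show False using that Db[OF Dk] by (simp add: i_def)
  qed
  define c where "c = of_int i / (2 ^ K :: real)"
  have c2: "c * 2 ^ K = of_int i" by (simp add: c_def)
  have before: "f1 x = f2 x" if "x \<in> {p..p'}" "x < c" for x
  proof -
    have "x * 2 ^ K < of_int i" using that(2) c2 by (metis mult_strict_right_mono zero_less_numeral zero_less_power)
    then have "\<lfloor>x * 2 ^ K\<rfloor> < i" by (simp add: floor_less_iff)
    then show ?thesis using min that(1) in_cell_floor[of K x] unfolding D_def by blast
  qed
  obtain j1 e1 where 1: "\<And>x. x \<in> {p..p'} \<Longrightarrow> in_cell K i x \<Longrightarrow> f1 x = 2 powi j1 * x + e1" using levelE[OF L1] by metis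
  obtain j2 e2 where 2: "\<And>x. x \<in> {p..p'} \<Longrightarrow> in_cell K i x \<Longrightarrow> f2 x = 2 powi j2 * x + e2" using levelE[OF L2] by metis
  obtain x1 where x1: "x1 \<in> {p..p'}" "in_cell K i x1" "f1 x1 \<noteq> f2 x1" using Di unfolding D_def by blast
  have distinct: "u = v" if "u \<in> {p..p'}" "in_cell K i u" "f1 u = f2 u" "v \<in> {p..p'}" "in_cell K i v" "f1 v = f2 v" for u v
  proof (rule ccontr)
    assume "u \<noteq> v"
    moreover have "2 powi j1 * u + e1 = 2 powi j2 * u + e2" "2 powi j1 * v + e1 = 2 powi j2 * v + e2"
      using 1[of u] 2[of u] 1[of v] 2[of v] that by auto
    ultimately have "j1 = j2 \<and> e1 = e2" using affine_unique by blast
    then show False using 1 2 x1 by auto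
  qed
  have pc: "p < c"
  proof (rule ccontr)
    assume "\<not> p < c"
    then have le: "of_int i / 2 ^ K \<le> p" by (simp add: c_def)
    have "p + \<epsilon> < x1" using init x1 by (metis atLeastAtMost_iff not_le)
    then have "in_cell K i p" "in_cell K i (p + \<epsilon>)" using le x1(2) init(1) unfolding in_cell_iff by linarith+
    then have "p = p + \<epsilon>" using distinct[of p "p + \<epsilon>"] init \<open>p + \<epsilon> < x1\<close> x1(1) by auto
    then show False using init(1) by simp
  qed
  have cx1: "c \<le> x1" using x1(2) unfolding in_cell_iff c_def by simp
  have "in_cell K (i - 1) c" unfolding in_cell_def c2 by simp
  then have fc: "f1 c = f2 c" using min[of "i - 1"] pc cx1 x1(1) unfolding D_def by auto
  have cp': "c < p'" using cx1 fc x1 by (cases "c = x1") auto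
  have icc: "in_cell K i c" unfolding in_cell_def c2 by simp
  have after: "f1 x \<noteq> f2 x" if "c < x" "x \<le> c + 1 / 2 ^ K" "x \<le> p'" for x
  proof
    assume "f1 x = f2 x"
    moreover have "in_cell K i x" using that unfolding in_cell_iff c_def by (simp add: add_divide_distrib)
    ultimately have "c = x" using distinct[of c x] icc fc that pc cp' by auto
    then show False using that by simp
  qed
  have "f1 x = f2 x" if "p \<le> x" "x \<le> c" for x
    using before[of x] fc that cp' by (cases "x = c") auto
  then show ?thesis using that[of c] after pc cp' by (simp add: c_def)
qed

lemma grid_fix_rats_sep:
  assumes "c \<in> grid K" "r \<in> fix_rats N" "N \<le> K" "c \<noteq> r" shows "1 / 2 ^ (K + N) \<le> \<bar>c - r\<bar>"
proof -
  obtain i where i: "i \<in> {1..N}" "r * (2 ^ N * (2 ^ i - 1)) \<in> \<int>" using assms(2) by (auto simp: fix_rats_def)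
  have K: "(2::real) ^ K = 2 ^ N * 2 ^ (K - N)" using assms(3) by (simp flip: power_add)
  have 1: "c * 2 ^ K * (2 ^ i - 1) \<in> \<int>" by (rule Ints_mult[OF gridD[OF assms(1)]]) simp
  have 2: "r * (2 ^ N * (2 ^ i - 1)) * 2 ^ (K - N) \<in> \<int>" by (rule Ints_mult[OF i(2)]) simp
  have "(c - r) * (2 ^ K * (2 ^ i - 1)) = c * 2 ^ K * (2 ^ i - 1) - r * (2 ^ N * (2 ^ i - 1)) * 2 ^ (K - N)"
    unfolding K by (simp add: algebra_simps)
  also have "\<dots> \<in> \<int>" using 1 2 by (rule Ints_diff)
  finally have int: "(c - r) * (2 ^ K * (2 ^ i - 1)) \<in> \<int>" .
  have "(1::real) < 2 ^ i" using i by (auto intro: one_less_power)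
  then have pos: "0 < (2 ^ K * (2 ^ i - 1) :: real)" by simp
  have "1 \<le> \<bar>(c - r) * (2 ^ K * (2 ^ i - 1))\<bar>"
    by (rule Ints_nonzero_abs_ge1[OF int]) (use pos assms(4) in auto)
  also have "\<dots> = \<bar>c - r\<bar> * (2 ^ K * (2 ^ i - 1))" using pos by (simp add: abs_mult)
  also have "\<dots> \<le> \<bar>c - r\<bar> * (2 ^ K * 2 ^ N)"
  proof -
    have "(2::real) ^ i \<le> 2 ^ N" using i by (intro power_increasing) auto
    then have "(2::real) ^ i - 1 \<le> 2 ^ N" by linarith
    then show ?thesis by (intro mult_left_mono) auto
  qed
  finally show ?thesis by (simp add: field_simps power_add)
qed

context map_family begin

text \<open>
  Close to \<open>p\<close> all maps are dilations about \<open>p\<close> and commute. The end of this range is a grid point of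
  level \<open>3 * N\<close>, the level of the two products, so its distance to both ends is bounded below.
\<close>

lemma first_noncommuting:
  assumes m: "moving Z p p'" and ab: "a \<in> Z" "b \<in> Z" and x0: "x0 \<in> {p..p'}" "a (b x0) \<noteq> b (a x0)"
  obtains c where "p + 1 / 2 ^ (4 * N) \<le> c" "c \<le> p' - 1 / 2 ^ (4 * N)" "\<And>x. p \<le> x \<Longrightarrow> x \<le> c \<Longrightarrow> a (b x) = b (a x)"
    "\<And>x. c < x \<Longrightarrow> x \<le> c + 1 / 2 ^ (3 * N) \<Longrightarrow> x \<le> p' \<Longrightarrow> a (b x) \<noteq> b (a x)"
proof -
  have sub: "{p..p'} \<subseteq> {0..1}" using m by (auto simp: moving_def Fix_def)
  have L: "level (N + 2 * N) (\<lambda>x. a (b x)) {p..p'}" "level (N + 2 * N) (\<lambda>x. b (a x)) {p..p'}"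
    by (rule level_subset[OF homeo_level[OF homeo_comp[OF Z_homeo[OF ab(2)] Z_homeo[OF ab(1)]]] sub],
        rule level_subset[OF homeo_level[OF homeo_comp[OF Z_homeo[OF ab(1)] Z_homeo[OF ab(2)]]] sub])
  obtain i where i: "\<bar>i\<bar> \<le> int N" and ai: "\<And>x. p \<le> x \<Longrightarrow> x \<le> p + sep N \<Longrightarrow> a x = p + 2 powi i * (x - p)" using right_germ[OF m ab(1)] by metis
  obtain j where j: "\<bar>j\<bar> \<le> int N" and bj: "\<And>x. p \<le> x \<Longrightarrow> x \<le> p + sep N \<Longrightarrow> b x = p + 2 powi j * (x - p)" using right_germ[OF m ab(2)] by metis
  have init: "a (b x) = b (a x)" if x: "p \<le> x" "x \<le> p + sep N / 2 ^ N" for x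
  proof -
    have le: "2 powi l * (x - p) \<le> sep N" if "\<bar>l\<bar> \<le> int N" for l
    proof -
      have "2 powi l * (x - p) \<le> 2 ^ N * (sep N / 2 ^ N)" using two_powi_bounds[OF that] x by (intro mult_mono) auto
      then show ?thesis by simp
    qed
    have x2: "x \<le> p + sep N" using le[of 0] by simp
    have "a (b x) = p + 2 powi i * (2 powi j * (x - p))" using bj[OF x(1) x2] ai[of "p + 2 powi j * (x - p)"] le[OF j] x by simp
    moreover have "b (a x) = p + 2 powi j * (2 powi i * (x - p))" using ai[OF x(1) x2] bj[of "p + 2 powi i * (x - p)"] le[OF i] x by simp
    ultimately show ?thesis by simp
  qed
  have e: "N + 2 * N = 3 * N" "3 * N + N = 4 * N" "N \<le> 3 * N" "0 < sep N / 2 ^ N" by simp_all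
  obtain c where c: "c \<in> grid (3 * N)" "p < c" "c < p'" "\<And>x. p \<le> x \<Longrightarrow> x \<le> c \<Longrightarrow> a (b x) = b (a x)"
    "\<And>x. c < x \<Longrightarrow> x \<le> c + 1 / 2 ^ (3 * N) \<Longrightarrow> x \<le> p' \<Longrightarrow> a (b x) \<noteq> b (a x)"
    using first_difference[OF L[unfolded e(1)] e(4) init x0] by metis
  have "1 / 2 ^ (4 * N) \<le> \<bar>c - p\<bar>" "1 / 2 ^ (4 * N) \<le> \<bar>c - p'\<bar>"
    using grid_fix_rats_sep[OF c(1) moving_fix_rats(1)[OF m] e(3)] grid_fix_rats_sep[OF c(1) moving_fix_rats(2)[OF m] e(3)] c(2,3) unfolding e(2) by auto
  then show ?thesis using c by (intro that[of c]) auto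
qed

end

lemma smooth_nondyadic:
  assumes f: "homeo M f" and p: "p \<in> {0..1}" "p \<notin> grid M"
  obtains \<epsilon> j e where "0 < \<epsilon>" "\<And>x. p - \<epsilon> \<le> x \<Longrightarrow> x \<le> p + \<epsilon> \<Longrightarrow> f x = 2 powi j * x + e"
proof -
  define i where "i = \<lfloor>p * 2 ^ M\<rfloor>"
  obtain j e where je: "\<And>x. x \<in> {0..1} \<Longrightarrow> in_cell M i x \<Longrightarrow> f x = 2 powi j * x + e" using levelE[OF homeo_level[OF f]] by metis
  have ic: "in_cell M i p" unfolding i_def by (rule in_cell_floor)
  have "p \<noteq> of_int i / 2 ^ M" "p \<noteq> of_int (i + 1) / 2 ^ M" "p \<noteq> 0" "p \<noteq> 1" using p(2) grid_frac grid_01 by metis+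
  then have s: "of_int i / 2 ^ M < p" "p < (of_int i + 1) / 2 ^ M" "0 < p" "p < 1" using ic p(1) unfolding in_cell_iff by auto
  define \<epsilon> where "\<epsilon> = min (min (p - of_int i / 2 ^ M) ((of_int i + 1) / 2 ^ M - p)) (min p (1 - p))"
  have "0 < \<epsilon>" using s by (simp add: \<epsilon>_def)
  moreover have "f x = 2 powi j * x + e" if "p - \<epsilon> \<le> x" "x \<le> p + \<epsilon>" for x
    by (rule je) (use that in \<open>auto simp: \<epsilon>_def in_cell_iff\<close>)
  ultimately show ?thesis by (rule that)
qed

section \<open>Conjugators on a moving interval\<close>

text \<open>
  A bound for the level of a conjugator on a moving interval in terms of its slope \<open>2 powi k\<close>,
  \<open>\<bar>k\<bar> \<le> s\<close>, at one end. The exponent of 3 is the number of steps that may be needed to cross the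
  interval.
\<close>

definition spread :: "nat \<Rightarrow> nat \<Rightarrow> nat" where "spread N s = (6 * N + s) * 3 ^ Suc (2 ^ (5 * N + 2 * s + 5))"

lemma spread_ge: "s \<le> spread N s"
proof -
  have "(6 * N + s) * 1 \<le> (6 * N + s) * 3 ^ Suc (2 ^ (5 * N + 2 * s + 5))" by (intro mult_left_mono) auto
  then have "6 * N + s \<le> spread N s" unfolding spread_def mult_1_right .
  then show ?thesis by simp
qed

lemma spread_iter: "s \<le> (spread N ^^ n) s" "m \<le> n \<Longrightarrow> (spread N ^^ m) s \<le> (spread N ^^ n) s"
proof -
  show 1: "s \<le> (spread N ^^ n) s" for s n by (induction n) (auto intro: order.trans spread_ge)
  have 2: "(spread N ^^ m) s \<le> (spread N ^^ (k + m)) s" for k using 1[of "(spread N ^^ m) s" k] by (simp add: funpow_add)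
  show "m \<le> n \<Longrightarrow> (spread N ^^ m) s \<le> (spread N ^^ n) s" using 2[of "n - m"] by simp
qed

definition slope_bound :: "nat \<Rightarrow> nat" where "slope_bound N = N * 2 ^ (5 * N + 4)"

context conjugacy begin

text \<open>
  Near \<open>p\<close> the conjugator is linear with the given slope. Each step with \<open>propagate_right\<close> extends
  the control over it, and by \<open>steps\<close> it can be chosen to advance \<open>c\<close> or \<open>g c\<close> by a
  fixed amount, until both are close to the right ends. There \<open>g\<close> is linear again, and the overlap with
  the part already controlled bounds its slope.
\<close>

lemma moving_bound:
  assumes g: "conjugates R g" and m: "moving Zs p p'" and k: "right_slope g p k" and s: "\<bar>k\<bar> \<le> int s"
  shows "level (spread N s) g {p..p'}"
proof -
  define q where "q = g p"
  define q' where "q' = g p'"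
  have my: "moving Ys q q'" unfolding q_def q'_def by (rule conjugates_moving[OF g m])
  have pp: "p \<in> {0..1}" "p' \<in> {0..1}" using m by (auto simp: moving_def Fix_def)
  \<comment> \<open>the initial linear part contains a point \<open>c\<close> with \<open>p + \<kappa> \<le> c\<close> and \<open>g p + \<kappa> \<le> g c\<close>
    (the slope is at least \<open>1 / 2 ^ (N + s)\<close>); each step gains \<open>\<sigma>\<close>\<close>
  define \<kappa> where "\<kappa> = sep N / 2 ^ (N + 2 * s + 1)"
  have two1: "(1::real) \<le> 2 ^ n" for n by simp
  have small: "sep N / 2 ^ n \<le> sep N" for n
  proof -
    have "sep N * 1 \<le> sep N * 2 ^ n" using two1[of n] by (intro mult_left_mono) auto
    then show ?thesis by (simp add: divide_le_eq)
  qed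
  have \<kappa>: "0 < \<kappa>" "\<kappa> \<le> sep N" unfolding \<kappa>_def by (simp, rule small)
  define \<sigma> where "\<sigma> = \<kappa> / 2 ^ (N + 2)"
  have \<sigma>: "0 < \<sigma>" using \<kappa> by (simp add: \<sigma>_def)
  define M where "M t = (6 * N + s) * 3 ^ t" for t
  have M_step: "2 * M t + 5 * N \<le> M (Suc t)" for t
  proof -
    have "(6 * N + s) * 1 \<le> (6 * N + s) * 3 ^ t" by (intro mult_left_mono) auto
    then have "5 * N \<le> M t" unfolding M_def mult_1_right by linarith
    moreover have "M (Suc t) = 3 * M t" unfolding M_def by simp
    ultimately show ?thesis by linarith
  qed
  note L0 = initial_level[OF g m k s]
  \<comment> \<open>the sum \<open>c + g c\<close> grows by \<open>\<sigma>\<close> in each step but never exceeds 2\<close>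
  have claim: "\<exists>c. p + \<kappa> \<le> c \<and> c < p' \<and> q + \<kappa> \<le> g c \<and> level (M t) g {p..c} \<and>
      (p' - \<kappa> \<le> c \<and> q' - \<kappa> \<le> g c \<or> real t * \<sigma> \<le> c + g c)" for t
  proof (induction t)
    case 0
    define c where "c = p + sep N / 2 ^ (s + 1)"
    have c1: "c \<le> p + sep N / 2 ^ s" unfolding c_def by (simp add: field_simps)
    have "sep N / 2 ^ (s + 1) < sep N / 2 ^ s" by (simp add: field_simps)
    then have c2: "c < p'" using small[of s] zf.moving_length[OF m] unfolding c_def by linarith
    have c3: "p < c" unfolding c_def by simp
    have cc: "c \<in> {0..1}" using c2 c3 pp by auto
    have L: "level (N + s) g {p..c}" by (rule level_subset[OF L0]) (use c1 in auto)
    have "(c - p) / 2 ^ (N + s) \<le> g c - g p" using level_slope(2)[OF L order.refl less_imp_le[OF c3] order.refl] .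
    moreover have e: "N + 2 * s + 1 = (s + 1) + (N + s)" by simp
    have cp: "(c - p) / 2 ^ (N + s) = \<kappa>"
      unfolding c_def \<kappa>_def e power_add[of _ "s + 1" "N + s"] by (simp only: divide_divide_eq_left add_diff_cancel_left')
    ultimately have "q + \<kappa> \<le> g c" unfolding q_def by linarith
    moreover have "\<kappa> \<le> c - p"
    proof -
      have "\<kappa> * 2 ^ (N + s) = c - p" unfolding cp[symmetric] by simp
      moreover have "\<kappa> * 1 \<le> \<kappa> * 2 ^ (N + s)" using \<kappa> by (intro mult_left_mono) auto
      ultimately show ?thesis by linarith
    qed
    moreover have "level (M 0) g {p..c}" by (rule level_mono[OF L]) (simp add: M_def)
    ultimately show ?case using c2 conjugates_in[OF g cc] cc by (intro exI[of _ c]) auto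
  next
    case (Suc t)
    then obtain c where c: "p + \<kappa> \<le> c" "c < p'" "q + \<kappa> \<le> g c" "level (M t) g {p..c}"
      and alt: "p' - \<kappa> \<le> c \<and> q' - \<kappa> \<le> g c \<or> real t * \<sigma> \<le> c + g c" by blast
    have cc: "c \<in> {0..1}" "p < c" using c \<kappa> pp by auto
    show ?case
    proof (cases "p' - \<kappa> \<le> c \<and> q' - \<kappa> \<le> g c")
      case True
      have "M t \<le> M (Suc t)" using M_step[of t] by simp
      then show ?thesis using c True level_mono by (intro exI[of _ c]) blast
    next
      case False
      have "\<exists>z y. (z, y) \<in> R \<and> c < z c \<and> c + g c + \<sigma> \<le> z c + g (z c)"
      proof (cases "p' - \<kappa> \<le> c")
        case False
        then obtain z where z: "z \<in> Zs" "c + \<sigma> \<le> z c" using zf.steps(1)[OF m \<kappa> c(1)] by (auto simp: \<sigma>_def)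
        then obtain y where zy: "(z, y) \<in> R" by auto
        have "g c \<le> g (z c)" using conjugates_le_iff[OF g cc(1), of "z c"] z(2) \<sigma> homeo_in R_homeo[OF zy] cc(1) by auto
        then show ?thesis using zy z(2) \<sigma> by (intro exI[of _ z] exI[of _ y]) auto
      next
        case True
        then have "g c \<le> q' - \<kappa>" using False by simp
        then obtain y where y: "y \<in> Ys" "g c + \<sigma> \<le> y (g c)" using yf.steps(1)[OF my \<kappa> c(3)] by (auto simp: \<sigma>_def)
        then obtain z where zy: "(z, y) \<in> R" by auto
        have "y (g c) = g (z c)" by (rule conjugatesD[OF g zy cc(1)])
        then have gz: "g c + \<sigma> \<le> g (z c)" using y(2) by simp
        then have "c < z c" using conjugates_less_iff[OF g cc(1), of "z c"] \<sigma> homeo_in R_homeo[OF zy] cc(1) by auto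
        then show ?thesis using zy gz by (intro exI[of _ z] exI[of _ y]) auto
      qed
      then obtain z y where zy: "(z, y) \<in> R" "c < z c" "c + g c + \<sigma> \<le> z c + g (z c)" by blast
      have st: "level (2 * M t + 5 * N) g {p..z c}" "z c < p'" using propagate_right[OF g m cc(2) c(2) zy(1,2) c(4)] by auto
      have "level (M (Suc t)) g {p..z c}" by (rule level_mono[OF st(1) M_step])
      moreover have "g c \<le> g (z c)" using conjugates_le_iff[OF g cc(1), of "z c"] zy(2) st(2) pp cc by auto
      moreover have "real (Suc t) * \<sigma> \<le> z c + g (z c)" using alt False zy(3) by (auto simp: algebra_simps)
      ultimately show ?thesis using c zy(2) st(2) by (intro exI[of _ "z c"]) auto
    qed
  qed
  define t0 where "t0 = (2::nat) ^ (5 * N + 2 * s + 5)"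
  have e1: "5 * N + 2 * s + 3 = 3 * N + (N + 2 * s + 1) + (N + 2)" and e2: "5 * N + 2 * s + 5 = (5 * N + 2 * s + 3) + 2" by simp_all
  have "\<sigma> = 1 / 2 ^ (5 * N + 2 * s + 3)"
    unfolding \<sigma>_def \<kappa>_def sep_def e1 power_add[of _ _ "N + 2"] power_add[of _ "3 * N"] by (simp only: divide_divide_eq_left mult.assoc)
  moreover have "real t0 = 2 ^ (5 * N + 2 * s + 3) * 4" unfolding t0_def e2 power_add[of _ _ 2] by simp
  ultimately have "real t0 * \<sigma> = 4" by simp
  obtain c where c: "p + \<kappa> \<le> c" "c < p'" "level (M t0) g {p..c}"
      and alt: "p' - \<kappa> \<le> c \<and> q' - \<kappa> \<le> g c \<or> real t0 * \<sigma> \<le> c + g c" using claim[of t0] by blast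
  have cc: "c \<in> {0..1}" "p < c" using c \<kappa> pp by auto
  have "c + g c \<le> 2" using cc conjugates_in[OF g cc(1)] by auto
  then have near: "p' - \<kappa> \<le> c" "q' - \<kappa> \<le> g c" using alt \<open>real t0 * \<sigma> = 4\<close> by auto
  obtain l where l: "\<And>x. p' - sep N \<le> x \<Longrightarrow> x \<le> p' \<Longrightarrow> g p' - sep N \<le> g x \<Longrightarrow> g x = g p' - 2 powi l * (p' - x)"
    using linear_left[OF g m] by metis
  have lin: "g x = 2 powi l * x + (g p' - 2 powi l * p')" if "c \<le> x" "x \<le> p'" for x
  proof -
    have "g c \<le> g x" using conjugates_le_iff[OF g cc(1), of x] that pp cc by auto
    then have "g x = g p' - 2 powi l * (p' - x)" using that near \<kappa> unfolding q'_def by (intro l) auto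
    then show ?thesis by (simp add: algebra_simps)
  qed
  \<comment> \<open>one more step makes the controlled part overlap with the linear end \<open>[c, p']\<close>\<close>
  have "c \<notin> Fix Zs" using m cc c by (auto simp: moving_def)
  then obtain z0 where z0: "z0 \<in> Zs" "z0 c \<noteq> c" using cc by (auto simp: Fix_def)
  have "\<exists>z\<in>Zs. c < z c"
  proof (cases "c < z0 c")
    case True then show ?thesis using z0 by blast
  next
    case False
    then obtain z where "z \<in> Zs" "c + (c - z0 c) / 2 ^ N \<le> z c"
      using zf.inverse_displacement(1)[OF z0(1) cc(1), of "c - z0 c"] by auto
    moreover have "0 < (c - z0 c) / 2 ^ N" using False z0 by simp
    ultimately show ?thesis by (intro bexI[of _ z]) auto
  qed
  then obtain z y where zy: "(z, y) \<in> R" "c < z c" by auto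
  have st: "level (2 * M t0 + 5 * N) g {p..z c}" "z c < p'" using propagate_right[OF g m cc(2) c(2) zy c(3)] by auto
  have "level (M (Suc t0)) g {p..z c}" by (rule level_mono[OF st(1) M_step])
  then have "level (M (Suc t0)) g {p..p'}"
    by (rule level_extend_affine[where d = c, OF _ lin]) (use cc zy st in auto)
  then show ?thesis unfolding M_def spread_def t0_def .
qed


text \<open>
  The conjugator maps the first point \<open>c\<close> where \<open>z1 z2\<close> and \<open>z2 z1\<close> part to the first point \<open>d\<close>
  where \<open>y1 y2\<close> and \<open>y2 y1\<close> part, so one point of its graph is known. Moving this point by the pairs
  in \<open>R\<close> towards \<open>(p, g p)\<close>, until it lies in the range where \<open>g\<close> is linear, determines the slope.
\<close>

lemma noncommuting_slope:
  assumes g: "conjugates R g" and m: "moving Zs p p'" and k: "right_slope g p k"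
    and zy1: "(z1, y1) \<in> R" and zy2: "(z2, y2) \<in> R" and x0: "p < x0" "x0 < p'" "z1 (z2 x0) \<noteq> z2 (z1 x0)"
  shows "\<bar>k\<bar> \<le> int (slope_bound N)"
proof -
  define q where "q = g p"
  define q' where "q' = g p'"
  have my: "moving Ys q q'" unfolding q_def q'_def by (rule conjugates_moving[OF g m])
  have pp: "p \<in> {0..1}" "p' \<in> {0..1}" "p < p'" "q \<in> {0..1}" "q' \<in> {0..1}" using m my by (auto simp: moving_def Fix_def)
  have mem: "z1 \<in> Zs" "z2 \<in> Zs" "y1 \<in> Ys" "y2 \<in> Ys" using zy1 zy2 by force+
  have vf: "y1 (y2 (g x)) = y2 (y1 (g x)) \<longleftrightarrow> z1 (z2 x) = z2 (z1 x)" if x: "x \<in> {0..1}" for x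
  proof -
    have z: "z1 x \<in> {0..1}" "z2 x \<in> {0..1}" using homeo_in R_homeo[OF zy1] R_homeo[OF zy2] x by blast+
    then have zz: "z1 (z2 x) \<in> {0..1}" "z2 (z1 x) \<in> {0..1}" using homeo_in R_homeo[OF zy1] R_homeo[OF zy2] by blast+
    have "y1 (y2 (g x)) = g (z1 (z2 x))" "y2 (y1 (g x)) = g (z2 (z1 x))"
      using conjugatesD[OF g zy1 x] conjugatesD[OF g zy2 x] conjugatesD[OF g zy1 z(2)] conjugatesD[OF g zy2 z(1)] by simp_all
    then show ?thesis using conjugates_eq_iff[OF g zz] by simp
  qed
  define \<kappa> where "\<kappa> = 1 / (2::real) ^ (4 * N)"
  have \<kappa>: "0 < \<kappa>" "\<kappa> \<le> sep N" unfolding \<kappa>_def sep_def by (auto simp: frac_le)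
  have x01: "x0 \<in> {p..p'}" "x0 \<in> {0..1}" using x0 pp by auto
  obtain c where c: "p + \<kappa> \<le> c" "c \<le> p' - \<kappa>" "\<And>x. p \<le> x \<Longrightarrow> x \<le> c \<Longrightarrow> z1 (z2 x) = z2 (z1 x)"
    "\<And>x. c < x \<Longrightarrow> x \<le> c + 1 / 2 ^ (3 * N) \<Longrightarrow> x \<le> p' \<Longrightarrow> z1 (z2 x) \<noteq> z2 (z1 x)"
    using zf.first_noncommuting[OF m mem(1,2) x01(1) x0(3), folded \<kappa>_def] by metis
  have gx0: "g x0 \<in> {q..q'}" using conjugates_le_iff[OF g] x01 pp unfolding q_def q'_def by auto
  have "y1 (y2 (g x0)) \<noteq> y2 (y1 (g x0))" using vf[OF x01(2)] x0(3) by simp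
  then obtain d where d: "q + \<kappa> \<le> d" "d \<le> q' - \<kappa>" "\<And>x. q \<le> x \<Longrightarrow> x \<le> d \<Longrightarrow> y1 (y2 x) = y2 (y1 x)"
    "\<And>x. d < x \<Longrightarrow> x \<le> d + 1 / 2 ^ (3 * N) \<Longrightarrow> x \<le> q' \<Longrightarrow> y1 (y2 x) \<noteq> y2 (y1 x)"
    using yf.first_noncommuting[OF my mem(3,4) gx0, folded \<kappa>_def] by metis
  have eps: "0 < (1::real) / 2 ^ (3 * N)" by simp
  have c01: "c \<in> {0..1}" using c(1,2) \<kappa> pp by auto
  have d01: "d \<in> {0..1}" using d(1,2) \<kappa> pp by auto
  \<comment> \<open>if \<open>g c \<noteq> d\<close>, a point just after \<open>c\<close>, or the preimage of a point just after \<open>d\<close>, yields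
    maps that commute on one side of the conjugacy only\<close>
  have gcd: "g c = d"
  proof (rule linorder_cases[of "g c" d])
    assume lt: "g c < d"
    obtain u where u: "u \<in> {0..1}" "g u = d" using conjugates_ex[OF g d01] by metis
    have cu: "c < u" "u < p'" using conjugates_less_iff[OF g c01 u(1)] conjugates_less_iff[OF g u(1) pp(2)] lt u(2) d(2) \<kappa> unfolding q'_def by auto
    define x where "x = min u (c + 1 / 2 ^ (3 * N))"
    have x: "c < x" "x \<le> c + 1 / 2 ^ (3 * N)" "x \<le> u" using cu eps unfolding x_def by auto
    have xx: "x \<in> {0..1}" using x c01 u by auto
    have "g x \<le> d" using conjugates_le_iff[OF g xx u(1)] x(3) u(2) by simp
    moreover have "q \<le> g x" unfolding q_def using conjugates_le_iff[OF g pp(1) xx] x c(1) \<kappa> by simp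
    ultimately have "z1 (z2 x) = z2 (z1 x)" using d(3) vf[OF xx] by blast
    then show ?thesis using c(4)[of x] x cu by simp
  next
    assume lt: "d < g c"
    define v where "v = min (g c) (d + 1 / 2 ^ (3 * N))"
    have v: "d < v" "v \<le> d + 1 / 2 ^ (3 * N)" "v \<le> g c" using lt eps unfolding v_def by auto
    have gcq: "g c \<le> q'" unfolding q'_def using conjugates_le_iff[OF g c01 pp(2)] c(2) \<kappa> by simp
    have "v \<in> {0..1}" using v d01 conjugates_in[OF g c01] by auto
    then obtain x where x: "x \<in> {0..1}" "g x = v" using conjugates_ex[OF g] by metis
    have "x \<le> c" using conjugates_le_iff[OF g x(1) c01] x(2) v by simp
    moreover have "p \<le> x" using conjugates_le_iff[OF g pp(1) x(1)] x(2) v d(1) \<kappa> unfolding q_def by simp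
    ultimately have "y1 (y2 v) = y2 (y1 v)" using c(3) vf[OF x(1)] x(2) by simp
    then show ?thesis using d(4)[of v] v gcq by simp
  qed
  define \<sigma> where "\<sigma> = \<kappa> / 2 ^ (N + 2)"
  have \<sigma>: "0 < \<sigma>" using \<kappa> by (simp add: \<sigma>_def)
  \<comment> \<open>now \<open>c + g c\<close> decreases by \<open>\<sigma>\<close> in each step, while the distances to \<open>p\<close> and \<open>g p\<close> shrink by the factor \<open>2 ^ N\<close> at most\<close>
  have claim: "\<exists>c. p < c \<and> c \<le> p' - \<kappa> \<and> g c \<le> q' - \<kappa> \<and> \<kappa> / 2 ^ (N * t) \<le> c - p \<and> \<kappa> / 2 ^ (N * t) \<le> g c - q \<and>
      (c \<le> p + \<kappa> \<and> g c \<le> q + \<kappa> \<or> c + g c \<le> 2 - real t * \<sigma>)" for t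
  proof (induction t)
    case 0 show ?case using c(1,2) d(1,2) gcd \<kappa> conjugates_in[OF g c01] c01 by (intro exI[of _ c]) auto
  next
    case (Suc t)
    then obtain c where c: "p < c" "c \<le> p' - \<kappa>" "g c \<le> q' - \<kappa>" "\<kappa> / 2 ^ (N * t) \<le> c - p" "\<kappa> / 2 ^ (N * t) \<le> g c - q"
      and alt: "c \<le> p + \<kappa> \<and> g c \<le> q + \<kappa> \<or> c + g c \<le> 2 - real t * \<sigma>" by blast
    have cc: "c \<in> {0..1}" using c \<kappa> pp by auto
    have pw: "\<kappa> / 2 ^ (N * Suc t) = \<kappa> / 2 ^ (N * t) / 2 ^ N" by (simp add: power_add mult.commute)
    show ?case
    proof (cases "c \<le> p + \<kappa> \<and> g c \<le> q + \<kappa>")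
      case True
      have "\<kappa> / 2 ^ (N * t) / 2 ^ N \<le> \<kappa> / 2 ^ (N * t) / 1" using \<kappa> by (intro divide_left_mono) auto
      then have "\<kappa> / 2 ^ (N * Suc t) \<le> \<kappa> / 2 ^ (N * t)" unfolding pw by simp
      then show ?thesis using c True by (intro exI[of _ c]) auto
    next
      case False
      have "\<exists>z y. (z, y) \<in> R \<and> z c < c \<and> z c + g (z c) \<le> c + g c - \<sigma>"
      proof (cases "c \<le> p + \<kappa>")
        case False
        then obtain z where z: "z \<in> Zs" "z c \<le> c - \<sigma>" using zf.steps(2)[OF m \<kappa> _ c(2)] by (auto simp: \<sigma>_def)
        then obtain y where zy: "(z, y) \<in> R" by auto
        have "g (z c) \<le> g c" using conjugates_le_iff[OF g _ cc, of "z c"] z(2) \<sigma> homeo_in R_homeo[OF zy] cc(1) by auto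
        then show ?thesis using zy z(2) \<sigma> by (intro exI[of _ z] exI[of _ y]) auto
      next
        case True
        then have "q + \<kappa> \<le> g c" using False by simp
        then obtain y where y: "y \<in> Ys" "y (g c) \<le> g c - \<sigma>" using yf.steps(2)[OF my \<kappa> _ c(3)] by (auto simp: \<sigma>_def)
        then obtain z where zy: "(z, y) \<in> R" by auto
        have "y (g c) = g (z c)" by (rule conjugatesD[OF g zy cc(1)])
        then have gz: "g (z c) \<le> g c - \<sigma>" using y(2) by simp
        then have "z c < c" using conjugates_less_iff[OF g _ cc, of "z c"] \<sigma> homeo_in R_homeo[OF zy] cc(1) by auto
        then show ?thesis using zy gz by (intro exI[of _ z] exI[of _ y]) auto
      qed
      then obtain z y where zy: "(z, y) \<in> R" "z c < c" "z c + g (z c) \<le> c + g c - \<sigma>" by blast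
      have Lz: "level N z {0..1}" "level N y {0..1}" using R_homeo[OF zy(1)] homeo_level by auto
      have zc: "z c \<in> {0..1}" using homeo_in R_homeo[OF zy(1)] cc by blast
      have "z \<in> Zs" "y \<in> Ys" using zy(1) by force+
      then have fp: "z p = p" "y q = q" using m my unfolding moving_def Fix_def by blast+
      have gc: "q \<le> g c" using conjugates_le_iff[OF g pp(1) cc] c(1) unfolding q_def by simp
      have "0 \<le> p" "p \<le> c" "c \<le> 1" "0 \<le> q" "g c \<le> 1" using pp cc c(1) conjugates_in[OF g cc] by auto
      note sl = level_slope(2)[OF Lz(1) this(1,2,3)] level_slope(2)[OF Lz(2) this(4) gc this(5)]
      have "(c - p) / 2 ^ N \<le> z c - z p" by (rule sl(1))
      moreover have "\<kappa> / 2 ^ (N * t) / 2 ^ N \<le> (c - p) / 2 ^ N" using c(4) by (rule divide_right_mono) simp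
      ultimately have 1: "\<kappa> / 2 ^ (N * Suc t) \<le> z c - p" unfolding pw fp by linarith
      have "(g c - q) / 2 ^ N \<le> y (g c) - y q" by (rule sl(2))
      moreover have "\<kappa> / 2 ^ (N * t) / 2 ^ N \<le> (g c - q) / 2 ^ N" using c(5) by (rule divide_right_mono) simp
      moreover have "y (g c) = g (z c)" by (rule conjugatesD[OF g zy(1) cc(1)])
      ultimately have 2: "\<kappa> / 2 ^ (N * Suc t) \<le> g (z c) - q" unfolding pw fp by linarith
      have "0 < \<kappa> / 2 ^ (N * Suc t)" using \<kappa> by simp
      then have "p < z c" using 1 by linarith
      moreover have "g (z c) \<le> g c" using conjugates_le_iff[OF g zc cc] zy(2) by simp
      moreover have "z c + g (z c) \<le> 2 - real (Suc t) * \<sigma>" using alt False zy(3) by (auto simp: algebra_simps)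
      ultimately show ?thesis using c zy(2) 1 2 by (intro exI[of _ "z c"]) auto
    qed
  qed
  define t0 where "t0 = (2::nat) ^ (5 * N + 4)"
  have e1: "5 * N + 2 = 4 * N + (N + 2)" and e2: "5 * N + 4 = (5 * N + 2) + 2" by simp_all
  have "\<sigma> = 1 / 2 ^ (5 * N + 2)"
    unfolding \<sigma>_def \<kappa>_def e1 power_add[of _ _ "N + 2"] by (simp only: divide_divide_eq_left)
  moreover have "real t0 = 2 ^ (5 * N + 2) * 4" unfolding t0_def e2 power_add[of _ _ 2] by simp
  ultimately have "real t0 * \<sigma> = 4" by simp
  obtain b where b: "p < b" "b \<le> p' - \<kappa>" "\<kappa> / 2 ^ (N * t0) \<le> b - p" "\<kappa> / 2 ^ (N * t0) \<le> g b - q"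
      and alt: "b \<le> p + \<kappa> \<and> g b \<le> q + \<kappa> \<or> b + g b \<le> 2 - real t0 * \<sigma>" using claim[of t0] by blast
  have bb: "b \<in> {0..1}" using b \<kappa> pp by auto
  have "0 \<le> b + g b" using bb conjugates_in[OF g bb] by auto
  then have near: "b \<le> p + \<kappa>" "g b \<le> q + \<kappa>" using alt \<open>real t0 * \<sigma> = 4\<close> by auto
  have "g b = g p + 2 powi k * (b - p)"
    by (rule linear_right'[OF g m k]) (use b near \<kappa> in \<open>auto simp: q_def\<close>)
  then have eq: "g b - q = 2 powi k * (b - p)" by (simp add: q_def)
  have pos: "0 < b - p" using b by simp
  have "2 powi k * (\<kappa> / 2 ^ (N * t0)) \<le> 2 powi k * (b - p)" using b by (intro mult_left_mono) auto
  also have "\<dots> \<le> \<kappa>" using near eq by simp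
  finally have "2 powi k \<le> (2::real) ^ (N * t0)" using \<kappa> by (simp add: field_simps)
  moreover have "1 / 2 ^ (N * t0) \<le> (2::real) powi k"
  proof -
    have "\<kappa> / 2 ^ (N * t0) \<le> 2 powi k * (b - p)" using b eq by simp
    also have "\<dots> \<le> 2 powi k * \<kappa>" using near by (intro mult_left_mono) auto
    finally show ?thesis using \<kappa> by (simp add: field_simps)
  qed
  ultimately have "\<bar>k\<bar> \<le> int (N * t0)" by (rule two_powi_boundsD)
  then show ?thesis by (simp add: slope_bound_def t0_def)
qed

end

section \<open>Chains of moving intervals\<close>

text \<open>
  A sequence of moving intervals that meet in common fixed points which are not dyadic. An element of
  Thompson's group has no breakpoints there, so its slope on one interval determines its slope on
  the next one.
\<close>

definition chain :: "(real \<Rightarrow> real) set \<Rightarrow> real \<Rightarrow> real \<Rightarrow> bool" where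
  "chain Z P P' \<longleftrightarrow> P \<in> Fix Z \<and> P' \<in> Fix Z \<and> P < P' \<and> (\<forall>x M. P < x \<and> x < P' \<and> x \<in> Fix Z \<longrightarrow> x \<notin> grid M)"

lemma chain_flip: assumes "chain Z P P'" shows "chain (flip ` Z) (1 - P') (1 - P)"
proof -
  have "x \<notin> grid M" if "1 - P' < x" "x < 1 - P" "x \<in> Fix (flip ` Z)" for x M
  proof
    assume "x \<in> grid M"
    then have "1 - x \<in> grid M" by (intro grid_diff) auto
    then show False using assms that unfolding chain_def Fix_flip by auto
  qed
  then show ?thesis using assms unfolding chain_def Fix_flip by auto
qed

lemma grid_between: assumes "x < y" obtains M r where "r \<in> grid M" "x < r" "r \<le> y"
proof -
  obtain M where M: "1 / (y - x) < 2 ^ M" using real_arch_pow[of 2] by force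
  then have "1 / 2 ^ M < y - x" using assms by (simp add: field_simps)
  moreover define r where "r = of_int (\<lfloor>x * 2 ^ M\<rfloor> + 1) / (2 ^ M :: real)"
  moreover have "x < r" unfolding r_def by (simp add: field_simps, linarith)
  moreover have "r \<le> x + 1 / 2 ^ M" unfolding r_def by (simp add: field_simps)
  moreover have "r \<in> grid M" unfolding r_def by (rule grid_frac)
  ultimately show ?thesis by (intro that[of r M]) simp_all
qed

context map_family begin

text \<open>
  A cell that contains two common fixed points is fixed between them, and dyadic points are dense;
  so each cell contains one common fixed point of the chain at most.
\<close>

lemma chain_finite:
  assumes ch: "chain Z P P'"
  shows "finite (Fix Z \<inter> {P<..<P'})" "card (Fix Z \<inter> {P<..<P'}) \<le> 2 ^ N"
proof -
  let ?A = "Fix Z \<inter> {P<..<P'}" and ?f = "\<lambda>x::real. \<lfloor>x * 2 ^ N\<rfloor>"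
  have PP: "P \<in> {0..1}" "P' \<in> {0..1}" using ch by (auto simp: chain_def Fix_def)
  have no: False if x: "x \<in> ?A" and y: "y \<in> ?A" and xy: "?f x = ?f y" "x < y" for x y
  proof -
    have x01: "x \<in> {0..1}" "y \<in> {0..1}" using x y by (auto simp: Fix_def)
    have "t \<in> Fix Z" if t: "x \<le> t" "t \<le> y" for t
    proof -
      have ic: "in_cell N (?f x) x" "in_cell N (?f x) y" using in_cell_floor[of N x] in_cell_floor[of N y] xy by auto
      have ict: "in_cell N (?f x) t" using in_cell_convex[OF ic t] .
      have t01: "t \<in> {0..1}" using t x01 by auto
      show ?thesis using two_fixed_cell[OF _ _ _ ic t01 ict] x y xy(2) by auto
    qed
    moreover obtain M r where "r \<in> grid M" "x < r" "r \<le> y" using grid_between[OF xy(2)] by metis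
    ultimately show False using ch x y unfolding chain_def by force
  qed
  have inj: "inj_on ?f ?A"
  proof (rule inj_onI)
    fix x y assume "x \<in> ?A" "y \<in> ?A" "?f x = ?f y"
    then show "x = y" using no[of x y] no[of y x] by (cases x y rule: linorder_cases) auto
  qed
  have sub: "?f ` ?A \<subseteq> {0..<2 ^ N}"
  proof
    fix i assume "i \<in> ?f ` ?A"
    then obtain x where x: "x \<in> ?A" "i = ?f x" by blast
    then have "0 < x" "x < 1" using PP by auto
    then have "0 \<le> x * 2 ^ N" "x * 2 ^ N < of_int (2 ^ N)" by simp_all
    then show "i \<in> {0..<2 ^ N}" unfolding x(2) by (simp add: floor_less_iff)
  qed
  show "finite ?A" by (rule inj_on_finite[OF inj sub]) simp
  have "card ?A \<le> card {0..<2 ^ N :: int}" by (rule card_inj_on_le[OF inj sub]) simp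
  then show "card ?A \<le> 2 ^ N" by (simp add: nat_power_eq)
qed

lemma chain_next:
  assumes ch: "chain Z P P'" and p: "p \<in> Fix Z" "P \<le> p" "p < P'"
  obtains p1 where "moving Z p p1" "p1 \<le> P'"
proof -
  let ?A = "insert P' (Fix Z \<inter> {P<..<P'} \<inter> {p<..})"
  have fin: "finite ?A" using chain_finite(1)[OF ch] by simp
  define p1 where "p1 = Min ?A"
  have in1: "p1 \<in> ?A" unfolding p1_def by (rule Min_in[OF fin]) simp
  have le: "p1 \<le> x" if "x \<in> ?A" for x unfolding p1_def by (rule Min_le[OF fin that])
  have "p1 \<in> Fix Z" "p < p1" "p1 \<le> P'" using in1 ch p by (auto simp: chain_def)
  moreover have "x \<notin> Fix Z" if "p < x" "x < p1" for x
  proof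
    assume "x \<in> Fix Z"
    then have "x \<in> ?A" using that p \<open>p1 \<le> P'\<close> by auto
    then show False using le that by fastforce
  qed
  ultimately show ?thesis using that p(1) unfolding moving_def by blast
qed

end

lemma level_left_germ:
  assumes f: "level M f {a..p}" and "a < p" and aff: "0 < \<epsilon>" "\<And>x. p - \<epsilon> \<le> x \<Longrightarrow> x \<le> p \<Longrightarrow> f x = 2 powi j * x + e"
    and ng: "p \<notin> grid M"
  shows "\<bar>j\<bar> \<le> int M"
proof -
  define i where "i = \<lfloor>p * 2 ^ M\<rfloor>"
  obtain j1 e1 where 1: "\<bar>j1\<bar> \<le> int M" "\<And>x. x \<in> {a..p} \<Longrightarrow> in_cell M i x \<Longrightarrow> f x = 2 powi j1 * x + e1" using levelE[OF f] by metis
  have ic: "in_cell M i p" unfolding i_def by (rule in_cell_floor)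
  have "p \<noteq> of_int i / 2 ^ M" using ng grid_frac by metis
  then have ip: "of_int i / 2 ^ M < p" using ic unfolding in_cell_iff by simp
  define x where "x = max (max a (p - \<epsilon>)) (of_int i / 2 ^ M)"
  have x: "x < p" "a \<le> x" "p - \<epsilon> \<le> x" "of_int i / 2 ^ M \<le> x" using ip assms(2) aff(1) by (auto simp: x_def)
  have "in_cell M i x" using x ic unfolding in_cell_iff by auto
  then have "2 powi j1 * x + e1 = 2 powi j * x + e" using 1(2)[of x] aff(2)[of x] x by auto
  moreover have "2 powi j1 * p + e1 = 2 powi j * p + e" using 1(2)[of p] aff(2)[of p] ic aff(1) assms(2) by auto
  ultimately have "j1 = j" using affine_unique(1)[of x p j1 e1 j e] x by simp
  then show ?thesis using 1 by simp
qed

lemma affine_right_slope: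
  assumes "0 < \<epsilon>" "\<And>x. p - \<epsilon> \<le> x \<Longrightarrow> x \<le> p + \<epsilon> \<Longrightarrow> f x = 2 powi j * x + e"
  shows "right_slope f p j" "right_slope (flip f) (1 - p) j"
proof -
  have fp: "f p = 2 powi j * p + e" using assms by simp
  show "right_slope f p j" unfolding right_slope_def fp
    by (intro exI[of _ \<epsilon>] conjI allI impI) (use assms in \<open>auto simp: right_diff_distrib\<close>)
  show "right_slope (flip f) (1 - p) j" unfolding right_slope_def
  proof (intro exI[of _ \<epsilon>] conjI allI impI)
    fix x assume x: "1 - p \<le> x \<and> x \<le> 1 - p + \<epsilon>"
    then have "f (1 - x) = 2 powi j * (1 - x) + e" using assms by auto
    then show "flip f x = flip f (1 - p) + 2 powi j * (x - (1 - p))" using fp by (simp add: flip_def algebra_simps)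
  qed (rule assms(1))
qed

context conjugacy begin

lemma chain_smooth:
  assumes g: "conjugates R g" and ch: "chain Zs P P'" and p: "p \<in> Fix Zs" "P < p" "p < P'"
  obtains \<epsilon> j e where "0 < \<epsilon>" "\<And>x. p - \<epsilon> \<le> x \<Longrightarrow> x \<le> p + \<epsilon> \<Longrightarrow> g x = 2 powi j * x + e"
    "right_slope g p j" "right_slope (flip g) (1 - p) j"
proof -
  obtain M where M: "homeo M g" using g unfolding conjugates_def by blast
  have "p \<in> {0..1}" "p \<notin> grid M" using ch p by (auto simp: chain_def Fix_def)
  then obtain \<epsilon> j e where "0 < \<epsilon>" "\<And>x. p - \<epsilon> \<le> x \<Longrightarrow> x \<le> p + \<epsilon> \<Longrightarrow> g x = 2 powi j * x + e"
    using smooth_nondyadic[OF M] by metis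
  then show ?thesis using that affine_right_slope by metis
qed

text \<open>
  The slope at \<open>p\<close> bounds the level up to the next common fixed point, hence the slope
  there, and so on; each moving interval costs one application of \<open>spread\<close>.
\<close>

lemma chain_forward:
  assumes g: "conjugates R g" and ch: "chain Zs P P'"
  shows "\<lbrakk>p \<in> Fix Zs; P \<le> p; p < P'; right_slope g p k; \<bar>k\<bar> \<le> int s; card (Fix Zs \<inter> {p<..<P'}) \<le> n\<rbrakk>
    \<Longrightarrow> level ((spread N ^^ Suc n) s) g {p..P'}"
proof (induction n arbitrary: p k s)
  have first: "\<exists>p1. moving Zs p p1 \<and> p1 \<le> P' \<and> level (spread N s) g {p..p1}"
    if "p \<in> Fix Zs" "P \<le> p" "p < P'" "right_slope g p k" "\<bar>k\<bar> \<le> int s" for p k s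
    using zf.chain_next[OF ch that(1,2,3)] moving_bound[OF g _ that(4,5)] by metis
  have fin: "finite (Fix Zs \<inter> {p<..<P'})" if "P \<le> p" for p
    by (rule finite_subset[OF _ zf.chain_finite(1)[OF ch]]) (use that in auto)
  {
    case 0
    obtain p1 where p1: "moving Zs p p1" "p1 \<le> P'" "level (spread N s) g {p..p1}" using first[OF 0(1-5)] by blast
    have "Fix Zs \<inter> {p<..<P'} = {}" using 0(6) fin[OF 0(2)] by simp
    then have "p1 = P'" using p1 by (auto simp: moving_def)
    then show ?case using p1(3) by simp
  next
    case (Suc n)
    obtain p1 where p1: "moving Zs p p1" "p1 \<le> P'" "level (spread N s) g {p..p1}" using first[OF Suc.prems(1-5)] by blast
    have it: "spread N s \<le> (spread N ^^ Suc (Suc n)) s" using spread_iter(2)[of "Suc 0" "Suc (Suc n)" N s] by simp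
    show ?case
    proof (cases "p1 = P'")
      case True then show ?thesis using level_mono[OF p1(3) it] by simp
    next
      case False
      have p1': "p1 \<in> Fix Zs" "P < p1" "p1 < P'" "p < p1" using p1 False Suc.prems by (auto simp: moving_def)
      obtain \<epsilon> j e where sm: "0 < \<epsilon>" "\<And>x. p1 - \<epsilon> \<le> x \<Longrightarrow> x \<le> p1 + \<epsilon> \<Longrightarrow> g x = 2 powi j * x + e" "right_slope g p1 j"
        using chain_smooth[OF g ch p1'(1,2,3)] by metis
      have "p1 \<notin> grid (spread N s)" using ch p1' by (auto simp: chain_def)
      then have j: "\<bar>j\<bar> \<le> int (spread N s)" using level_left_germ[OF p1(3) p1'(4) sm(1) sm(2)] sm(1) by auto
      have "Fix Zs \<inter> {p1<..<P'} \<subset> Fix Zs \<inter> {p<..<P'}" using p1' by auto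
      then have "card (Fix Zs \<inter> {p1<..<P'}) < card (Fix Zs \<inter> {p<..<P'})" by (rule psubset_card_mono[OF fin[OF Suc.prems(2)]])
      then have "level ((spread N ^^ Suc n) (spread N s)) g {p1..P'}"
        using Suc.IH[OF p1'(1) _ p1'(3) sm(3) j] p1'(2) Suc.prems(6) by simp
      then have "level ((spread N ^^ Suc (Suc n)) s) g {p1..P'}" by (simp add: funpow_swap1)
      then show ?thesis using level_glue_smooth[OF level_mono[OF p1(3) it] _ p1'(4,3) sm(1,2)] by simp
    qed
  }
qed

definition chain_bound :: "nat \<Rightarrow> nat" where "chain_bound s = (spread N ^^ Suc (2 ^ N)) s"

lemma chain_right:
  assumes g: "conjugates R g" and ch: "chain Zs P P'" and p: "p \<in> Fix Zs" "P \<le> p" "p < P'" "right_slope g p k" "\<bar>k\<bar> \<le> int s"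
  shows "level (chain_bound s) g {p..P'}"
proof -
  have "card (Fix Zs \<inter> {p<..<P'}) \<le> card (Fix Zs \<inter> {P<..<P'})"
    by (rule card_mono[OF zf.chain_finite(1)[OF ch]]) (use p in auto)
  then show ?thesis unfolding chain_bound_def using chain_forward[OF g ch p] zf.chain_finite(2)[OF ch] by simp
qed


text \<open>
  To the left of \<open>p\<close>, \<open>chain_right\<close> is applied to the reflected problem.
\<close>

lemma chain_spread:
  assumes g: "conjugates R g" and ch: "chain Zs P P'" and p: "p \<in> Fix Zs" "P \<le> p" "p < P'" "right_slope g p k" "\<bar>k\<bar> \<le> int s"
  shows "level (chain_bound s) g {P..P'}"
proof (cases "P = p")
  case True then show ?thesis using chain_right[OF assms] by simp
next
  case False
  then have Pp: "P < p" using p by simp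
  obtain \<epsilon> j e where sm: "0 < \<epsilon>" "\<And>x. p - \<epsilon> \<le> x \<Longrightarrow> x \<le> p + \<epsilon> \<Longrightarrow> g x = 2 powi j * x + e"
      "right_slope g p j" "right_slope (flip g) (1 - p) j"
    using chain_smooth[OF g ch p(1) Pp p(3)] by metis
  have jk: "j = k" using right_slope_unique[OF sm(3) p(4)] .
  interpret r: conjugacy N Rflip by (rule conjugacy_flip)
  have "level (r.chain_bound s) (flip g) {1 - p..1 - P}"
  proof (rule r.chain_right[OF conjugates_flip[OF g]])
    show "chain (fst ` Rflip) (1 - P') (1 - P)" unfolding fst_Rflip by (rule chain_flip[OF ch])
    show "1 - p \<in> Fix (fst ` Rflip)" unfolding fst_Rflip Fix_flip using p by simp
    show "right_slope (flip g) (1 - p) k" using sm jk by simp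
  qed (use p Pp in auto)
  then have "level (chain_bound s) (flip g) {1 - p..1 - P}" unfolding r.chain_bound_def chain_bound_def .
  then have "level (chain_bound s) (flip (flip g)) {1 - (1 - P)..1 - (1 - p)}" by (rule level_flip)
  then have "level (chain_bound s) g {P..p}" by simp
  then show ?thesis using level_glue_smooth[OF _ chain_right[OF assms] Pp p(3) sm(1,2)] by simp
qed

lemma fixed_interval_invariant:
  assumes "(z, y) \<in> R" "P \<in> Fix Zs" "P' \<in> Fix Zs" "x \<in> {0..1}"
  shows "z x \<in> {P..P'} \<longleftrightarrow> x \<in> {P..P'}"
proof -
  have z: "z \<in> Zs" using assms(1) by force
  have L: "level N z {0..1}" using R_homeo[OF assms(1)] homeo_level by blast
  have P: "z P = P" "z P' = P'" "P \<in> {0..1}" "P' \<in> {0..1}" using assms(2,3) z by (auto simp: Fix_def)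
  show ?thesis using level_le_iff[OF L P(3) assms(4)] level_le_iff[OF L assms(4) P(4)] P by simp
qed

text \<open>
  On \<open>[P, P']\<close> the map \<open>z\<close> commutes with the whole family, so composing \<open>g\<close> with it there yields another
  conjugator; breakpoints at the grid points \<open>P\<close> and \<open>P'\<close> are harmless.
\<close>

lemma commuting_adjust_step:
  assumes g: "conjugates R g" and ch: "chain Zs P P'" and gr: "P \<in> grid N" "P' \<in> grid N"
    and comm: "\<And>z1 y1 z2 y2 x. (z1, y1) \<in> R \<Longrightarrow> (z2, y2) \<in> R \<Longrightarrow> x \<in> {P..P'} \<Longrightarrow> z1 (z2 x) = z2 (z1 x)"
    and zy: "(z, y) \<in> R" and h_def: "h = (\<lambda>x. if x \<in> {P..P'} then g (z x) else g x)"
  shows "conjugates R h" "h P = g P" "h P' = g P'"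
proof -
  have PP: "P \<in> Fix Zs" "P' \<in> Fix Zs" "P < P'" "P \<in> {0..1}" "P' \<in> {0..1}" using ch by (auto simp: chain_def Fix_def)
  have zz: "z \<in> Zs" using zy by force
  then have zP: "z P = P" "z P' = P'" using PP(1,2) unfolding Fix_def by blast+
  then show hP: "h P = g P" "h P' = g P'" using PP(3) by (simp_all add: h_def)
  obtain M where M: "homeo M g" using g unfolding conjugates_def by blast
  define K where "K = M + 2 * N"
  have KN: "N \<le> K" "M \<le> K" unfolding K_def by auto
  have Lg: "level K g {0..1}" using level_mono[OF homeo_level[OF M]] KN by blast
  have Lgz: "level K (\<lambda>x. g (z x)) {0..1}" unfolding K_def using homeo_level[OF homeo_comp[OF _ M]] R_homeo[OF zy] by blast
  have gK: "P \<in> grid K" "P' \<in> grid K" using grid_mono gr KN by blast+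
  have "level K h {0..P}"
    by (rule level_cong[OF level_subset[OF Lg]]) (use PP zP in \<open>auto simp: h_def\<close>)
  moreover have "level K h {P..P'}"
    by (rule level_cong[OF level_subset[OF Lgz]]) (use PP in \<open>auto simp: h_def\<close>)
  moreover have "level K h {P'..1}"
    by (rule level_cong[OF level_subset[OF Lg]]) (use PP zP in \<open>auto simp: h_def\<close>)
  ultimately have "level K h {0..1}" using level_glue gK by metis
  moreover have "h 0 = 0"
  proof (cases "P = 0")
    case True then show ?thesis using hP homeo_0[OF M] by simp
  next
    case False then show ?thesis using PP homeo_0[OF M] by (auto simp: h_def)
  qed
  moreover have "h 1 = 1"
  proof (cases "P' = 1")
    case True then show ?thesis using hP homeo_1[OF M] by simp
  next
    case False then show ?thesis using PP homeo_1[OF M] by (auto simp: h_def)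
  qed
  ultimately have "homeo K h" by (simp add: homeo_def)
  moreover have "y2 (h x) = h (z2 x)" if zy2: "(z2, y2) \<in> R" and x: "x \<in> {0..1}" for z2 y2 x
  proof -
    have z2x: "z2 x \<in> {0..1}" and zx: "z x \<in> {0..1}" using homeo_in R_homeo zy zy2 x by blast+
    note inv = fixed_interval_invariant[OF zy2 PP(1,2) x]
    show ?thesis
    proof (cases "x \<in> {P..P'}")
      case True
      then have "y2 (h x) = y2 (g (z x))" by (simp only: h_def if_True)
      also have "\<dots> = g (z2 (z x))" by (rule conjugatesD[OF g zy2 zx])
      also have "z2 (z x) = z (z2 x)" using comm[OF zy2 zy True] .
      also have "g (z (z2 x)) = h (z2 x)" using inv True by (simp only: h_def if_True)
      finally show ?thesis .
    next
      case False
      then show ?thesis using inv conjugatesD[OF g zy2 x] by (simp only: h_def if_False)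
    qed
  qed
  ultimately show "conjugates R h" unfolding conjugates_def by blast
qed

text \<open>
  A map that contracts or expands at \<open>P\<close> changes the exponent \<open>k\<close> of the slope of \<open>g\<close> at \<open>P\<close> by its own
  exponent, which is at most \<open>N\<close> in absolute value. Repeated adjustment in the right direction
  brings \<open>k\<close> into the range \<open>\<bar>k\<bar> \<le> N\<close>.
\<close>

lemma commuting_adjust:
  assumes ch: "chain Zs P P'" and gr: "P \<in> grid N" "P' \<in> grid N"
    and comm: "\<And>z1 y1 z2 y2 x. (z1, y1) \<in> R \<Longrightarrow> (z2, y2) \<in> R \<Longrightarrow> x \<in> {P..P'} \<Longrightarrow> z1 (z2 x) = z2 (z1 x)"
  shows "conjugates R g \<Longrightarrow> \<exists>h k. conjugates R h \<and> h P = g P \<and> h P' = g P' \<and> right_slope h P k \<and> \<bar>k\<bar> \<le> int N"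
proof -
  have PP: "P \<in> Fix Zs" "P' \<in> Fix Zs" "P < P'" "P \<in> {0..1}" "P' \<in> {0..1}" using ch by (auto simp: chain_def Fix_def)
  obtain p1 where p1: "moving Zs P p1" "p1 \<le> P'" using zf.chain_next[OF ch PP(1) _ PP(3)] by auto
  obtain z j z' where z: "z \<in> Zs" "z' \<in> Zs" "j > 0" "j \<le> int N"
    and germ: "\<And>x. P \<le> x \<Longrightarrow> x \<le> P + sep N \<Longrightarrow> z x = P + 2 powi (- j) * (x - P)"
    "\<And>x. P \<le> x \<Longrightarrow> x \<le> P + sep N \<Longrightarrow> z' x = P + 2 powi j * (x - P)" using zf.right_germs[OF p1(1)] by metis
  have seps: "P + sep N \<le> P'" using zf.moving_length[OF p1(1)] p1(2) by simp
  have shift: "\<exists>h. conjugates R h \<and> h P = g P \<and> h P' = g P' \<and> right_slope h P (k + i)"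
    if g: "conjugates R g" and k: "right_slope g P k" and w: "w \<in> Zs" and wg: "\<And>x. P \<le> x \<Longrightarrow> x \<le> P + sep N \<Longrightarrow> w x = P + 2 powi i * (x - P)"
    for g k w i
  proof -
    obtain y where wy: "(w, y) \<in> R" using w by auto
    define h where "h = (\<lambda>x. if x \<in> {P..P'} then g (w x) else g x)"
    note step = commuting_adjust_step[where g = g and h = h and z = w and y = y and P = P and P' = P', OF g ch gr _ wy h_def]
    have st: "conjugates R h" "h P = g P" "h P' = g P'" by (rule step; use comm in blast)+
    obtain \<epsilon> where \<epsilon>: "0 < \<epsilon>" "\<And>x. P \<le> x \<Longrightarrow> x \<le> P + \<epsilon> \<Longrightarrow> g x = g P + 2 powi k * (x - P)" using k unfolding right_slope_def by blast
    define e where "e = min (sep N) (2 powi (- i) * \<epsilon>)"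
    have e0: "0 < e" using \<epsilon>(1) by (simp add: e_def)
    have "h x = h P + 2 powi (k + i) * (x - P)" if x: "P \<le> x" "x \<le> P + e" for x
    proof -
      have "2 powi i * (x - P) \<le> 2 powi i * (2 powi (- i) * \<epsilon>)" using x by (intro mult_left_mono) (auto simp: e_def)
      also have "\<dots> = \<epsilon>" by (simp only: mult.assoc[symmetric] two_powi_minus mult_1)
      finally have le: "2 powi i * (x - P) \<le> \<epsilon>" .
      have wx: "w x = P + 2 powi i * (x - P)" using wg x by (auto simp: e_def)
      have "x \<in> {P..P'}" using x seps by (auto simp: e_def)
      then have "h x = g (w x)" by (simp only: h_def if_True)
      also have "\<dots> = g P + 2 powi k * (2 powi i * (x - P))" unfolding wx using \<epsilon>(2)[of "P + 2 powi i * (x - P)"] le x by simp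
      finally show ?thesis using st(2) by (simp add: two_powi_add)
    qed
    then have "right_slope h P (k + i)" unfolding right_slope_def using e0 by blast
    then show ?thesis using st by blast
  qed
  have main: "\<exists>h k. conjugates R h \<and> h P = g P \<and> h P' = g P' \<and> right_slope h P k \<and> \<bar>k\<bar> \<le> int N"
    if "conjugates R g" "right_slope g P k" "nat \<bar>k\<bar> \<le> n" for n k g
    using that
  proof (induction n arbitrary: g k rule: less_induct)
    case (less n)
    show ?case
    proof (cases "\<bar>k\<bar> \<le> int N")
      case True then show ?thesis using less.prems by blast
    next
      case False
      have "\<exists>h i. conjugates R h \<and> h P = g P \<and> h P' = g P' \<and> right_slope h P i \<and> \<bar>i\<bar> < \<bar>k\<bar>"
      proof (cases "0 < k")
        case True
        have "\<bar>k + (- j)\<bar> < \<bar>k\<bar>" using False True z by auto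
        then show ?thesis using shift[OF less.prems(1,2) z(1) germ(1)] by blast
      next
        case neg: False
        have "\<bar>k + j\<bar> < \<bar>k\<bar>" using False neg z by auto
        then show ?thesis using shift[OF less.prems(1,2) z(2) germ(2)] by blast
      qed
      then obtain h i where h: "conjugates R h" "h P = g P" "h P' = g P'" "right_slope h P i" "\<bar>i\<bar> < \<bar>k\<bar>" by blast
      then have "nat \<bar>i\<bar> < n" using less.prems(3) by auto
      then show ?thesis using less.IH[OF _ h(1,4) order.refl] h by metis
    qed
  qed
  assume g: "conjugates R g"
  then obtain k where "right_slope g P k" using conjugates_right_slope[OF g PP(4)] PP by auto
  then show ?thesis using main[OF g _ order.refl] by blast
qed

lemma chain_conjugator:
  assumes g: "conjugates R g" and ch: "chain Zs P P'" and gr: "P \<in> grid N" "P' \<in> grid N"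
  shows "\<exists>h. conjugates R h \<and> h P = g P \<and> h P' = g P' \<and> level (chain_bound (N + slope_bound N)) h {P..P'}"
proof (cases "\<forall>z1 y1 z2 y2 x. (z1, y1) \<in> R \<and> (z2, y2) \<in> R \<and> x \<in> {P..P'} \<longrightarrow> z1 (z2 x) = z2 (z1 x)")
  case True
  obtain h k where h: "conjugates R h" "h P = g P" "h P' = g P'" "right_slope h P k" "\<bar>k\<bar> \<le> int N"
    using commuting_adjust[OF ch gr _ g] True by blast
  have "\<bar>k\<bar> \<le> int (N + slope_bound N)" using h(5) by simp
  then have "level (chain_bound (N + slope_bound N)) h {P..P'}"
    using chain_spread[OF h(1) ch _ order.refl _ h(4)] ch by (auto simp: chain_def)
  then show ?thesis using h by blast
next
  case False
  then obtain z1 y1 z2 y2 x where zy: "(z1, y1) \<in> R" "(z2, y2) \<in> R" and x: "x \<in> {P..P'}" "z1 (z2 x) \<noteq> z2 (z1 x)" by blast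
  have "z1 \<in> Zs" "z2 \<in> Zs" using zy by force+
  then have "z1 x = x \<and> z2 x = x" if "x \<in> Fix Zs" using that unfolding Fix_def by blast
  then have nF: "x \<notin> Fix Zs" using x(2) by auto
  have PP: "P \<in> Fix Zs" "P' \<in> Fix Zs" using ch by (auto simp: chain_def)
  have Px: "P < x" "x < P'" using x(1) nF PP by (metis atLeastAtMost_iff order_le_less)+
  let ?A = "insert P (Fix Zs \<inter> {P<..<P'} \<inter> {..<x})"
  have fin: "finite ?A" using zf.chain_finite(1)[OF ch] by simp
  define p where "p = Max ?A"
  have pA: "p \<in> ?A" unfolding p_def by (rule Max_in[OF fin]) simp
  have p: "p \<in> Fix Zs" "P \<le> p" "p < x" "p < P'" using pA Px PP by auto
  obtain p' where p': "moving Zs p p'" "p' \<le> P'" using zf.chain_next[OF ch p(1,2,4)] by metis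
  have "x < p'"
  proof (rule ccontr)
    assume "\<not> x < p'"
    then have "p' < x" using p'(1) nF by (cases "p' = x") (auto simp: moving_def)
    then have "p' \<in> ?A" using p' p Px by (auto simp: moving_def)
    then have "p' \<le> p" unfolding p_def by (rule Max_ge[OF fin])
    then show False using p'(1) by (simp add: moving_def)
  qed
  moreover have "p \<in> {0..1}" "p < 1" using p PP by (auto simp: Fix_def)
  ultimately obtain k where k: "right_slope g p k" "\<bar>k\<bar> \<le> int (slope_bound N)"
    using conjugates_right_slope[OF g] noncommuting_slope[OF g p'(1) _ zy p(3) _ x(2)] by metis
  have "\<bar>k\<bar> \<le> int (N + slope_bound N)" using k(2) by simp
  then have "level (chain_bound (N + slope_bound N)) g {P..P'}" by (rule chain_spread[OF g ch p(1,2,4) k(1)])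
  then show ?thesis using g by blast
qed

end

section \<open>Gluing at the corners\<close>

lemma level_glue_if:
  assumes "level M h1 {a..b}" "level M h2 {b..c}" "b \<in> grid M" "h1 b = h2 b"
  shows "level M (\<lambda>x. if x \<le> b then h1 x else h2 x) {a..c}"
proof (rule level_glue[OF _ _ assms(3)])
  show "level M (\<lambda>x. if x \<le> b then h1 x else h2 x) {a..b}" by (rule level_cong[OF assms(1)]) simp
  show "level M (\<lambda>x. if x \<le> b then h1 x else h2 x) {b..c}"
    by (rule level_cong[OF assms(2)]) (use assms(4) in auto)
qed

lemma affine_map_level:
  assumes "P \<in> grid A" "Q \<in> grid B" "A + B \<le> M"
  shows "level M (\<lambda>x. Q + 2 powi (int A - int B) * (x - P)) S"
proof (rule level_affine[where j = "int A - int B" and c = "Q - 2 powi (int A - int B) * P"])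
  have "2 powi (int A - int B) * P * 2 ^ B = P * 2 ^ A" by (simp add: power_int_diff)
  then have "2 powi (int A - int B) * P \<in> grid B" using gridD[OF assms(1)] by (intro gridI) (simp only:)
  then show "Q - 2 powi (int A - int B) * P \<in> grid M" using assms grid_mono[of _ B M] by (intro grid_diff) auto
qed (use assms(3) in \<open>auto simp: right_diff_distrib\<close>)

text \<open>
  Two dyadic intervals of \<open>u\<close> and \<open>v\<close> cells are mapped onto each other by matching their last cells
  one to one. When only one cell is left on one side, it is halved, which raises
  the depth on this side by one for each cell of the other side.
\<close>

lemma interval_map:
  assumes "1 \<le> u" "1 \<le> v" "P \<in> grid A" "Q \<in> grid B" "A + B + u + v \<le> M"
  shows "\<exists>h. h P = Q \<and> h (P + real u / 2 ^ A) = Q + real v / 2 ^ B \<and> level M h {P..P + real u / 2 ^ A}"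
  using assms
proof (induction "u + v" arbitrary: u v A B P Q rule: less_induct)
  case less
  have extend: "\<exists>h. h P = Q \<and> h (P + real u / 2 ^ A) = Q + real v / 2 ^ B \<and> level M h {P..P + real u / 2 ^ A}"
    if IH: "h1 P = Q" "h1 P2 = Q2" "level M h1 {P..P2}" and g: "P2 \<in> grid A'" "Q2 \<in> grid B'" "A' + B' \<le> M"
      and e: "P + real u / 2 ^ A = P2 + 1 / 2 ^ A'" "Q + real v / 2 ^ B = Q2 + 1 / 2 ^ B'" and le: "P \<le> P2"
    for h1 P2 Q2 A' B'
  proof -
    let ?h2 = "\<lambda>x. Q2 + 2 powi (int A' - int B') * (x - P2)"
    define b where "b = P2 + 1 / 2 ^ A'"
    have b: "P2 < b" unfolding b_def by simp
    have h2b: "?h2 b = Q + real v / 2 ^ B" unfolding b_def e(2) by (simp add: power_int_diff)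
    have b': "P + real u / 2 ^ A = b" unfolding b_def e(1) ..
    have "level M (\<lambda>x. if x \<le> P2 then h1 x else ?h2 x) {P..b}"
      by (rule level_glue_if[OF IH(3) affine_map_level[OF g]]) (use IH(2) g grid_mono[of P2 A' M] in auto)
    then show ?thesis unfolding b'
      by (intro exI[of _ "\<lambda>x. if x \<le> P2 then h1 x else ?h2 x"]) (use IH(1) le b h2b in simp)
  qed
  have gP: "P + real n / 2 ^ A \<in> grid A" for n using less.prems(3) grid_frac[of "int n" A] by (intro grid_add) auto
  have gQ: "Q + real n / 2 ^ B \<in> grid B" for n using less.prems(4) grid_frac[of "int n" B] by (intro grid_add) auto
  have minus1: "a + real n / 2 ^ C = a + real (n - 1) / 2 ^ C + 1 / 2 ^ C" if "2 \<le> n" for a :: real and n C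
    using that by (simp add: of_nat_diff diff_divide_distrib)
  have half: "a + real 1 / 2 ^ C = a + real 1 / 2 ^ Suc C + 1 / 2 ^ Suc C" for a :: real and C by simp
  consider "u = 1" "v = 1" | "u = 1" "2 \<le> v" | "2 \<le> u" "v = 1" | "2 \<le> u" "2 \<le> v" using less.prems by linarith
  then show ?case
  proof cases
    case 1
    show ?thesis using affine_map_level[OF less.prems(3,4), of M] less.prems(5) 1
      by (intro exI[of _ "\<lambda>x. Q + 2 powi (int A - int B) * (x - P)"]) (auto simp: power_int_diff)
  next
    case 2
    have g: "P \<in> grid (Suc A)" using less.prems(3) by (rule grid_mono) simp
    have "\<exists>h1. h1 P = Q \<and> h1 (P + real 1 / 2 ^ Suc A) = Q + real (v - 1) / 2 ^ B \<and> level M h1 {P..P + real 1 / 2 ^ Suc A}"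
      by (rule less.hyps[of 1 "v - 1" P "Suc A" Q B]) (use 2 less.prems g in simp_all)
    then obtain h1 where "h1 P = Q" "h1 (P + real 1 / 2 ^ Suc A) = Q + real (v - 1) / 2 ^ B" "level M h1 {P..P + real 1 / 2 ^ Suc A}"
      by blast
    moreover have "P + real 1 / 2 ^ Suc A \<in> grid (Suc A)" using g grid_frac[of 1 "Suc A"] by (intro grid_add) auto
    moreover have "Suc A + B \<le> M" "P \<le> P + real 1 / 2 ^ Suc A" using less.prems by simp_all
    moreover have "P + real u / 2 ^ A = P + real 1 / 2 ^ Suc A + 1 / 2 ^ Suc A" unfolding 2(1) by (rule half)
    ultimately show ?thesis using gQ minus1[OF 2(2)] by (intro extend[where A' = "Suc A" and B' = B])
  next
    case 3
    have g: "Q \<in> grid (Suc B)" using less.prems(4) by (rule grid_mono) simp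
    have "\<exists>h1. h1 P = Q \<and> h1 (P + real (u - 1) / 2 ^ A) = Q + real 1 / 2 ^ Suc B \<and> level M h1 {P..P + real (u - 1) / 2 ^ A}"
      by (rule less.hyps[of "u - 1" 1 P A Q "Suc B"]) (use 3 less.prems g in simp_all)
    then obtain h1 where "h1 P = Q" "h1 (P + real (u - 1) / 2 ^ A) = Q + real 1 / 2 ^ Suc B" "level M h1 {P..P + real (u - 1) / 2 ^ A}"
      by blast
    moreover have "Q + real 1 / 2 ^ Suc B \<in> grid (Suc B)" using g grid_frac[of 1 "Suc B"] by (intro grid_add) auto
    moreover have "A + Suc B \<le> M" "P \<le> P + real (u - 1) / 2 ^ A" using less.prems by simp_all
    moreover have "Q + real v / 2 ^ B = Q + real 1 / 2 ^ Suc B + 1 / 2 ^ Suc B" unfolding 3(2) by (rule half)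
    ultimately show ?thesis using gP minus1[OF 3(1)] by (intro extend[where A' = A and B' = "Suc B"])
  next
    case 4
    have "\<exists>h1. h1 P = Q \<and> h1 (P + real (u - 1) / 2 ^ A) = Q + real (v - 1) / 2 ^ B \<and> level M h1 {P..P + real (u - 1) / 2 ^ A}"
      by (rule less.hyps[of "u - 1" "v - 1" P A Q B]) (use 4 less.prems in simp_all)
    then obtain h1 where "h1 P = Q" "h1 (P + real (u - 1) / 2 ^ A) = Q + real (v - 1) / 2 ^ B" "level M h1 {P..P + real (u - 1) / 2 ^ A}"
      by blast
    moreover have "A + B \<le> M" "P \<le> P + real (u - 1) / 2 ^ A" using less.prems by simp_all
    ultimately show ?thesis using gP gQ minus1[OF 4(1)] minus1[OF 4(2)] by (intro extend[where A' = A and B' = B])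
  qed
qed

definition interior_fixed :: "(real \<Rightarrow> real) set \<Rightarrow> real \<Rightarrow> bool" where
  "interior_fixed Z x \<longleftrightarrow> (\<exists>a b. a \<in> {0..1} \<and> b \<in> {0..1} \<and> a < x \<and> x < b \<and> {a..b} \<subseteq> Fix Z)"

text \<open>
  The dyadic common fixed points, except those that have fixed intervals on both sides. A map in
  Thompson's group may have a breakpoint there, so conjugators on both sides can be combined freely.
  The definition refers only to notions that a conjugator preserves, hence it maps corners to
  corners; this would fail for the grid points among the fixed points.
\<close>

definition corners :: "(real \<Rightarrow> real) set \<Rightarrow> real set" where
  "corners Z = {x \<in> Fix Z. (\<exists>M. x \<in> grid M) \<and> (x = 0 \<or> x = 1 \<or> \<not> interior_fixed Z x)}"

context map_family begin

lemma corners_01: "0 \<in> corners Z" "1 \<in> corners Z"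
proof -
  have "z 0 = 0" "z 1 = 1" if "z \<in> Z" for z using Z_homeo[OF that] homeo_0 homeo_1 by blast+
  then show "0 \<in> corners Z" "1 \<in> corners Z" unfolding corners_def Fix_def using grid_01 by auto
qed

lemma corners_grid: assumes "x \<in> corners Z" shows "x \<in> grid N"
proof (rule ccontr)
  assume ng: "x \<notin> grid N"
  have x: "x \<in> Fix Z" "x \<in> {0..1}" using assms by (auto simp: corners_def Fix_def)
  have "x \<notin> fix_rats N" using assms fix_rats_grid ng by (auto simp: corners_def)
  note fc = fixed_cell[OF x(1) this]
  define i where "i = \<lfloor>x * 2 ^ N\<rfloor>"
  have ic: "in_cell N i x" unfolding i_def by (rule in_cell_floor)
  have "x \<noteq> of_int i / 2 ^ N" "x \<noteq> of_int (i + 1) / 2 ^ N" "x \<noteq> 0" "x \<noteq> 1" using ng grid_frac grid_01 by metis+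
  then have s: "of_int i / 2 ^ N < x" "x < (of_int i + 1) / 2 ^ N" "0 < x" "x < 1" using ic x unfolding in_cell_iff by auto
  have ends: "of_int i / 2 ^ N \<in> {0..1::real}" "(of_int i + 1) / 2 ^ N \<in> {0..1::real}"
    using unit_cell(3,4)[of x N] s(3,4) by (simp_all add: i_def)
  have "{of_int i / 2 ^ N..(of_int i + 1) / 2 ^ N} \<subseteq> Fix Z"
  proof
    fix t assume "t \<in> {of_int i / 2 ^ N..(of_int i + 1) / (2 ^ N :: real)}"
    then have "in_cell N i t" "t \<in> {0..1}" using ends unfolding in_cell_iff atLeastAtMost_iff by linarith+
    then show "t \<in> Fix Z" using fc[folded i_def] by blast
  qed
  then have "interior_fixed Z x" unfolding interior_fixed_def using ends s by blast
  then show False using assms s by (auto simp: corners_def)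
qed

lemma finite_corners: "finite (corners Z)"
proof -
  have "corners Z \<subseteq> (\<lambda>i. of_int i / 2 ^ N) ` {0..2 ^ N}"
  proof
    fix x assume x: "x \<in> corners Z"
    then obtain i where i: "x = of_int i / 2 ^ N" using corners_grid grid_E by metis
    have "0 \<le> x" "x \<le> 1" using x by (auto simp: corners_def Fix_def)
    then have "0 \<le> (of_int i :: real)" "of_int i \<le> (of_int (2 ^ N) :: real)" unfolding i by (auto simp: field_simps)
    then have "0 \<le> i" "i \<le> 2 ^ N" by (simp_all only: of_int_le_iff of_int_0_le_iff)
    then show "x \<in> (\<lambda>i. of_int i / 2 ^ N) ` {0..2 ^ N}" using i by auto
  qed
  then show ?thesis by (rule finite_subset) simp
qed

text \<open>
  A dyadic common fixed point which is not a corner is interior to a fixed interval, and affine maps that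
  fix two points of a cell fix all of it. So the adjacent cells are fixed as well, and the argument
  repeats at their endpoints until a corner is reached.
\<close>

lemma fixed_between_corners:
  assumes P: "P \<in> corners Z" "P' \<in> corners Z" "\<And>x. P < x \<Longrightarrow> x < P' \<Longrightarrow> x \<notin> corners Z"
    and x: "x \<in> Fix Z" "x \<in> grid M" "P < x" "x < P'"
  shows "{P..P'} \<subseteq> Fix Z"
proof -
  define F where "F i \<longleftrightarrow> (\<forall>t\<in>{0..1}. in_cell N i t \<longrightarrow> t \<in> Fix Z)" for i
  have PP: "P \<in> {0..1}" "P' \<in> {0..1}" using P by (auto simp: corners_def Fix_def)
  obtain u v where uv: "P = of_int u / 2 ^ N" "P' = of_int v / 2 ^ N" using corners_grid[OF P(1)] corners_grid[OF P(2)] grid_E by metis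
  have int: "interior_fixed Z r" if "r \<in> Fix Z" "r \<in> grid K" "P < r" "r < P'" for r K
    using P(3)[of r] that unfolding corners_def by blast
  have node: "F (k - 1) \<and> F k" if k: "of_int k / 2 ^ N \<in> Fix Z" "P < of_int k / 2 ^ N" "of_int k / 2 ^ N < P'" for k
  proof -
    define r where "r = of_int k / (2 ^ N :: real)"
    have r2: "r * 2 ^ N = of_int k" by (simp add: r_def)
    obtain a b where ab: "a < r" "r < b" "{a..b} \<subseteq> Fix Z" using int[OF k(1) grid_frac k(2,3)] unfolding interior_fixed_def r_def by blast
    define s where "s = max a ((of_int k - 1) / 2 ^ N)"
    define t where "t = min b ((of_int k + 1) / 2 ^ N)"
    have st: "s < r" "r < t" using ab by (auto simp: s_def t_def r_def divide_strict_right_mono)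
    have fx: "s \<in> Fix Z" "r \<in> Fix Z" "t \<in> Fix Z" using ab st by (auto simp: s_def t_def intro!: subsetD[OF ab(3)])
    have "in_cell N (k - 1) s" "in_cell N (k - 1) r" using st by (auto simp: in_cell_iff r_def s_def)
    then have 1: "F (k - 1)" unfolding F_def using two_fixed_cell[OF fx(1,2)] st by auto
    have "in_cell N k r" "in_cell N k t" using st by (auto simp: in_cell_iff r_def t_def)
    then have "F k" unfolding F_def using two_fixed_cell[OF fx(2,3)] st by auto
    then show ?thesis using 1 by blast
  qed
  have less: "of_int a / 2 ^ N < (of_int b / 2 ^ N :: real) \<longleftrightarrow> a < b" for a b by (simp add: divide_less_cancel)
  have step: "F k \<longleftrightarrow> F (k - 1)" if k: "u < k" "k < v" for k
  proof -
    define r where "r = of_int k / (2 ^ N :: real)"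
    have r: "P < r" "r < P'" using k unfolding uv r_def less by auto
    then have r01: "r \<in> {0..1}" using PP by auto
    have "in_cell N k r" "in_cell N (k - 1) r" by (auto simp: in_cell_def r_def)
    then have "F k \<Longrightarrow> r \<in> Fix Z" "F (k - 1) \<Longrightarrow> r \<in> Fix Z" using r01 unfolding F_def by blast+
    then show ?thesis using node[of k] r unfolding r_def by blast
  qed
  have "\<exists>i0. u \<le> i0 \<and> i0 < v \<and> F i0"
  proof (cases "x \<in> grid N")
    case True
    then obtain k where k: "x = of_int k / 2 ^ N" using grid_E by metis
    then have "u < k" "k < v" using x unfolding uv k less by auto
    then show ?thesis using node[of k] x unfolding k by (intro exI[of _ k]) auto
  next
    case False
    then have "x \<notin> fix_rats N" using fix_rats_grid x(2) by blast
    then have "F \<lfloor>x * 2 ^ N\<rfloor>" unfolding F_def using fixed_cell[OF x(1)] by blast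
    moreover have "of_int u \<le> x * 2 ^ N" "x * 2 ^ N < of_int v" using x unfolding uv by (auto simp: field_simps)
    then have "u \<le> \<lfloor>x * 2 ^ N\<rfloor>" "\<lfloor>x * 2 ^ N\<rfloor> < v" by (simp_all add: le_floor_iff floor_less_iff)
    ultimately show ?thesis by blast
  qed
  then obtain i0 where i0: "u \<le> i0" "i0 < v" "F i0" by blast
  have up: "i < v \<longrightarrow> F i" if "i0 \<le> i" for i
    using that
  proof (induction i rule: int_ge_induct)
    case (step i)
    show ?case
    proof
      assume "i + 1 < v"
      then have "F (i + 1 - 1)" "u < i + 1" using step i0(1) by simp_all
      then show "F (i + 1)" using \<open>\<And>k. u < k \<Longrightarrow> k < v \<Longrightarrow> F k \<longleftrightarrow> F (k - 1)\<close> \<open>i + 1 < v\<close> by blast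
    qed
  qed (use i0 in blast)
  have down: "u \<le> i \<longrightarrow> F i" if "i \<le> i0" for i
    using that
  proof (induction i rule: int_le_induct)
    case (step i)
    show ?case
    proof
      assume "u \<le> i - 1"
      then have "F i" "u < i" "i < v" using step i0(2) by simp_all
      then show "F (i - 1)" using \<open>\<And>k. u < k \<Longrightarrow> k < v \<Longrightarrow> F k \<longleftrightarrow> F (k - 1)\<close> by blast
    qed
  qed (use i0 in blast)
  have all: "F i" if "u \<le> i" "i < v" for i using up[of i] down[of i] that by linarith
  show ?thesis
  proof
    fix t assume t: "t \<in> {P..P'}"
    show "t \<in> Fix Z"
    proof (cases "t = P'")
      case True then show ?thesis using P(2) by (simp add: corners_def)
    next
      case False
      then have "of_int u \<le> t * 2 ^ N" "t * 2 ^ N < of_int v" using t unfolding uv by (auto simp: field_simps)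
      then have "u \<le> \<lfloor>t * 2 ^ N\<rfloor>" "\<lfloor>t * 2 ^ N\<rfloor> < v" by (simp_all add: le_floor_iff floor_less_iff)
      then show ?thesis using all t PP in_cell_floor[of N t] unfolding F_def by auto
    qed
  qed
qed

end

text \<open>
  The first summand serves the chains, the second one the fixed intervals.
\<close>

definition conjugator_bound :: "nat \<Rightarrow> nat" where
  "conjugator_bound N = (spread N ^^ Suc (2 ^ N)) (N + slope_bound N) + (2 * N + 2 * 2 ^ N)"

lemma grid_map: assumes "homeo M f" "x \<in> {0..1}" "x \<in> grid K" shows "\<exists>L. f x \<in> grid L"
proof -
  obtain j c where j: "\<bar>j\<bar> \<le> int M" "c \<in> grid M" "f x = 2 powi j * x + c"
    using levelE[OF homeo_level[OF assms(1)]] in_cell_floor assms(2) by metis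
  have "2 powi j * x \<in> grid (K + M)" by (rule grid_powi[OF assms(3)]) (use j in auto)
  then have "f x \<in> grid (K + M)" using j grid_mono[of c M "K + M"] by (auto intro: grid_add)
  then show ?thesis by blast
qed

context conjugacy begin

lemma conjugates_corners:
  assumes g: "conjugates R g" and x: "x \<in> corners Zs" shows "g x \<in> corners Ys"
proof -
  obtain M where M: "homeo M g" using g unfolding conjugates_def by blast
  have x01: "x \<in> {0..1}" "x \<in> Fix Zs" using x by (auto simp: corners_def Fix_def)
  have "\<exists>L. g x \<in> grid L" using grid_map[OF M x01(1)] x by (auto simp: corners_def)
  moreover have "g x \<in> Fix Ys" using conjugates_Fix[OF g x01(1)] x01 by simp
  moreover have "interior_fixed Zs x" if "interior_fixed Ys (g x)"
  proof -
    obtain a b where ab: "a \<in> {0..1}" "b \<in> {0..1}" "a < g x" "g x < b" "{a..b} \<subseteq> Fix Ys" using \<open>interior_fixed Ys (g x)\<close> unfolding interior_fixed_def by blast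
    obtain c d where cd: "c \<in> {0..1}" "g c = a" "d \<in> {0..1}" "g d = b" using conjugates_ex[OF g] ab by metis
    have "c < x" "x < d" using conjugates_less_iff[OF g cd(1) x01(1)] conjugates_less_iff[OF g x01(1) cd(3)] ab cd by auto
    moreover have "{c..d} \<subseteq> Fix Zs"
    proof
      fix t assume t: "t \<in> {c..d}"
      then have t01: "t \<in> {0..1}" using cd by auto
      have "g t \<in> {a..b}" using conjugates_le_iff[OF g cd(1) t01] conjugates_le_iff[OF g t01 cd(3)] t cd by auto
      then show "t \<in> Fix Zs" using ab(5) conjugates_Fix[OF g t01] by blast
    qed
    ultimately show ?thesis unfolding interior_fixed_def using cd by blast
  qed
  ultimately show ?thesis using x homeo_0[OF M] homeo_1[OF M] unfolding corners_def by auto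
qed

text \<open>
  Between successive corners either everything is fixed, and every map between the two intervals is
  a conjugator, or there is no dyadic common fixed point, and the interval is a chain.
\<close>

lemma local_conjugator:
  assumes g: "conjugates R g" and P: "P \<in> corners Zs" "P' \<in> corners Zs" "P < P'"
    and no: "\<And>x. P < x \<Longrightarrow> x < P' \<Longrightarrow> x \<notin> corners Zs"
  shows "\<exists>h. h P = g P \<and> h P' = g P' \<and> level (conjugator_bound N) h {P..P'} \<and>
    (\<forall>(z, y)\<in>R. \<forall>x\<in>{P..P'}. y (h x) = h (z x))"
proof -
  have PP: "P \<in> Fix Zs" "P' \<in> Fix Zs" "P \<in> {0..1}" "P' \<in> {0..1}" using P by (auto simp: corners_def Fix_def)
  note gr = zf.corners_grid[OF P(1)] zf.corners_grid[OF P(2)]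
  show ?thesis
  proof (cases "\<exists>x M. P < x \<and> x < P' \<and> x \<in> Fix Zs \<and> x \<in> grid M")
    case False
    then have "chain Zs P P'" using PP P(3) unfolding chain_def by blast
    then obtain h where h: "conjugates R h" "h P = g P" "h P' = g P'" "level (chain_bound (N + slope_bound N)) h {P..P'}"
      using chain_conjugator[OF g _ gr] by blast
    have "level (conjugator_bound N) h {P..P'}"
      by (rule level_mono[OF h(4)]) (simp add: conjugator_bound_def chain_bound_def)
    moreover have "\<forall>(z, y)\<in>R. \<forall>x\<in>{P..P'}. y (h x) = h (z x)" using conjugatesD[OF h(1)] PP by auto
    ultimately show ?thesis using h by blast
  next
    case True
    then have sub: "{P..P'} \<subseteq> Fix Zs" using zf.fixed_between_corners[OF P(1,2) no] by blast
    have gP: "g P \<in> grid N" "g P' \<in> grid N" using yf.corners_grid conjugates_corners[OF g] P by blast+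
    have gPP: "g P \<in> {0..1}" "g P' \<in> {0..1}" "g P < g P'" using conjugates_in[OF g] conjugates_less_iff[OF g] PP P(3) by auto
    have len: "\<exists>n::nat. 1 \<le> n \<and> n \<le> 2 ^ N \<and> b = a + real n / 2 ^ N"
      if ab: "a \<in> grid N" "b \<in> grid N" "a < b" "a \<in> {0..1}" "b \<in> {0..1}" for a b
    proof -
      obtain i j where ij: "a = of_int i / 2 ^ N" "b = of_int j / 2 ^ N" using ab grid_E by metis
      have "i < j" using ab(3) unfolding ij by (simp add: divide_less_cancel)
      have "b - a \<le> 1" using ab(4,5) unfolding atLeastAtMost_iff by linarith
      then have "of_int (j - i) / 2 ^ N \<le> (1::real)" unfolding ij of_int_diff diff_divide_distrib .
      then have "of_int (j - i) \<le> (of_int (2 ^ N) :: real)" by simp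
      then have "j - i \<le> 2 ^ N" by (simp only: of_int_le_iff)
      then have "nat (j - i) \<le> 2 ^ N" by (simp add: nat_le_iff)
      moreover have "b = a + real (nat (j - i)) / 2 ^ N" unfolding ij using \<open>i < j\<close> by (simp add: field_simps)
      ultimately show ?thesis using \<open>i < j\<close> by (intro exI[of _ "nat (j - i)"]) auto
    qed
    obtain m n :: nat where m: "1 \<le> m" "m \<le> 2 ^ N" "P' = P + real m / 2 ^ N" and n: "1 \<le> n" "n \<le> 2 ^ N" "g P' = g P + real n / 2 ^ N"
      using len[OF gr P(3) PP(3,4)] len[OF gP gPP(3,1,2)] by blast
    have "N + N + m + n \<le> conjugator_bound N" unfolding conjugator_bound_def using m n by linarith
    then obtain h where h: "h P = g P" "h P' = g P'" "level (conjugator_bound N) h {P..P'}"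
      using interval_map[OF m(1) n(1) gr(1) gP(1)] unfolding m(3)[symmetric] n(3)[symmetric] by blast
    have "y (h x) = h (z x)" if zy: "(z, y) \<in> R" and x: "x \<in> {P..P'}" for z y x
    proof -
      have "z x = x" using sub x zy by (force simp: Fix_def)
      have "P \<in> {P..P'}" "P' \<in> {P..P'}" using P(3) by auto
      then have "h P \<le> h x" "h x \<le> h P'" using level_le_iff[OF h(3)] x by (meson atLeastAtMost_iff)+
      then have hx: "h x \<in> {g P..g P'}" using h by simp
      then obtain t where t: "t \<in> {0..1}" "g t = h x" using conjugates_ex[OF g] gPP by (metis atLeastAtMost_iff order.trans)
      have "t \<in> {P..P'}" using t(2) hx conjugates_le_iff[OF g PP(3) t(1)] conjugates_le_iff[OF g t(1) PP(4)] by auto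
      then have "g t \<in> Fix Ys" using conjugates_Fix[OF g t(1)] sub by blast
      then have "y (h x) = h x" using t(2) zy by (force simp: Fix_def)
      then show ?thesis using \<open>z x = x\<close> by simp
    qed
    then show ?thesis using h by blast
  qed
qed

text \<open>
  The local conjugators agree with \<open>g\<close> at the corners, which are grid points, so they can be glued
  from left to right.
\<close>

theorem bounded_conjugator:
  assumes g: "conjugates R g"
  shows "\<exists>h. homeo (conjugator_bound N) h \<and> (\<forall>(z, y)\<in>R. \<forall>x\<in>{0..1}. y (h x) = h (z x))"
proof -
  let ?B = "conjugator_bound N"
  obtain M where M: "homeo M g" using g unfolding conjugates_def by blast
  have "\<exists>h. level ?B h {0..P} \<and> h 0 = 0 \<and> h P = g P \<and> (\<forall>(z, y)\<in>R. \<forall>x\<in>{0..P}. y (h x) = h (z x))"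
    if "P \<in> corners Zs" for P
    using that
  proof (induction "card (corners Zs \<inter> {..<P})" arbitrary: P rule: less_induct)
    case less
    have P: "P \<in> Fix Zs" "P \<in> {0..1}" using less.prems by (auto simp: corners_def Fix_def)
    have ends: "0 \<in> corners Zs" "1 \<in> corners Zs" by (rule zf.corners_01)+
    show ?case
    proof (cases "P = 0")
      case True
      have "level ?B (\<lambda>x. x) {0..P}" by (rule level_affine[where j = 0 and c = 0]) auto
      moreover have "y (0::real) = z 0" if "(z, y) \<in> R" for z y using R_homeo[OF that] homeo_0 by metis
      ultimately show ?thesis using True homeo_0[OF M] by (intro exI[of _ "\<lambda>x. x"]) auto
    next
      case False
      let ?A = "corners Zs \<inter> {..<P}"
      have fin: "finite ?A" using zf.finite_corners by simp
      have ne: "0 \<in> ?A" using ends False P by auto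
      define P0 where "P0 = Max ?A"
      have P0: "P0 \<in> ?A" unfolding P0_def using fin ne by (intro Max_in) auto
      have no: "x \<notin> corners Zs" if "P0 < x" "x < P" for x
      proof
        assume "x \<in> corners Zs"
        then have "x \<in> ?A" using that by simp
        then have "x \<le> P0" unfolding P0_def by (rule Max_ge[OF fin])
        then show False using that by simp
      qed
      have P0': "P0 \<in> corners Zs" "P0 < P" "P0 \<in> Fix Zs" "P0 \<in> {0..1}" using P0 by (auto simp: corners_def Fix_def)
      have "corners Zs \<inter> {..<P0} \<subset> ?A" using P0 by auto
      then have "card (corners Zs \<inter> {..<P0}) < card ?A" by (rule psubset_card_mono[OF fin])
      then obtain h1 where h1: "level ?B h1 {0..P0}" "h1 0 = 0" "h1 P0 = g P0" "\<forall>(z, y)\<in>R. \<forall>x\<in>{0..P0}. y (h1 x) = h1 (z x)"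
        using less.hyps P0'(1) by blast
      obtain h2 where h2: "h2 P0 = g P0" "h2 P = g P" "level ?B h2 {P0..P}" "\<forall>(z, y)\<in>R. \<forall>x\<in>{P0..P}. y (h2 x) = h2 (z x)"
        using local_conjugator[OF g P0'(1) less.prems P0'(2) no] by blast
      define h where "h = (\<lambda>x. if x \<le> P0 then h1 x else h2 x)"
      have gr: "P0 \<in> grid ?B" by (rule grid_mono[OF zf.corners_grid[OF P0'(1)]]) (simp add: conjugator_bound_def)
      have L: "level ?B h {0..P}" unfolding h_def by (rule level_glue_if[OF h1(1) h2(3) gr]) (use h1 h2 in simp)
      have "y (h x) = h (z x)" if zy: "(z, y) \<in> R" and x: "x \<in> {0..P}" for z y x
      proof -
        have x01: "x \<in> {0..1}" using x P by auto
        note i1 = fixed_interval_invariant[OF zy _ P0'(3) x01, of 0] and i2 = fixed_interval_invariant[OF zy P0'(3) P(1) x01]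
        have z0: "0 \<in> Fix Zs" using ends by (simp add: corners_def)
        show ?thesis
        proof (cases "x \<le> P0")
          case True
          then have "z x \<le> P0" using i1[OF z0] x by auto
          then show ?thesis using True h1(4) zy x by (auto simp: h_def)
        next
          case F: False
          then have "z x \<in> {P0..P}" using i2 x by auto
          moreover have "z x \<noteq> P0"
          proof
            assume "z x = P0"
            moreover have "z P0 = P0" using P0'(3) zy by (force simp: Fix_def)
            ultimately have "x = P0" using level_eq_iff[OF homeo_level, of N z x P0] R_homeo[OF zy] x01 P0'(4) by auto
            then show False using F by simp
          qed
          ultimately show ?thesis using F h2(4) zy x by (auto simp: h_def)
        qed
      qed
      then have "\<forall>(z, y)\<in>R. \<forall>x\<in>{0..P}. y (h x) = h (z x)" by blast
      moreover have "h 0 = 0" "h P = g P" using h1 h2 P0' by (auto simp: h_def)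
      ultimately show ?thesis using L by blast
    qed
  qed
  from this[of 1] show ?thesis using zf.corners_01 homeo_1[OF M] by (simp add: homeo_def)
qed

end

section \<open>Elements of the group and their descriptions\<close>

lemma homeo_thompson_F: assumes f: "homeo M f" shows "restrict f {0..1} \<in> thompson_F"
proof -
  let ?B = "(\<lambda>i. of_int i / 2 ^ M) ` {0..2 ^ M} :: real set"
  note L = homeo_level[OF f]
  have inj: "inj_on f {0..1}" using level_eq_iff[OF L] by (auto intro: inj_onI)
  obtain g where "homeomorphism {0..1} {0..1} f g"
    using homeomorphism_compact[OF compact_Icc level_continuous[OF L] homeo_image[OF f] inj] by blast
  then have hg: "homeomorphism {0..1} {0..1} (restrict f {0..1}) g" by (rule homeomorphism_cong) auto
  show ?thesis
  proof (rule thompson_F_I[OF _ hg])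
    show "strict_mono_on {0..1} (restrict f {0..1})"
      using level_less_iff[OF L] by (intro strict_mono_onI) auto
    show "finite ?B" by simp
    show "?B \<subseteq> dyadic_rationals" unfolding dyadic_rationals_def by blast
    fix a b :: real assume ab: "0 \<le> a" "a < b" "b \<le> 1" "{a<..<b} \<inter> ?B = {}"
    define i where "i = \<lfloor>a * 2 ^ M\<rfloor>"
    obtain j c where jc: "\<And>x. x \<in> {0..1} \<Longrightarrow> in_cell M i x \<Longrightarrow> f x = 2 powi j * x + c" using levelE[OF L] by metis
    define r where "r = of_int (i + 1) / (2 ^ M :: real)"
    have ar: "a < r" unfolding r_def i_def by (simp add: field_simps, linarith)
    have "b \<le> r"
    proof (rule ccontr)
      assume "\<not> b \<le> r"
      then have "r < b" by simp
      have "0 \<le> i" unfolding i_def using ab by simp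
      have "r \<le> 1" using \<open>r < b\<close> ab by simp
      then have "of_int (i + 1) \<le> (of_int (2 ^ M) :: real)" unfolding r_def by simp
      then have "i + 1 \<le> 2 ^ M" by (simp only: of_int_le_iff)
      then have "r \<in> ?B" unfolding r_def using \<open>0 \<le> i\<close> by (intro imageI) simp
      then show False using ab(4) ar \<open>r < b\<close> by auto
    qed
    have ia: "in_cell M i a" unfolding i_def by (rule in_cell_floor)
    have "f x = 2 powi j * x + c" if "x \<in> {a..b}" for x
    proof (rule jc)
      show "x \<in> {0..1}" using that ab by auto
      show "in_cell M i x" using ia that \<open>b \<le> r\<close> unfolding in_cell_iff r_def by auto
    qed
    then have "\<forall>x\<in>{a..b}. restrict f {0..1} x = 2 powi j * x + c" using ab by auto
    then show "affine_piece (restrict f {0..1}) a b" unfolding affine_piece_def by blast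
  qed simp
qed

type_synonym desc = "((nat \<times> nat) \<times> (nat \<times> nat)) list"

definition node_x :: "desc \<Rightarrow> nat \<Rightarrow> real" where "node_x ps i = dyadic (fst (ps ! i))"
definition node_y :: "desc \<Rightarrow> nat \<Rightarrow> real" where "node_y ps i = dyadic (snd (ps ! i))"

definition exps_le :: "nat \<Rightarrow> desc \<Rightarrow> bool" where
  "exps_le c ps \<longleftrightarrow> (\<forall>i<length ps. snd (fst (ps ! i)) \<le> c \<and> snd (snd (ps ! i)) \<le> c)"

text \<open>
  This is a condition on the list alone. It characterizes the lists that describe some element.
\<close>

definition valid_desc :: "nat \<Rightarrow> desc \<Rightarrow> bool" where
  "valid_desc c ps \<longleftrightarrow> ps \<noteq> [] \<and> node_x ps 0 = 0 \<and> node_y ps 0 = 0 \<and> node_x ps (length ps - 1) = 1 \<and> node_y ps (length ps - 1) = 1 \<and>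
     (\<forall>i. Suc i < length ps \<longrightarrow> node_x ps i < node_x ps (Suc i) \<and>
       (\<exists>j. \<bar>j\<bar> \<le> int c \<and> node_y ps (Suc i) - node_y ps i = 2 powi j * (node_x ps (Suc i) - node_x ps i)))"

lemma dyadic_in_grid: "snd p \<le> c \<Longrightarrow> dyadic p \<in> grid c"
  unfolding dyadic_def using grid_mono[OF grid_frac[of "int (fst p)" "snd p"]] by simp

lemma exps_le_grid: "exps_le c ps \<Longrightarrow> i < length ps \<Longrightarrow> node_x ps i \<in> grid c \<and> node_y ps i \<in> grid c"
  unfolding exps_le_def node_x_def node_y_def using dyadic_in_grid by blast

lemma describes_iff:
  "describes ps f \<longleftrightarrow> f \<in> thompson_F \<and> ps \<noteq> [] \<and> node_x ps 0 = 0 \<and> node_x ps (length ps - 1) = 1 \<and>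
     (\<forall>i. Suc i < length ps \<longrightarrow> node_x ps i < node_x ps (Suc i)) \<and> (\<forall>i<length ps. f (node_x ps i) = node_y ps i) \<and>
     (\<forall>i. Suc i < length ps \<longrightarrow> affine_piece f (node_x ps i) (node_x ps (Suc i)))"
proof -
  have s: "sorted_wrt (<) (xs::real list) \<longleftrightarrow> (\<forall>i. Suc i < length xs \<longrightarrow> xs ! i < xs ! Suc i)" for xs
    by (rule sorted_wrt_iff_nth_Suc_transp) (auto simp: transp_on_def)
  show ?thesis
    unfolding describes_def Let_def s by (cases "ps = []") (auto simp: node_x_def node_y_def hd_conv_nth last_conv_nth)
qed

text \<open>
  Both coordinates are in \<^term>\<open>grid c\<close> and in the unit interval, so their increments lie
  between \<open>1 / 2 ^ c\<close> and 1, and the exponent of the slope is bounded by \<open>c\<close>.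
\<close>

lemma describes_piece:
  assumes f: "describes ps f" and d: "exps_le c ps" and i: "Suc i < length ps"
  obtains j where "\<bar>j\<bar> \<le> int c" "node_x ps i < node_x ps (Suc i)" "node_y ps i < node_y ps (Suc i)"
    "node_y ps (Suc i) - node_y ps i = 2 powi j * (node_x ps (Suc i) - node_x ps i)"
    "\<And>x. node_x ps i \<le> x \<Longrightarrow> x \<le> node_x ps (Suc i) \<Longrightarrow> f x = node_y ps i + 2 powi j * (x - node_x ps i)"
proof -
  note D = f[unfolded describes_iff]
  have e: "f 0 = 0" "f 1 = 1" using thompson_F_ends D by auto
  have mono: "strict_mono_on {0..1} f" using D by (simp add: thompson_F_def)
  have lt: "node_x ps i < node_x ps (Suc i)" if "Suc i < length ps" for i using D that by blast
  have le: "node_x ps i \<le> node_x ps j" if "i \<le> j" "j < length ps" for i j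
    using that by (induction j rule: dec_induct) (use lt in \<open>force+\<close>)
  have x01: "node_x ps l \<in> {0..1}" if "l < length ps" for l
    using le[of 0 l] le[of l "length ps - 1"] that D by auto
  have y01: "node_y ps l \<in> {0..1}" if "l < length ps" for l
  proof -
    have "f (node_x ps l) \<in> {0..1}"
      using x01[OF that] strict_mono_on_leD[OF mono, of 0 "node_x ps l"] strict_mono_on_leD[OF mono, of "node_x ps l" 1] e by auto
    then show ?thesis using D that by simp
  qed
  have i': "i < length ps" using i by simp
  obtain j k where jk: "\<And>x. x \<in> {node_x ps i..node_x ps (Suc i)} \<Longrightarrow> f x = 2 powi j * x + k"
    using D i unfolding affine_piece_def by blast
  have Y: "node_y ps i = f (node_x ps i)" "node_y ps (Suc i) = f (node_x ps (Suc i))" using D i i' by auto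
  have eq: "node_y ps (Suc i) - node_y ps i = 2 powi j * (node_x ps (Suc i) - node_x ps i)"
    unfolding Y using jk[of "node_x ps i"] jk[of "node_x ps (Suc i)"] lt[OF i] by (simp add: algebra_simps)
  have "0 < 2 powi j * (node_x ps (Suc i) - node_x ps i)" using lt[OF i] by (intro mult_pos_pos) simp_all
  then have ylt: "node_y ps i < node_y ps (Suc i)" using eq by linarith
  have small: "1 / 2 ^ c \<le> node_y ps (Suc i) - node_y ps i" "1 / 2 ^ c \<le> node_x ps (Suc i) - node_x ps i"
    using grid_less_sep[of "node_y ps i" c "node_y ps (Suc i)"] grid_less_sep[of "node_x ps i" c "node_x ps (Suc i)"]
      ylt lt[OF i] exps_le_grid[OF d i] exps_le_grid[OF d i'] by auto
  have large: "node_y ps (Suc i) - node_y ps i \<le> 1" "node_x ps (Suc i) - node_x ps i \<le> 1"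
    using x01[OF i'] x01[OF i] y01[OF i'] y01[OF i] unfolding atLeastAtMost_iff by linarith+
  have "2 powi j * (1 / 2 ^ c) \<le> 2 powi j * (node_x ps (Suc i) - node_x ps i)" using small by (intro mult_left_mono) auto
  then have "2 powi j * (1 / 2 ^ c) \<le> (1::real)" using eq large by linarith
  moreover have "2 powi j * (node_x ps (Suc i) - node_x ps i) \<le> 2 powi j * 1" using large by (intro mult_left_mono) auto
  then have "1 / 2 ^ c \<le> 2 powi j * (1::real)" using eq small by linarith
  ultimately have "\<bar>j\<bar> \<le> int c" by (intro two_powi_boundsD) (simp_all add: field_simps)
  moreover have "f x = node_y ps i + 2 powi j * (x - node_x ps i)" if "node_x ps i \<le> x" "x \<le> node_x ps (Suc i)" for x
    unfolding Y(1) using jk[of x] jk[of "node_x ps i"] that lt[OF i] by (simp add: right_diff_distrib)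
  ultimately show ?thesis using that lt[OF i] ylt eq by blast
qed

lemma describes_valid:
  assumes f: "describes ps f" and d: "exps_le c ps"
  shows "valid_desc c ps"
proof -
  note D = f[unfolded describes_iff]
  have e: "f 0 = 0" "f 1 = 1" using thompson_F_ends D by auto
  have len: "0 < length ps" using D by simp
  have "node_y ps 0 = 0" using D len e by metis
  moreover have "length ps - 1 < length ps" using len by simp
  then have "node_y ps (length ps - 1) = 1" using D e by metis
  ultimately show ?thesis using D describes_piece[OF f d] unfolding valid_desc_def by metis
qed

lemma describes_homeo:
  assumes f: "describes ps f" and d: "exps_le c ps" shows "homeo (2 * c) f"
proof -
  note D = f[unfolded describes_iff]
  have e: "f 0 = 0" "f 1 = 1" using thompson_F_ends D by auto
  have "level (2 * c) f {0..1}"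
  proof (rule level_unitI[OF e])
    fix i :: int assume i: "0 \<le> i" "i < 2 ^ (2 * c)"
    define t where "t = of_int i / (2 ^ (2 * c) :: real)"
    have "of_int i < (of_int (2 ^ (2 * c)) :: real)" using i(2) by (simp only: of_int_less_iff)
    then have t: "0 \<le> t" "t < 1" unfolding t_def using i(1) by simp_all
    define l where "l = (GREATEST l. l < length ps \<and> node_x ps l \<le> t)"
    have P0: "0 < length ps \<and> node_x ps 0 \<le> t" using D t by simp
    have l: "l < length ps \<and> node_x ps l \<le> t"
      unfolding l_def by (rule GreatestI_nat[where P = "\<lambda>l. l < length ps \<and> node_x ps l \<le> t" and b = "length ps", OF P0]) auto
    have mx: "m \<le> l" if "m < length ps \<and> node_x ps m \<le> t" for m
      unfolding l_def by (rule Greatest_le_nat[where P = "\<lambda>l. l < length ps \<and> node_x ps l \<le> t" and b = "length ps", OF that]) auto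
    have Sl: "Suc l < length ps"
    proof (rule ccontr)
      assume "\<not> Suc l < length ps"
      then have "l = length ps - 1" using l by linarith
      then show False using l t D by simp
    qed
    have tl: "t < node_x ps (Suc l)" using mx[of "Suc l"] Sl by (force simp: not_le)
    have gx: "node_x ps l \<in> grid c" "node_y ps l \<in> grid c" "node_x ps (Suc l) \<in> grid (2 * c)"
      using exps_le_grid[OF d] l Sl grid_mono[of "node_x ps (Suc l)" c "2 * c"] by auto
    have "t \<in> grid (2 * c)" unfolding t_def by (rule grid_frac)
    then have tr: "t + 1 / 2 ^ (2 * c) \<le> node_x ps (Suc l)" using grid_less_sep gx(3) tl by blast
    obtain j where j: "\<bar>j\<bar> \<le> int c"
      and fx: "\<And>x. node_x ps l \<le> x \<Longrightarrow> x \<le> node_x ps (Suc l) \<Longrightarrow> f x = node_y ps l + 2 powi j * (x - node_x ps l)"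
      using describes_piece[OF f d Sl] by metis
    define k where "k = node_y ps l - 2 powi j * node_x ps l"
    have "2 powi j * node_x ps l \<in> grid (c + c)" by (rule grid_powi[OF gx(1)]) (use j in auto)
    then have "k \<in> grid (2 * c)" unfolding k_def mult_2 using grid_mono[OF gx(2), of "c + c"] by (intro grid_diff) auto
    moreover have "f x = 2 powi j * x + k" if "in_cell (2 * c) i x" for x
    proof -
      have "t \<le> x" "x \<le> t + 1 / 2 ^ (2 * c)" using that unfolding in_cell_iff t_def by (simp_all add: add_divide_distrib)
      then show ?thesis using fx[of x] l tr by (simp add: k_def right_diff_distrib)
    qed
    moreover have "\<bar>j\<bar> \<le> int (2 * c)" using j by simp
    ultimately show "\<exists>j k. \<bar>j\<bar> \<le> int (2 * c) \<and> k \<in> grid (2 * c) \<and> (\<forall>x\<in>{0..1}. in_cell (2 * c) i x \<longrightarrow> f x = 2 powi j * x + k)"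
      by blast
  qed
  then show ?thesis using e by (simp add: homeo_def)
qed


lemma valid_describes:
  assumes V: "valid_desc c ps" and d: "exps_le c ps" shows "\<exists>f. describes ps f"
proof -
  note V' = V[unfolded valid_desc_def]
  have lt: "node_x ps i < node_x ps (Suc i)" if "Suc i < length ps" for i using V' that by blast
  have le: "node_x ps i \<le> node_x ps j" if "i \<le> j" "j < length ps" for i j
    using that by (induction j rule: dec_induct) (use lt in \<open>force+\<close>)
  have claim: "\<exists>h. level (2 * c) h {0..node_x ps l} \<and> (\<forall>m\<le>l. h (node_x ps m) = node_y ps m) \<and> (\<forall>m<l. affine_piece h (node_x ps m) (node_x ps (Suc m)))"
    if "l < length ps" for l
    using that
  proof (induction l)
    case 0
    have "level (2 * c) (\<lambda>x. x) {0..node_x ps 0}" by (rule level_affine[where j = 0 and c = 0]) auto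
    then show ?case using V' by (intro exI[of _ "\<lambda>x. x"]) auto
  next
    case (Suc l)
    then obtain h where h: "level (2 * c) h {0..node_x ps l}" "\<And>m. m \<le> l \<Longrightarrow> h (node_x ps m) = node_y ps m"
      "\<And>m. m < l \<Longrightarrow> affine_piece h (node_x ps m) (node_x ps (Suc m))" by auto
    obtain j where j: "\<bar>j\<bar> \<le> int c" "node_y ps (Suc l) - node_y ps l = 2 powi j * (node_x ps (Suc l) - node_x ps l)" using V' Suc.prems by blast
    define k where "k = node_y ps l - 2 powi j * node_x ps l"
    define h2 where "h2 x = 2 powi j * x + k" for x
    \<comment> \<open>the pieces are added from left to right\<close>
    define h3 where "h3 = (\<lambda>x. if x \<le> node_x ps l then h x else h2 x)"
    have g: "node_x ps l \<in> grid c" "node_y ps l \<in> grid c" using exps_le_grid[OF d] Suc.prems by auto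
    have "2 powi j * node_x ps l \<in> grid (c + c)" by (rule grid_powi[OF g(1)]) (use j in auto)
    then have "k \<in> grid (2 * c)" unfolding k_def mult_2 using grid_mono[OF g(2), of "c + c"] by (intro grid_diff) auto
    then have L2: "level (2 * c) h2 S" for S by (rule level_affine[where j = j, rotated]) (use j in \<open>auto simp: h2_def\<close>)
    have h2v: "h2 (node_x ps l) = node_y ps l" "h2 (node_x ps (Suc l)) = node_y ps (Suc l)" using j(2) by (simp_all add: h2_def k_def algebra_simps)
    have "level (2 * c) h3 {0..node_x ps (Suc l)}" unfolding h3_def
      by (rule level_glue_if[OF h(1) L2]) (use h(2)[of l] h2v grid_mono[OF g(1)] in auto)
    moreover have "h3 (node_x ps m) = node_y ps m" if "m \<le> Suc l" for m
    proof (cases "m = Suc l")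
      case True then show ?thesis using lt[OF Suc.prems] h2v by (simp add: h3_def)
    next
      case False
      then have "m \<le> l" using that by simp
      then show ?thesis using h(2) le[of m l] Suc.prems by (simp add: h3_def)
    qed
    moreover have "affine_piece h3 (node_x ps m) (node_x ps (Suc m))" if "m < Suc l" for m
    proof (cases "m = l")
      case True
      have "\<forall>x\<in>{node_x ps l..node_x ps (Suc l)}. h3 x = 2 powi j * x + k"
      proof
        fix x assume x: "x \<in> {node_x ps l..node_x ps (Suc l)}"
        show "h3 x = 2 powi j * x + k"
          using x h(2)[of l] h2v by (cases "x = node_x ps l") (auto simp: h3_def h2_def)
      qed
      then show ?thesis unfolding True affine_piece_def by blast
    next
      case False
      then have m: "m < l" using that by simp
      obtain i e where ie: "\<forall>x\<in>{node_x ps m..node_x ps (Suc m)}. h x = 2 powi i * x + e" using h(3)[OF m] unfolding affine_piece_def by blast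
      have "node_x ps (Suc m) \<le> node_x ps l" using le[of "Suc m" l] m Suc.prems by simp
      then have "\<forall>x\<in>{node_x ps m..node_x ps (Suc m)}. h3 x = 2 powi i * x + e" using ie by (simp add: h3_def)
      then show ?thesis unfolding affine_piece_def by blast
    qed
    ultimately show ?case by blast
  qed
  have len: "length ps - 1 < length ps" "node_x ps (length ps - 1) = 1" "node_y ps (length ps - 1) = 1" "node_x ps 0 = 0" "node_y ps 0 = 0" using V' by auto
  obtain h where h: "level (2 * c) h {0..1}" "\<And>m. m < length ps \<Longrightarrow> h (node_x ps m) = node_y ps m"
    "\<And>m. Suc m < length ps \<Longrightarrow> affine_piece h (node_x ps m) (node_x ps (Suc m))"
    using claim[OF len(1)] len(2) by fastforce
  have "0 < length ps" using len(1) by linarith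
  then have "h 0 = 0" "h 1 = 1" using h(2)[of 0] h(2)[of "length ps - 1"] len by metis+
  then have "homeo (2 * c) h" using h(1) by (simp add: homeo_def)
  then have F: "restrict h {0..1} \<in> thompson_F" by (rule homeo_thompson_F)
  have x01: "node_x ps i \<in> {0..1}" if "i < length ps" for i
    using le[of 0 i] le[of i "length ps - 1"] that len by auto
  have "affine_piece (restrict h {0..1}) (node_x ps m) (node_x ps (Suc m))" if m: "Suc m < length ps" for m
  proof -
    obtain i e where "\<forall>x\<in>{node_x ps m..node_x ps (Suc m)}. h x = 2 powi i * x + e" using h(3)[OF m] unfolding affine_piece_def by blast
    then have "\<forall>x\<in>{node_x ps m..node_x ps (Suc m)}. restrict h {0..1} x = 2 powi i * x + e" using x01[of m] x01[of "Suc m"] m by auto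
    then show ?thesis unfolding affine_piece_def by blast
  qed
  then have "describes ps (restrict h {0..1})" unfolding describes_iff using F V' lt h(2) x01 by auto
  then show ?thesis by blast
qed

section \<open>Computable functions and decidable predicates\<close>

text \<open>
  It is enough to deal with functions of one argument, because several arguments are coded into one
  by \<open>prod_encode\<close>. Functions of two and three arguments serve to construct this coding and to state
  primitive recursion.
\<close>

definition computable :: "(nat \<Rightarrow> nat) \<Rightarrow> bool" where
  "computable f \<longleftrightarrow> (\<exists>p. \<forall>x. run p [x] = Some (f x))"

definition computable2 :: "(nat \<Rightarrow> nat \<Rightarrow> nat) \<Rightarrow> bool" where
  "computable2 f \<longleftrightarrow> (\<exists>p. \<forall>x y. run p [x, y] = Some (f x y))"

definition computable3 :: "(nat \<Rightarrow> nat \<Rightarrow> nat \<Rightarrow> nat) \<Rightarrow> bool" where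
  "computable3 f \<longleftrightarrow> (\<exists>p. \<forall>x y z. run p [x, y, z] = Some (f x y z))"

lemma computable_id: "computable (\<lambda>x. x)"
  unfolding computable_def by (rule exI[of _ "Proj 0"]) simp

lemma computable2_proj: "computable2 (\<lambda>x y. x)" "computable2 (\<lambda>x y. y)"
  unfolding computable2_def by (rule exI[of _ "Proj 0"], simp, rule exI[of _ "Proj 1"], simp)

lemma computable3_proj: "computable3 (\<lambda>x y z. x)" "computable3 (\<lambda>x y z. y)" "computable3 (\<lambda>x y z. z)"
  unfolding computable3_def
  by (rule exI[of _ "Proj 0"], simp, rule exI[of _ "Proj 1"], simp, rule exI[of _ "Proj 2"], simp)

lemma computable_Suc: "computable Suc"
  unfolding computable_def by (rule exI[of _ Succ]) simp

lemma computable_comp: "computable h \<Longrightarrow> computable f \<Longrightarrow> computable (\<lambda>x. h (f x))"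
proof -
  assume "computable h" "computable f"
  then obtain p q where "\<And>x. run p [x] = Some (h x)" "\<And>x. run q [x] = Some (f x)" unfolding computable_def by blast
  then have "\<forall>x. run (Comp p [q]) [x] = Some (h (f x))" by simp
  then show ?thesis unfolding computable_def by blast
qed

lemma computable_comp2: "computable2 h \<Longrightarrow> computable f \<Longrightarrow> computable g \<Longrightarrow> computable (\<lambda>x. h (f x) (g x))"
proof -
  assume "computable2 h" "computable f" "computable g"
  then obtain p q r where "\<And>x y. run p [x, y] = Some (h x y)" "\<And>x. run q [x] = Some (f x)" "\<And>x. run r [x] = Some (g x)"
    unfolding computable_def computable2_def by blast
  then have "\<forall>x. run (Comp p [q, r]) [x] = Some (h (f x) (g x))" by simp
  then show ?thesis unfolding computable_def by blast
qed

lemma computable2_comp: "computable h \<Longrightarrow> computable2 f \<Longrightarrow> computable2 (\<lambda>x y. h (f x y))"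
proof -
  assume "computable h" "computable2 f"
  then obtain p q where "\<And>x. run p [x] = Some (h x)" "\<And>x y. run q [x, y] = Some (f x y)"
    unfolding computable_def computable2_def by blast
  then have "\<forall>x y. run (Comp p [q]) [x, y] = Some (h (f x y))" by simp
  then show ?thesis unfolding computable2_def by blast
qed

lemma computable2_comp2: "computable2 h \<Longrightarrow> computable2 f \<Longrightarrow> computable2 g \<Longrightarrow> computable2 (\<lambda>x y. h (f x y) (g x y))"
proof -
  assume "computable2 h" "computable2 f" "computable2 g"
  then obtain p q r where "\<And>x y. run p [x, y] = Some (h x y)" "\<And>x y. run q [x, y] = Some (f x y)" "\<And>x y. run r [x, y] = Some (g x y)"
    unfolding computable2_def by blast
  then have "\<forall>x y. run (Comp p [q, r]) [x, y] = Some (h (f x y) (g x y))" by simp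
  then show ?thesis unfolding computable2_def by blast
qed

lemma computable3_comp: "computable h \<Longrightarrow> computable3 f \<Longrightarrow> computable3 (\<lambda>x y z. h (f x y z))"
proof -
  assume "computable h" "computable3 f"
  then obtain p q where "\<And>x. run p [x] = Some (h x)" "\<And>x y z. run q [x, y, z] = Some (f x y z)"
    unfolding computable_def computable3_def by blast
  then have "\<forall>x y z. run (Comp p [q]) [x, y, z] = Some (h (f x y z))" by simp
  then show ?thesis unfolding computable3_def by blast
qed

lemma computable3_comp2: "computable2 h \<Longrightarrow> computable3 f \<Longrightarrow> computable3 g \<Longrightarrow> computable3 (\<lambda>x y z. h (f x y z) (g x y z))"
proof -
  assume "computable2 h" "computable3 f" "computable3 g"
  then obtain p q r where "\<And>x y. run p [x, y] = Some (h x y)" "\<And>x y z. run q [x, y, z] = Some (f x y z)" "\<And>x y z. run r [x, y, z] = Some (g x y z)"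
    unfolding computable2_def computable3_def by blast
  then have "\<forall>x y z. run (Comp p [q, r]) [x, y, z] = Some (h (f x y z) (g x y z))" by simp
  then show ?thesis unfolding computable3_def by blast
qed

lemma computable_const: "computable (\<lambda>x. c)"
proof (induction c)
  case 0 show ?case unfolding computable_def by (rule exI[of _ Zero]) simp
next
  case (Suc c) then show ?case using computable_comp[OF computable_Suc] by simp
qed

lemma computable2_rec:
  assumes "computable a" "computable3 s" shows "computable2 (\<lambda>n y. rec_nat (a y) (\<lambda>m r. s m r y) n)"
proof -
  obtain p q where p: "\<And>y. run p [y] = Some (a y)" and q: "\<And>m r y. run q [m, r, y] = Some (s m r y)"
    using assms unfolding computable_def computable3_def by blast
  have "run (PrimRec p q) [n, y] = Some (rec_nat (a y) (\<lambda>m r. s m r y) n)" for n y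
    by (induction n) (simp_all add: p q)
  then show ?thesis unfolding computable2_def by blast
qed

lemma computable_Least:
  assumes "computable2 h" "\<And>x. \<exists>n. h n x = 0" shows "computable (\<lambda>x. LEAST n. h n x = 0)"
proof -
  obtain p where p: "\<And>n x. run p [n, x] = Some (h n x)" using assms(1) unfolding computable2_def by blast
  have "run (Mu p) [x] = Some (LEAST n. h n x = 0)" for x
    using assms(2)[of x] by (simp add: p)
  then show ?thesis unfolding computable_def by blast
qed

lemma computable2_add: "computable2 (\<lambda>x y. x + y)"
proof -
  have "computable2 (\<lambda>n y. rec_nat y (\<lambda>m r. Suc r) n)"
    by (intro computable2_rec computable_id computable3_comp[OF computable_Suc] computable3_proj)
  moreover have "rec_nat y (\<lambda>m r. Suc r) n = n + y" for n y :: nat by (induction n) auto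
  ultimately show ?thesis by simp
qed

lemma computable2_mult: "computable2 (\<lambda>x y. x * y)"
proof -
  have "computable2 (\<lambda>n y. rec_nat 0 (\<lambda>m r. r + y) n)"
    by (intro computable2_rec computable_const computable3_comp2[OF computable2_add] computable3_proj)
  moreover have "rec_nat 0 (\<lambda>m r. r + y) n = n * y" for n y :: nat by (induction n) auto
  ultimately show ?thesis by simp
qed

lemma computable_pred: "computable (\<lambda>x. x - 1)"
proof -
  have "computable2 (\<lambda>n y. rec_nat 0 (\<lambda>m r. m) n)"
    by (intro computable2_rec computable_const computable3_proj)
  then have "computable (\<lambda>n. rec_nat 0 (\<lambda>m r. m) n)"
    using computable_comp2[OF _ computable_id computable_id] by blast
  moreover have "rec_nat 0 (\<lambda>m r. m) n = n - 1" for n :: nat by (induction n) auto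
  ultimately show ?thesis by simp
qed

lemma computable2_diff: "computable2 (\<lambda>x y. x - y)"
proof -
  have "computable2 (\<lambda>n y. rec_nat y (\<lambda>m r. r - 1) n)"
    by (intro computable2_rec computable_id computable3_comp[OF computable_pred] computable3_proj)
  moreover have "rec_nat y (\<lambda>m r. r - 1) n = y - n" for n y :: nat by (induction n) auto
  ultimately have "computable2 (\<lambda>n y. y - n)" by simp
  from computable2_comp2[OF this computable2_proj(2) computable2_proj(1)] show ?thesis .
qed

lemma computable_triangle: "computable triangle"
proof -
  have "computable2 (\<lambda>n y. rec_nat 0 (\<lambda>m r. r + Suc m) n)"
    by (intro computable2_rec computable_const computable3_comp2[OF computable2_add] computable3_comp[OF computable_Suc] computable3_proj)
  then have "computable (\<lambda>n. rec_nat 0 (\<lambda>m r. r + Suc m) n)"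
    using computable_comp2[OF _ computable_id computable_id] by blast
  moreover have "rec_nat 0 (\<lambda>m r. r + Suc m) n = triangle n" for n :: nat by (induction n) auto
  ultimately show ?thesis by (metis (no_types, lifting) ext)
qed

definition npair :: "nat \<Rightarrow> nat \<Rightarrow> nat" where "npair a b = prod_encode (a, b)"
definition nfst :: "nat \<Rightarrow> nat" where "nfst w = fst (prod_decode w)"
definition nsnd :: "nat \<Rightarrow> nat" where "nsnd w = snd (prod_decode w)"

lemma nfst_npair [simp]: "nfst (npair a b) = a" and nsnd_npair [simp]: "nsnd (npair a b) = b" and npair_nfst_nsnd [simp]: "npair (nfst w) (nsnd w) = w"
  by (simp_all add: npair_def nfst_def nsnd_def)

lemma computable2_npair: "computable2 npair"
proof -
  have "computable2 (\<lambda>a b. triangle (a + b) + a)"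
    by (intro computable2_comp2[OF computable2_add] computable2_comp[OF computable_triangle] computable2_add computable2_proj)
  then show ?thesis by (simp add: npair_def[abs_def] prod_encode_def)
qed

lemma triangle_mono: "m \<le> n \<Longrightarrow> triangle m \<le> triangle n"
  by (induction n rule: dec_induct) auto

text \<open>
  The pairing function enumerates the diagonals of the plane, and \<open>triangle s\<close> is the first
  number on the diagonal with sum \<open>s\<close>. So minimization finds the sum of the components, from which the
  components themselves are recovered.
\<close>

lemma diagonal_Least: "(LEAST s. Suc w - triangle (Suc s) = 0) = nfst w + nsnd w"
proof (rule Least_equality)
  have w: "w = triangle (nfst w + nsnd w) + nfst w"
    using npair_nfst_nsnd[of w] by (simp only: npair_def prod_encode_def split)
  then show "Suc w - triangle (Suc (nfst w + nsnd w)) = 0" by simp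
  fix s assume "Suc w - triangle (Suc s) = 0"
  then have "w < triangle (Suc s)" by simp
  then show "nfst w + nsnd w \<le> s" using triangle_mono[of "Suc s" "nfst w + nsnd w"] w by linarith
qed

lemma computable_nfst: "computable nfst" and computable_nsnd: "computable nsnd"
proof -
  have "computable2 (\<lambda>s w. Suc w - triangle (Suc s))"
    by (intro computable2_comp2[OF computable2_diff] computable2_comp[OF computable_Suc] computable2_comp[OF computable_triangle]
        computable2_proj)
  moreover have "\<exists>s. Suc w - triangle (Suc s) = 0" for w
    by (rule exI[of _ w]) simp
  ultimately have "computable (\<lambda>w. LEAST s. Suc w - triangle (Suc s) = 0)" by (rule computable_Least)
  then have d: "computable (\<lambda>w. nfst w + nsnd w)" unfolding diagonal_Least .
  have "computable (\<lambda>w. w - triangle (nfst w + nsnd w))"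
    by (intro computable_comp2[OF computable2_diff] computable_comp[OF computable_triangle] d computable_id)
  moreover have "w - triangle (nfst w + nsnd w) = nfst w" for w
    using npair_nfst_nsnd[of w] by (simp only: npair_def prod_encode_def split)
  ultimately show f: "computable nfst" by (metis (no_types, lifting) ext)
  have "computable (\<lambda>w. (nfst w + nsnd w) - nfst w)" by (intro computable_comp2[OF computable2_diff] d f)
  then show "computable nsnd" by simp
qed

named_theorems computable

lemmas [computable] = computable_id computable_const
  computable_comp[OF computable_Suc] computable_comp[OF computable_nfst] computable_comp[OF computable_nsnd]
  computable_comp2[OF computable2_npair] computable_comp2[OF computable2_add] computable_comp2[OF computable2_mult]
  computable_comp2[OF computable2_diff]

lemma uncurry_computable2: "computable (\<lambda>w. h (nfst w) (nsnd w)) \<Longrightarrow> computable2 h"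
  using computable2_comp[OF _ computable2_npair, of "\<lambda>w. h (nfst w) (nsnd w)"] by simp

lemma uncurry_computable3:
  assumes "computable (\<lambda>w. h (nfst w) (nfst (nsnd w)) (nsnd (nsnd w)))" shows "computable3 h"
proof -
  have "computable3 (\<lambda>x y z. npair x (npair y z))" by (intro computable3_comp2[OF computable2_npair] computable3_proj)
  from computable3_comp[OF assms this] show ?thesis by simp
qed

lemma computable_binary:
  "computable (\<lambda>w. h (nfst w) (nsnd w)) \<Longrightarrow> computable f \<Longrightarrow> computable g \<Longrightarrow> computable (\<lambda>x. h (f x) (g x))"
  by (rule computable_comp2[OF uncurry_computable2])

lemma computable_rec_nat:
  assumes "computable (\<lambda>w. s (nfst w) (nfst (nsnd w)) (nsnd (nsnd w)))" "computable a" "computable b"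
  shows "computable (\<lambda>x. rec_nat (a x) (\<lambda>m r. s m r x) (b x))"
  by (rule computable_comp2[OF computable2_rec[OF assms(2) uncurry_computable3[OF assms(1)]] assms(3) computable_id])

lemma computable_funpow:
  assumes "computable h" "computable a" "computable b"
  shows "computable (\<lambda>x. (h ^^ b x) (a x))"
proof -
  have "computable (\<lambda>x. rec_nat (a x) (\<lambda>m r. h r) (b x))"
    by (intro computable_rec_nat computable_comp[OF assms(1)] computable assms)
  moreover have "rec_nat y (\<lambda>m r. h r) n = (h ^^ n) y" for y n by (induction n) auto
  ultimately show ?thesis by simp
qed

lemma computable_power [computable]:
  assumes "computable f" "computable g" shows "computable (\<lambda>x. f x ^ g x)"
proof -
  have "computable (\<lambda>x. rec_nat 1 (\<lambda>m r. r * f x) (g x))"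
    by (rule computable_rec_nat) (intro computable computable_comp[OF assms(1)] assms)+
  moreover have "rec_nat 1 (\<lambda>m r. r * y) n = y ^ n" for y n :: nat by (induction n) auto
  ultimately show ?thesis by simp
qed

definition decidable :: "(nat \<Rightarrow> bool) \<Rightarrow> bool" where
  "decidable P \<longleftrightarrow> computable (\<lambda>x. if P x then 1 else 0)"

lemma decidable_comp: "decidable P \<Longrightarrow> computable f \<Longrightarrow> decidable (\<lambda>x. P (f x))"
  unfolding decidable_def by (rule computable_comp)

lemma decidable_not [computable]: assumes "decidable P" shows "decidable (\<lambda>x. \<not> P x)"
proof -
  have "computable (\<lambda>x. 1 - (if P x then 1 else 0))" using assms unfolding decidable_def by (intro computable)
  moreover have "(\<lambda>x. 1 - (if P x then 1 else 0)) = (\<lambda>x. if \<not> P x then 1 else (0::nat))" by auto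
  ultimately show ?thesis unfolding decidable_def by simp
qed

lemma decidable_conj [computable]: assumes "decidable P" "decidable Q" shows "decidable (\<lambda>x. P x \<and> Q x)"
proof -
  have "computable (\<lambda>x. (if P x then 1 else 0) * (if Q x then 1 else 0))" using assms unfolding decidable_def by (intro computable)
  moreover have "(\<lambda>x. (if P x then 1 else 0) * (if Q x then 1 else 0)) = (\<lambda>x. if P x \<and> Q x then 1 else (0::nat))" by auto
  ultimately show ?thesis unfolding decidable_def by simp
qed

lemma decidable_disj [computable]: assumes "decidable P" "decidable Q" shows "decidable (\<lambda>x. P x \<or> Q x)"
proof -
  have "decidable (\<lambda>x. \<not> (\<not> P x \<and> \<not> Q x))" by (intro computable assms)
  then show ?thesis by simp
qed

lemma decidable_le [computable]: assumes "computable f" "computable g" shows "decidable (\<lambda>x. f x \<le> g x)"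
proof -
  have "computable (\<lambda>x. 1 - (f x - g x))" using assms by (intro computable)
  moreover have "(\<lambda>x. 1 - (f x - g x)) = (\<lambda>x. if f x \<le> g x then 1 else 0)" by auto
  ultimately show ?thesis unfolding decidable_def by simp
qed

lemma decidable_less [computable]: assumes "computable f" "computable g" shows "decidable (\<lambda>x. f x < g x)"
proof -
  have "decidable (\<lambda>x. Suc (f x) \<le> g x)" using assms by (intro computable)
  then show ?thesis by (simp add: Suc_le_eq)
qed

lemma decidable_eq [computable]: assumes "computable f" "computable g" shows "decidable (\<lambda>x. f x = g x)"
proof -
  have "decidable (\<lambda>x. f x \<le> g x \<and> g x \<le> f x)" using assms by (intro computable)
  then show ?thesis by (simp add: eq_iff)
qed

lemma computable_if [computable]:
  assumes "decidable P" "computable f" "computable g" shows "computable (\<lambda>x. if P x then f x else g x)"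
proof -
  have "computable (\<lambda>x. (if P x then 1 else 0) * f x + (1 - (if P x then 1 else 0)) * g x)"
    using assms unfolding decidable_def by (intro computable)
  moreover have "(\<lambda>x. (if P x then 1 else 0) * f x + (1 - (if P x then 1 else 0)) * g x) = (\<lambda>x. if P x then f x else g x)" by auto
  ultimately show ?thesis by simp
qed

lemma decidable_ball:
  assumes P: "decidable (\<lambda>w. P (nfst w) (nsnd w))" and b: "computable b" shows "decidable (\<lambda>x. \<forall>i<b x. P i x)"
proof -
  define p where "p i x = (if P i x then 1 else 0 :: nat)" for i x
  have p: "computable (\<lambda>w. p (nfst w) (nsnd w))" using P unfolding decidable_def p_def .
  have "computable (\<lambda>x. rec_nat 1 (\<lambda>m r. r * p m x) (b x))"
    by (rule computable_rec_nat) (intro computable computable_binary[OF p] b)+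
  moreover have "rec_nat 1 (\<lambda>m r. r * p m x) n = (if \<forall>i<n. P i x then 1 else 0)" for x n
    by (induction n) (auto simp: p_def less_Suc_eq)
  ultimately show ?thesis unfolding decidable_def by simp
qed

lemma decidable_bex:
  assumes P: "decidable (\<lambda>w. P (nfst w) (nsnd w))" and b: "computable b" shows "decidable (\<lambda>x. \<exists>i<b x. P i x)"
proof -
  have "decidable (\<lambda>x. \<forall>i<b x. \<not> P i x)" by (rule decidable_ball[OF decidable_not[OF P] b])
  then have "decidable (\<lambda>x. \<not> (\<forall>i<b x. \<not> P i x))" by (rule decidable_not)
  then show ?thesis by simp
qed

lemma computable_LEAST:
  assumes P: "decidable (\<lambda>w. P (nfst w) (nsnd w))" and ex: "\<And>x. \<exists>n. P n x" shows "computable (\<lambda>x. LEAST n. P n x)"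
proof -
  have "computable (\<lambda>w. if P (nfst w) (nsnd w) then 0 else 1)" using P by (intro computable)
  then have "computable2 (\<lambda>n x. if P n x then 0 else 1)" by (rule uncurry_computable2)
  from computable_Least[OF this] ex have "computable (\<lambda>x. LEAST n. (if P n x then 0 else (1::nat)) = 0)" by simp
  moreover have "(if P n x then 0 else (1::nat)) = 0 \<longleftrightarrow> P n x" for n x by simp
  ultimately show ?thesis by simp
qed

lemma computable_div [computable]:
  assumes "computable f" "computable g" shows "computable (\<lambda>x. f x div g x)"
proof -
  have "computable (\<lambda>w. LEAST q. nsnd w = 0 \<or> nfst w < Suc q * nsnd w)"
  proof (rule computable_LEAST)
    show "\<exists>q. nsnd w = 0 \<or> nfst w < Suc q * nsnd w" for w
      by (rule exI[of _ "nfst w"]) (cases "nsnd w", auto)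
  qed (intro computable)
  moreover have "(LEAST q. b = 0 \<or> a < Suc q * b) = a div b" for a b :: nat
  proof (cases "b = 0")
    case True then show ?thesis by (simp add: Least_equality)
  next
    case False
    show ?thesis
    proof (rule Least_equality)
      have "a mod b < b" using False by simp
      then have "a < Suc (a div b) * b" using div_mult_mod_eq[of a b] unfolding mult_Suc by linarith
      then show "b = 0 \<or> a < Suc (a div b) * b" ..
      fix q assume "b = 0 \<or> a < Suc q * b"
      then have "a < Suc q * b" using False by blast
      then have "a div b < Suc q" by (rule less_mult_imp_div_less)
      then show "a div b \<le> q" by simp
    qed
  qed
  ultimately have "computable (\<lambda>w. nfst w div nsnd w)" by simp
  then show ?thesis using assms by (rule computable_binary)
qed

section \<open>Coded lists\<close>

definition ntl :: "nat \<Rightarrow> nat" where "ntl c = nsnd (c - 1)"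
definition entry :: "nat \<Rightarrow> nat \<Rightarrow> nat" where "entry c i = nfst ((ntl ^^ i) c - 1)"
definition len :: "nat \<Rightarrow> nat" where "len c = (LEAST l. (ntl ^^ l) c = 0)"

lemma ntl_encode: "(ntl ^^ i) (list_encode xs) = list_encode (drop i xs)"
proof (induction i arbitrary: xs)
  case (Suc i)
  have "nsnd 0 = 0" using nsnd_npair[of 0 0] by (simp add: npair_def prod_encode_def)
  then have "ntl (list_encode xs) = list_encode (tl xs)"
    by (cases xs) (simp_all add: ntl_def, simp add: nsnd_def)
  then show ?case using Suc[of "tl xs"] by (simp add: funpow_swap1 drop_Suc)
qed simp

lemma entry_encode: "i < length xs \<Longrightarrow> entry (list_encode xs) i = xs ! i"
  by (simp add: entry_def ntl_encode nfst_def Cons_nth_drop_Suc[symmetric])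

lemma len_encode: "len (list_encode xs) = length xs"
proof -
  have "list_encode ys = 0 \<longleftrightarrow> ys = []" for ys by (cases ys) auto
  then show ?thesis unfolding len_def ntl_encode by (auto intro!: Least_equality)
qed

lemma len_exists: "\<exists>l. (ntl ^^ l) c = 0"
proof -
  have "(ntl ^^ length (list_decode c)) (list_encode (list_decode c)) = 0" unfolding ntl_encode by simp
  then show ?thesis by auto
qed

lemma computable_ntl_pow [computable]: "computable f \<Longrightarrow> computable g \<Longrightarrow> computable (\<lambda>x. (ntl ^^ g x) (f x))"
proof (rule computable_funpow)
  have "computable (\<lambda>c. nsnd (c - 1))" by (intro computable)
  then show "computable ntl" by (simp add: ntl_def[abs_def])
qed

lemma computable_entry [computable]: "computable f \<Longrightarrow> computable g \<Longrightarrow> computable (\<lambda>x. entry (f x) (g x))"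
  unfolding entry_def by (intro computable)

lemma computable_len [computable]: "computable f \<Longrightarrow> computable (\<lambda>x. len (f x))"
proof (rule computable_comp[of len])
  show "computable len" unfolding len_def[abs_def]
    by (rule computable_LEAST) (intro computable len_exists)+
qed

lemma encode_ge: "i < length xs \<Longrightarrow> xs ! i \<le> list_encode xs"
proof (induction xs arbitrary: i)
  case (Cons x xs)
  show ?case
  proof (cases i)
    case 0 then show ?thesis using le_prod_encode_1[of x "list_encode xs"] by simp
  next
    case (Suc j)
    then have "xs ! j \<le> list_encode xs" using Cons by simp
    then show ?thesis using Suc le_prod_encode_2[of "list_encode xs" x] by simp
  qed
qed simp

text \<open>
  This reduces algorithms with a fixed number of inputs to computable functions of one argument.
\<close>

lemma list_encode_program: "\<exists>p. \<forall>xs. length xs = n \<longrightarrow> run p xs = Some (list_encode xs)"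
proof -
  have "\<exists>p. \<forall>xs. length xs = n \<longrightarrow> run p xs = Some (list_encode (drop (n - i) xs))" if "i \<le> n" for i
    using that
  proof (induction i)
    case 0 show ?case by (rule exI[of _ Zero]) simp
  next
    case (Suc i)
    then obtain p where p: "\<And>xs. length xs = n \<Longrightarrow> run p xs = Some (list_encode (drop (n - i) xs))" by auto
    have "computable2 (\<lambda>x y. Suc (npair x y))" by (intro computable2_comp[OF computable_Suc] computable2_npair)
    then obtain q where q: "\<And>x y. run q [x, y] = Some (Suc (npair x y))" unfolding computable2_def by blast
    have "run (Comp q [Proj (n - Suc i), p]) xs = Some (list_encode (drop (n - Suc i) xs))" if l: "length xs = n" for xs
    proof -
      have "n - Suc i < length xs" "Suc (n - Suc i) = n - i" using Suc.prems l by auto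
      then show ?thesis using p[OF l] by (simp add: q npair_def Cons_nth_drop_Suc[symmetric])
    qed
    then show ?case by blast
  qed
  from this[of n] show ?thesis by simp
qed

lemma computable_on_lists: assumes "computable F" shows "\<exists>p. \<forall>xs. length xs = n \<longrightarrow> run p xs = Some (F (list_encode xs))"
proof -
  obtain q where q: "\<And>x. run q [x] = Some (F x)" using assms unfolding computable_def by blast
  obtain p where p: "\<And>xs. length xs = n \<Longrightarrow> run p xs = Some (list_encode xs)" using list_encode_program by blast
  have "\<forall>xs. length xs = n \<longrightarrow> run (Comp q [p]) xs = Some (F (list_encode xs))" by (simp add: p q)
  then show ?thesis by blast
qed

section \<open>Recognizing and evaluating codes\<close>

definition x_num :: "nat \<Rightarrow> nat \<Rightarrow> nat" where "x_num c i = nfst (nfst (entry c i))"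
definition x_exp :: "nat \<Rightarrow> nat \<Rightarrow> nat" where "x_exp c i = nsnd (nfst (entry c i))"
definition y_num :: "nat \<Rightarrow> nat \<Rightarrow> nat" where "y_num c i = nfst (nsnd (entry c i))"
definition y_exp :: "nat \<Rightarrow> nat \<Rightarrow> nat" where "y_exp c i = nsnd (nsnd (entry c i))"

text \<open>
  The numerators of the coordinates over the common denominator \<open>2 ^ D\<close>. The exponents of a list
  with code \<open>c\<close> are at most \<open>c\<close>, hence \<open>D \<ge> c\<close> is large enough.
\<close>

definition scaled_x :: "nat \<Rightarrow> nat \<Rightarrow> nat \<Rightarrow> nat" where "scaled_x D c i = x_num c i * 2 ^ (D - x_exp c i)"
definition scaled_y :: "nat \<Rightarrow> nat \<Rightarrow> nat \<Rightarrow> nat" where "scaled_y D c i = y_num c i * 2 ^ (D - y_exp c i)"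

definition decode_desc :: "nat \<Rightarrow> desc" where
  "decode_desc c = map (\<lambda>e. ((nfst (nfst e), nsnd (nfst e)), (nfst (nsnd e), nsnd (nsnd e)))) (list_decode c)"

lemma encode_decode_desc: "encode_description (decode_desc c) = c"
  unfolding encode_description_def decode_desc_def
  by (simp add: comp_def nfst_def nsnd_def)

lemma decode_encode_desc: "decode_desc (encode_description ps) = ps"
  unfolding encode_description_def decode_desc_def
  by (simp add: comp_def nfst_def nsnd_def case_prod_beta)

lemma codes_iff: "codes c f \<longleftrightarrow> describes (decode_desc c) f"
  unfolding codes_def using encode_decode_desc decode_encode_desc by metis

lemma length_decode_desc: "length (decode_desc c) = len c"
  using len_encode[of "list_decode c"] by (simp add: decode_desc_def)

lemma nth_decode_desc: assumes "i < len c" shows "decode_desc c ! i = ((x_num c i, x_exp c i), (y_num c i, y_exp c i))"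
proof -
  have "i < length (list_decode c)" using assms length_decode_desc[of c] by (simp add: decode_desc_def)
  then show ?thesis using entry_encode[of i "list_decode c"] by (simp add: decode_desc_def x_num_def x_exp_def y_num_def y_exp_def)
qed

lemma nfst_le: "nfst w \<le> w" and nsnd_le: "nsnd w \<le> w"
  using le_prod_encode_1[of "nfst w" "nsnd w"] le_prod_encode_2[of "nsnd w" "nfst w"] npair_nfst_nsnd[of w] by (simp_all add: npair_def)

lemma entry_le: "i < len c \<Longrightarrow> entry c i \<le> c"
  using encode_ge[of i "list_decode c"] entry_encode[of i "list_decode c"] len_encode[of "list_decode c"] by simp

lemma depth_bound: assumes "i < len c" shows "x_exp c i \<le> c" "y_exp c i \<le> c"
  unfolding x_exp_def y_exp_def using entry_le[OF assms] nfst_le nsnd_le order.trans by metis+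

lemma exps_le_decode: "exps_le c (decode_desc c)"
  unfolding exps_le_def length_decode_desc using depth_bound nth_decode_desc by simp

lemma codes_homeo: "codes c f \<Longrightarrow> homeo (2 * c) f"
  unfolding codes_iff using describes_homeo exps_le_decode by blast

lemma node_x_scaled: "i < len c \<Longrightarrow> c \<le> D \<Longrightarrow> node_x (decode_desc c) i = real (scaled_x D c i) / 2 ^ D"
  and node_y_scaled: "i < len c \<Longrightarrow> c \<le> D \<Longrightarrow> node_y (decode_desc c) i = real (scaled_y D c i) / 2 ^ D"
proof -
  have scale: "real a / 2 ^ n = real (a * 2 ^ (D - n)) / 2 ^ D" if "n \<le> D" for a n
  proof -
    have "(2::real) ^ D = 2 ^ n * 2 ^ (D - n)" using that by (simp flip: power_add)
    then show ?thesis by simp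
  qed
  show "i < len c \<Longrightarrow> c \<le> D \<Longrightarrow> node_x (decode_desc c) i = real (scaled_x D c i) / 2 ^ D"
    unfolding node_x_def scaled_x_def using nth_decode_desc[of i c] scale[of "x_exp c i" "x_num c i"] depth_bound[of i c] by (simp add: dyadic_def)
  show "i < len c \<Longrightarrow> c \<le> D \<Longrightarrow> node_y (decode_desc c) i = real (scaled_y D c i) / 2 ^ D"
    unfolding node_y_def scaled_y_def using nth_decode_desc[of i c] scale[of "y_exp c i" "y_num c i"] depth_bound[of i c] by (simp add: dyadic_def)
qed

definition valid_code :: "nat \<Rightarrow> bool" where
  "valid_code c \<longleftrightarrow> 0 < len c \<and> scaled_x c c 0 = 0 \<and> scaled_y c c 0 = 0 \<and> scaled_x c c (len c - 1) = 2 ^ c \<and> scaled_y c c (len c - 1) = 2 ^ c \<and>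
     (\<forall>i<len c - 1. scaled_x c c i < scaled_x c c (Suc i) \<and>
        (\<exists>e<Suc c. (scaled_y c c (Suc i) - scaled_y c c i) * 2 ^ e = scaled_x c c (Suc i) - scaled_x c c i \<or>
           scaled_y c c (Suc i) - scaled_y c c i = (scaled_x c c (Suc i) - scaled_x c c i) * 2 ^ e))"

text \<open>
  This turns the condition on slopes into one that is checked with natural numbers: the
  increments are compared after multiplying one of them by a power of 2. Truncated subtraction is
  correct here, as a positive increment of \<open>x\<close> forces one of \<open>y\<close>.
\<close>

lemma slope_iff:
  fixes x x' y y' :: nat assumes "x < x'"
  shows "(\<exists>j. \<bar>j\<bar> \<le> int c \<and> real y' - real y = 2 powi j * (real x' - real x)) \<longleftrightarrow>
    (\<exists>e<Suc c. (y' - y) * 2 ^ e = x' - x \<or> y' - y = (x' - x) * 2 ^ e)" (is "?L \<longleftrightarrow> ?R")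
proof
  assume ?L
  then obtain j where j: "\<bar>j\<bar> \<le> int c" "real y' - real y = 2 powi j * (real x' - real x)" by blast
  have "0 < 2 powi j * (real x' - real x)" using assms by simp
  then have yy: "y < y'" using j(2) by simp
  have eq: "real (y' - y) = 2 powi j * real (x' - x)" using j(2) yy assms by (simp add: of_nat_diff)
  show ?R
  proof (cases "0 \<le> j")
    case True
    then have "real (y' - y) = real ((x' - x) * 2 ^ nat j)" using eq by (simp add: two_powi_nat)
    then have "y' - y = (x' - x) * 2 ^ nat j" by (simp only: of_nat_eq_iff)
    then show ?thesis using j(1) True by (intro exI[of _ "nat j"]) auto
  next
    case False
    define e where "e = nat (- j)"
    have e: "j = - int e" using False by (simp add: e_def)
    have "real (y' - y) * 2 ^ e = real (x' - x)" unfolding eq e by (simp add: power_int_minus)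
    then have "real ((y' - y) * 2 ^ e) = real (x' - x)" by simp
    then have "(y' - y) * 2 ^ e = x' - x" by (simp only: of_nat_eq_iff)
    then show ?thesis using j(1) False by (intro exI[of _ e]) (auto simp: e_def)
  qed
next
  assume ?R
  then obtain e where e: "e \<le> c" "(y' - y) * 2 ^ e = x' - x \<or> y' - y = (x' - x) * 2 ^ e" by (auto simp: less_Suc_eq_le)
  have "0 < x' - x" using assms by simp
  then have yy: "y < y'" using e(2) by (metis mult_eq_0_iff not_gr_zero power_eq_0_iff zero_less_diff zero_neq_numeral)
  from e(2) show ?L
  proof
    assume "(y' - y) * 2 ^ e = x' - x"
    then have "real (y' - y) * 2 ^ e = real (x' - x)" by (metis of_nat_mult of_nat_numeral of_nat_power)
    then have "real y' - real y = 2 powi (- int e) * (real x' - real x)"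
      using yy assms by (simp add: power_int_minus of_nat_diff field_simps)
    then show ?L using e(1) by (intro exI[of _ "- int e"]) auto
  next
    assume "y' - y = (x' - x) * 2 ^ e"
    then have "real (y' - y) = real (x' - x) * 2 ^ e" by simp
    then have "real y' - real y = 2 powi (int e) * (real x' - real x)" using yy assms by (simp add: of_nat_diff)
    then show ?L using e(1) by (intro exI[of _ "int e"]) auto
  qed
qed

lemma valid_code_iff: "valid_code c \<longleftrightarrow> valid_desc c (decode_desc c)"
proof (cases "len c = 0")
  case True then show ?thesis unfolding valid_code_def valid_desc_def using length_decode_desc[of c] by auto
next
  case False
  define ps where "ps = decode_desc c"
  have L: "length ps = len c" unfolding ps_def by (rule length_decode_desc)
  have X: "node_x ps i = real (scaled_x c c i) / 2 ^ c" and Y: "node_y ps i = real (scaled_y c c i) / 2 ^ c" if "i < len c" for i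
    using node_x_scaled[OF that order.refl] node_y_scaled[OF that order.refl] by (simp_all add: ps_def)
  have one: "real n / 2 ^ c = 1 \<longleftrightarrow> n = 2 ^ c" for n
  proof -
    have "real n / 2 ^ c = 1 \<longleftrightarrow> real n = real (2 ^ c)" by (auto simp: field_simps)
    then show ?thesis by (simp only: of_nat_eq_iff)
  qed
  have piece: "(node_x ps i < node_x ps (Suc i) \<and> (\<exists>j. \<bar>j\<bar> \<le> int c \<and> node_y ps (Suc i) - node_y ps i = 2 powi j * (node_x ps (Suc i) - node_x ps i))) \<longleftrightarrow>
      (scaled_x c c i < scaled_x c c (Suc i) \<and>
        (\<exists>e<Suc c. (scaled_y c c (Suc i) - scaled_y c c i) * 2 ^ e = scaled_x c c (Suc i) - scaled_x c c i \<or>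
           scaled_y c c (Suc i) - scaled_y c c i = (scaled_x c c (Suc i) - scaled_x c c i) * 2 ^ e))" if i: "Suc i < len c" for i
  proof -
    have i': "i < len c" using i by simp
    have "node_x ps i < node_x ps (Suc i) \<longleftrightarrow> scaled_x c c i < scaled_x c c (Suc i)" unfolding X[OF i] X[OF i'] by (simp add: divide_less_cancel)
    moreover have "node_y ps (Suc i) - node_y ps i = 2 powi j * (node_x ps (Suc i) - node_x ps i) \<longleftrightarrow>
        real (scaled_y c c (Suc i)) - real (scaled_y c c i) = 2 powi j * (real (scaled_x c c (Suc i)) - real (scaled_x c c i))" for j
      unfolding X[OF i] X[OF i'] Y[OF i] Y[OF i'] by (simp flip: diff_divide_distrib)
    ultimately show ?thesis using slope_iff[of "scaled_x c c i" "scaled_x c c (Suc i)" c "scaled_y c c (Suc i)" "scaled_y c c i"] by auto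
  qed
  have all: "(\<forall>i. Suc i < len c \<longrightarrow> Q i) \<longleftrightarrow> (\<forall>i<len c - 1. Q i)" for Q by (simp add: less_diff_conv)
  have e: "0 < len c" "len c - 1 < len c" using False by auto
  show ?thesis unfolding ps_def[symmetric] valid_desc_def valid_code_def L
    using e piece X[OF e(1)] X[OF e(2)] Y[OF e(1)] Y[OF e(2)] one L by (auto simp: all)
qed

lemma valid_code_codes: "valid_code c \<longleftrightarrow> (\<exists>f. codes c f)"
  unfolding valid_code_iff codes_iff using valid_describes describes_valid exps_le_decode by blast

definition dval :: "nat \<Rightarrow> real" where "dval p = real (nfst p) / 2 ^ nsnd p"

text \<open>
  The first piece whose right end is not to the left of \<open>X / 2 ^ D\<close>. The second disjunct makes the
  search terminate for arbitrary numbers.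
\<close>

definition piece_index :: "nat \<Rightarrow> nat \<Rightarrow> nat \<Rightarrow> nat" where
  "piece_index D c X = (LEAST i. X \<le> scaled_x D c (Suc i) \<or> len c \<le> i)"

definition eval_piece :: "nat \<Rightarrow> nat \<Rightarrow> nat \<Rightarrow> nat \<Rightarrow> nat" where
  "eval_piece D c X i = npair (scaled_y D c i * 2 ^ D + ((X - scaled_x D c i) * 2 ^ D * (scaled_y D c (Suc i) - scaled_y D c i)) div (scaled_x D c (Suc i) - scaled_x D c i)) (2 * D)"

definition eval_code :: "nat \<Rightarrow> nat \<Rightarrow> nat" where
  "eval_code c p = eval_piece (c + nsnd p) c (nfst p * 2 ^ c) (piece_index (c + nsnd p) c (nfst p * 2 ^ c))"

text \<open>
  The value is \<open>y + 2 powi j * (x - x')\<close> for the left end \<open>(x', y)\<close> of the piece. Over the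
  denominator \<open>2 ^ (2 * D)\<close> the division in \<open>eval_piece\<close> is exact, because \<open>2 ^ D * 2 powi j\<close> is
  an integer.
\<close>

lemma eval_code_correct:
  assumes f: "codes c f" and p: "dval p \<le> 1" shows "dval (eval_code c p) = f (dval p)"
proof -
  define ps where "ps = decode_desc c"
  define D where "D = c + nsnd p"
  define X where "X = nfst p * 2 ^ c"
  define i where "i = piece_index D c X"
  have cD: "c \<le> D" by (simp add: D_def)
  have d: "describes ps f" using f by (simp add: codes_iff ps_def)
  note DI = d[unfolded describes_iff]
  have L: "length ps = len c" unfolding ps_def by (rule length_decode_desc)
  have len0: "0 < len c" using DI L by auto
  note sX = node_x_scaled[OF _ cD, folded ps_def] and sY = node_y_scaled[OF _ cD, folded ps_def]
  have x: "dval p = real X / 2 ^ D" by (simp add: dval_def X_def D_def power_add)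
  have le: "real m / 2 ^ D \<le> real n / 2 ^ D \<longleftrightarrow> m \<le> n" for m n by (simp add: divide_le_cancel)
  have ex: "\<exists>i. Suc i < len c \<and> X \<le> scaled_x D c (Suc i)"
  proof (cases "1 < len c")
    case True
    then have l: "Suc (len c - 2) = len c - 1" by simp
    have "node_x ps (len c - 1) = 1" using DI L by simp
    then have "real (scaled_x D c (len c - 1)) / 2 ^ D = 1" using sX[of "len c - 1"] len0 by (metis diff_less zero_less_one)
    then have "real X / 2 ^ D \<le> real (scaled_x D c (len c - 1)) / 2 ^ D" using p x by (simp only:)
    then show ?thesis unfolding le using l True by (intro exI[of _ "len c - 2"]) simp
  next
    case False
    then have "len c - 1 = 0" by simp
    then show ?thesis using DI L by simp
  qed
  then obtain i1 where i1: "Suc i1 < len c" "X \<le> scaled_x D c (Suc i1)" by blast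
  have min: "X \<le> scaled_x D c (Suc i) \<or> len c \<le> i" unfolding i_def piece_index_def by (rule LeastI[of _ i1]) (use i1 in simp)
  have "i \<le> i1" unfolding i_def piece_index_def by (rule Least_le) (use i1 in simp)
  then have i: "Suc i < len c" "i < len c" using i1 by auto
  then have up: "X \<le> scaled_x D c (Suc i)" using min by simp
  have lo: "scaled_x D c i \<le> X"
  proof (cases i)
    case 0
    have "scaled_x D c 0 = 0" using sX[OF len0] DI by simp
    then show ?thesis using 0 by simp
  next
    case (Suc m)
    then have "m < (LEAST i. X \<le> scaled_x D c (Suc i) \<or> len c \<le> i)" using i_def piece_index_def by simp
    then have "\<not> (X \<le> scaled_x D c (Suc m) \<or> len c \<le> m)" by (rule not_less_Least)
    then show ?thesis using Suc by simp
  qed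
  have ii: "Suc i < length ps" using i L by simp
  have dep: "exps_le c ps" using exps_le_decode by (simp add: ps_def)
  obtain j where j: "\<bar>j\<bar> \<le> int c" "node_y ps (Suc i) - node_y ps i = 2 powi j * (node_x ps (Suc i) - node_x ps i)"
    and lt: "node_x ps i < node_x ps (Suc i)" and ylt: "node_y ps i < node_y ps (Suc i)"
    and fx: "\<And>x. node_x ps i \<le> x \<Longrightarrow> x \<le> node_x ps (Suc i) \<Longrightarrow> f x = node_y ps i + 2 powi j * (x - node_x ps i)"
    using describes_piece[OF d dep ii] by metis
  have mem: "node_x ps i \<le> dval p" "dval p \<le> node_x ps (Suc i)" unfolding sX[OF i(1)] sX[OF i(2)] x le using lo up by auto
  note fp = fx[OF mem]
  have "real (scaled_x D c i) / 2 ^ D < real (scaled_x D c (Suc i)) / 2 ^ D" using lt unfolding sX[OF i(1)] sX[OF i(2)] .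
  then have sxl: "scaled_x D c i < scaled_x D c (Suc i)" by (simp add: divide_less_cancel)
  have "real (scaled_y D c i) / 2 ^ D < real (scaled_y D c (Suc i)) / 2 ^ D" using ylt unfolding sY[OF i(1)] sY[OF i(2)] .
  then have syl: "scaled_y D c i < scaled_y D c (Suc i)" by (simp add: divide_less_cancel)
  define a where "a = scaled_x D c (Suc i) - scaled_x D c i"
  define b where "b = scaled_y D c (Suc i) - scaled_y D c i"
  have ra: "real a = 2 ^ D * (node_x ps (Suc i) - node_x ps i)" "real b = 2 ^ D * (node_y ps (Suc i) - node_y ps i)"
    unfolding a_def b_def sX[OF i(1)] sX[OF i(2)] sY[OF i(1)] sY[OF i(2)] using sxl syl by (simp_all add: of_nat_diff field_simps)
  then have ab: "real b = 2 powi j * real a" using j(2) by simp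
  define e where "e = nat (int D + j)"
  have "2 ^ D * (2::real) powi j = 2 powi (int D + j)" by (simp add: two_powi_add)
  also have "\<dots> = 2 ^ e" unfolding e_def using j(1) cD by (intro two_powi_nat) linarith
  finally have e: "2 ^ D * (2::real) powi j = 2 ^ e" .
  have "real (2 ^ D * b) = real (2 ^ e * a)" using ab e by (simp flip: mult.assoc)
  then have "2 ^ D * b = 2 ^ e * a" by (simp only: of_nat_eq_iff)
  then have "(X - scaled_x D c i) * 2 ^ D * b div a = (X - scaled_x D c i) * 2 ^ e"
    using sxl by (simp add: mult.assoc a_def)
  moreover have "eval_code c p = eval_piece D c X i" by (simp add: eval_code_def D_def X_def i_def)
  ultimately have ev: "eval_code c p = npair (scaled_y D c i * 2 ^ D + (X - scaled_x D c i) * 2 ^ e) (2 * D)"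
    unfolding eval_piece_def a_def b_def by simp
  have "dval (eval_code c p) = (real (scaled_y D c i) * 2 ^ D + (real X - real (scaled_x D c i)) * 2 ^ e) / (2 ^ D * 2 ^ D)"
    unfolding ev dval_def using lo by (simp add: of_nat_diff mult_2 power_add)
  also have "\<dots> = real (scaled_y D c i) / 2 ^ D + (real X - real (scaled_x D c i)) * 2 powi j / 2 ^ D"
    unfolding e[symmetric] by (simp add: field_simps)
  also have "\<dots> = real (scaled_y D c i) / 2 ^ D + 2 powi j * (real X / 2 ^ D - real (scaled_x D c i) / 2 ^ D)"
    by (simp add: field_simps)
  also have "\<dots> = f (dval p)" using fp x sX[OF i(2)] sY[OF i(2)] by metis
  finally show ?thesis .
qed

definition same_value :: "nat \<Rightarrow> nat \<Rightarrow> bool" where "same_value p q \<longleftrightarrow> nfst p * 2 ^ nsnd q = nfst q * 2 ^ nsnd p"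

lemma same_value_iff: "same_value p q \<longleftrightarrow> dval p = dval q"
proof -
  have "dval p = dval q \<longleftrightarrow> real (nfst p * 2 ^ nsnd q) = real (nfst q * 2 ^ nsnd p)" unfolding dval_def by (simp add: frac_eq_eq)
  then show ?thesis unfolding same_value_def by (simp only: of_nat_eq_iff)
qed

lemma codes_in: "codes c f \<Longrightarrow> x \<in> {0..1} \<Longrightarrow> f x \<in> {0..1}"
  using codes_homeo homeo_in by blast

text \<open>
  Two maps of level \<open>K\<close> are affine on each cell, hence equal if they agree at the ends of the cells.
\<close>

lemma level_eqI:
  assumes f: "homeo K f" and g: "homeo K g" and eq: "\<And>a. a \<le> 2 ^ K \<Longrightarrow> f (real a / 2 ^ K) = g (real a / 2 ^ K)"
    and x: "x \<in> {0..1}" shows "f x = g x"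
proof (cases "x = 1")
  case True then show ?thesis using f g by (simp add: homeo_def)
next
  case False
  define i where "i = \<lfloor>x * 2 ^ K\<rfloor>"
  have x1: "0 \<le> x" "x < 1" using x False by auto
  have i0: "0 \<le> i" and i1: "i + 1 \<le> 2 ^ K" using unit_cell(1,2)[OF x1] by (simp_all add: i_def)
  define l r where "l = of_int i / (2 ^ K :: real)" and "r = of_int (i + 1) / (2 ^ K :: real)"
  have n: "nat i \<le> 2 ^ K" "nat (i + 1) \<le> 2 ^ K" using i1 i0 by (auto simp: nat_le_iff)
  have lr: "l = real (nat i) / 2 ^ K" "r = real (nat (i + 1)) / 2 ^ K" using i0 by (simp_all add: l_def r_def)
  have "l < r" unfolding l_def r_def by (simp add: divide_strict_right_mono)
  then have m: "l \<in> {0..1}" "r \<in> {0..1}" "l \<noteq> r" using unit_cell(3,4)[OF x1, of K] by (simp_all add: l_def r_def i_def)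
  have ic: "in_cell K i l" "in_cell K i r" "in_cell K i x" unfolding i_def[symmetric]
    by (simp_all add: in_cell_def l_def r_def i_def)
  obtain j c where 1: "\<And>x. x \<in> {0..1} \<Longrightarrow> in_cell K i x \<Longrightarrow> f x = 2 powi j * x + c" using levelE[OF homeo_level[OF f]] by metis
  obtain j' c' where 2: "\<And>x. x \<in> {0..1} \<Longrightarrow> in_cell K i x \<Longrightarrow> g x = 2 powi j' * x + c'" using levelE[OF homeo_level[OF g]] by metis
  have "f l = g l" "f r = g r" unfolding lr using eq n by auto
  then have "j = j'" "c = c'" using affine_unique[OF m(3), of j c j' c'] 1[OF m(1) ic(1)] 1[OF m(2) ic(2)] 2[OF m(1) ic(1)] 2[OF m(2) ic(2)] by auto
  then show ?thesis using 1[OF x ic(3)] 2[OF x ic(3)] by simp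
qed

text \<open>
  The number \<open>x\<close> is the code of the list of inputs: the first \<open>k\<close> entries are codes of \<open>y\<^sub>1, \<dots>, y\<^sub>k\<close>,
  the others are codes of \<open>z\<^sub>1, \<dots>, z\<^sub>k\<close>. These codes are at most \<open>x\<close>, so both sides of each
  equation have level \<open>4 * (c + x)\<close>, and it suffices to compare them on the grid of this level.
\<close>

definition conjugator_code :: "nat \<Rightarrow> nat \<Rightarrow> nat \<Rightarrow> bool" where
  "conjugator_code k c x \<longleftrightarrow> valid_code c \<and> (\<forall>i<k. \<forall>a<Suc (2 ^ (4 * (c + x))).
     same_value (eval_code (entry x i) (eval_code c (npair a (4 * (c + x))))) (eval_code c (eval_code (entry x (k + i)) (npair a (4 * (c + x))))))"

lemma commute_check:
  assumes g: "codes c g" and y: "codes u y" and z: "codes v z" and le: "u \<le> x" "v \<le> x"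
  shows "(\<forall>a<Suc (2 ^ (4 * (c + x))). same_value (eval_code u (eval_code c (npair a (4 * (c + x))))) (eval_code c (eval_code v (npair a (4 * (c + x)))))) \<longleftrightarrow>
    (\<forall>t\<in>{0..1}. y (g t) = g (z t))"
proof -
  define K where "K = 4 * (c + x)"
  have ev: "dval (eval_code u (eval_code c (npair a K))) = y (g (real a / 2 ^ K))" "dval (eval_code c (eval_code v (npair a K))) = g (z (real a / 2 ^ K))"
    and mem: "real a / 2 ^ K \<in> {0..1}" if "a \<le> 2 ^ K" for a
  proof -
    have "real a \<le> real (2 ^ K)" using that by (simp only: of_nat_le_iff)
    then show m: "real a / 2 ^ K \<in> {0..1}" by simp
    have d: "dval (npair a K) = real a / 2 ^ K" by (simp add: dval_def)
    have "dval (eval_code c (npair a K)) = g (real a / 2 ^ K)" using eval_code_correct[OF g, of "npair a K"] m d by simp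
    then show "dval (eval_code u (eval_code c (npair a K))) = y (g (real a / 2 ^ K))" using eval_code_correct[OF y, of "eval_code c (npair a K)"] codes_in[OF g m] by simp
    have "dval (eval_code v (npair a K)) = z (real a / 2 ^ K)" using eval_code_correct[OF z, of "npair a K"] m d by simp
    then show "dval (eval_code c (eval_code v (npair a K))) = g (z (real a / 2 ^ K))" using eval_code_correct[OF g, of "eval_code v (npair a K)"] codes_in[OF z m] by simp
  qed
  have h1: "homeo K (\<lambda>t. y (g t))" by (rule homeo_mono[OF homeo_comp[OF codes_homeo[OF g] codes_homeo[OF y]]]) (use le in \<open>simp add: K_def\<close>)
  have h2: "homeo K (\<lambda>t. g (z t))" by (rule homeo_mono[OF homeo_comp[OF codes_homeo[OF z] codes_homeo[OF g]]]) (use le in \<open>simp add: K_def\<close>)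
  have "(\<forall>a<Suc (2 ^ K). same_value (eval_code u (eval_code c (npair a K))) (eval_code c (eval_code v (npair a K)))) \<longleftrightarrow>
      (\<forall>a\<le>2 ^ K. y (g (real a / 2 ^ K)) = g (z (real a / 2 ^ K)))"
    unfolding same_value_iff using ev by (simp add: less_Suc_eq_le)
  also have "\<dots> \<longleftrightarrow> (\<forall>t\<in>{0..1}. y (g t) = g (z t))" using level_eqI[OF h1 h2] mem by blast
  finally show ?thesis unfolding K_def .
qed

section \<open>Searching for conjugators\<close>

lemma conjugators_iff:
  assumes ys: "set ys \<subseteq> thompson_F" and zs: "set zs \<subseteq> thompson_F"
  shows "g \<in> conjugators thompson_group ys zs \<longleftrightarrow>
    g \<in> thompson_F \<and> list_all2 (\<lambda>y z. \<forall>t\<in>{0..1}. y (g t) = g (z t)) ys zs"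
proof -
  interpret G: group thompson_group by (rule group_thompson_group)
  have carr: "carrier thompson_group = thompson_F" by (simp add: thompson_group_def)
  have mult: "a \<otimes>\<^bsub>thompson_group\<^esub> b = compose {0..1} a b" if "a \<in> thompson_F" "b \<in> thompson_F" for a b
    using that thompson_F_Bij by (simp add: thompson_group_def BijGroup_def)
  have key: "inv\<^bsub>thompson_group\<^esub> g \<otimes>\<^bsub>thompson_group\<^esub> y \<otimes>\<^bsub>thompson_group\<^esub> g = z \<longleftrightarrow> (\<forall>t\<in>{0..1}. y (g t) = g (z t))"
    if F: "g \<in> thompson_F" "y \<in> thompson_F" "z \<in> thompson_F" for y z
  proof -
    have c: "g \<in> carrier thompson_group" "y \<in> carrier thompson_group" "z \<in> carrier thompson_group" using F carr by auto
    have "inv\<^bsub>thompson_group\<^esub> g \<otimes>\<^bsub>thompson_group\<^esub> y \<otimes>\<^bsub>thompson_group\<^esub> g = z \<longleftrightarrow> y \<otimes>\<^bsub>thompson_group\<^esub> g = g \<otimes>\<^bsub>thompson_group\<^esub> z"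
      using c by (metis G.inv_closed G.inv_solve_left G.m_assoc G.m_closed)
    also have "\<dots> \<longleftrightarrow> compose {0..1} y g = compose {0..1} g z" using F mult by simp
    also have "\<dots> \<longleftrightarrow> (\<forall>t\<in>{0..1}. y (g t) = g (z t))"
    proof
      assume "compose {0..1} y g = compose {0..1} g z"
      then have "compose {0..1} y g t = compose {0..1} g z t" for t by simp
      then show "\<forall>t\<in>{0..1}. y (g t) = g (z t)" by (metis compose_eq)
    next
      assume "\<forall>t\<in>{0..1}. y (g t) = g (z t)"
      then show "compose {0..1} y g = compose {0..1} g z" by (auto simp: compose_def)
    qed
    finally show ?thesis .
  qed
  show ?thesis unfolding conjugators_def carr using key ys zs
    by (auto simp: list_all2_conv_all_nth subset_iff)
qed

lemma npair_mono: "a \<le> a' \<Longrightarrow> b \<le> b' \<Longrightarrow> npair a b \<le> npair a' b'"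
  unfolding npair_def prod_encode_def by (simp add: add_mono triangle_mono)

definition code_bound :: "nat \<Rightarrow> nat" where
  "code_bound B = rec_nat 0 (\<lambda>m r. Suc (npair (npair (npair (2 ^ B) B) (npair (2 ^ (2 * B)) (2 * B))) r)) (Suc (2 ^ B))"

text \<open>
  The bound belongs to the list of the same length all of whose entries are \<open>E\<close>, since the pairing
  function is monotone.
\<close>

lemma list_encode_bound:
  assumes "\<forall>e\<in>set xs. e \<le> E" shows "list_encode xs \<le> rec_nat 0 (\<lambda>m r. Suc (npair E r)) (length xs)"
  using assms by (induction xs) (auto intro!: npair_mono simp flip: npair_def)

text \<open>
  A map of level \<open>B\<close> is described by its values on the grid of level \<open>B\<close>; these values have the
  denominator \<open>2 ^ (2 * B)\<close>.
\<close>

lemma homeo_code: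
  assumes h: "homeo B h"
  shows "\<exists>c\<le>code_bound B. codes c (restrict h {0..1})"
proof -
  define v where "v i = nat \<lfloor>h (real i / 2 ^ B) * 2 ^ (2 * B)\<rfloor>" for i :: nat
  define ps where "ps = map (\<lambda>i. ((i, B), (v i, 2 * B))) [0..<Suc (2 ^ B)]"
  note L = homeo_level[OF h]
  have len: "length ps = Suc (2 ^ B)" by (simp add: ps_def)
  have nth: "ps ! i = ((i, B), (v i, 2 * B))" if "i \<le> 2 ^ B" for i
    using that unfolding ps_def by (subst nth_map) (simp_all del: upt_Suc)
  have X: "node_x ps i = real i / 2 ^ B" if "i \<le> 2 ^ B" for i using nth[OF that] by (simp add: node_x_def dyadic_def)
  have mem: "real i / 2 ^ B \<in> {0..1}" if "i \<le> 2 ^ B" for i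
  proof -
    have "real i \<le> real (2 ^ B)" using that by (simp only: of_nat_le_iff)
    then show ?thesis by simp
  qed
  have v: "real (v i) = h (real i / 2 ^ B) * 2 ^ (2 * B)" "v i \<le> 2 ^ (2 * B)" if i: "i \<le> 2 ^ B" for i
  proof -
    define x where "x = real i / 2 ^ B"
    have x: "x \<in> {0..1}" unfolding x_def by (rule mem[OF i])
    obtain j c where j: "\<bar>j\<bar> \<le> int B" "c \<in> grid B" "h x = 2 powi j * x + c"
      using levelE[OF L] in_cell_floor x by metis
    have "x \<in> grid B" unfolding x_def using grid_frac[of "int i" B] by simp
    then have "2 powi j * x \<in> grid (B + B)" by (rule grid_powi) (use j in auto)
    then have "h x \<in> grid (2 * B)" unfolding j(3) mult_2 using grid_mono[OF j(2), of "B + B"] by (intro grid_add) auto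
    then have int: "h x * 2 ^ (2 * B) \<in> \<int>" by (rule gridD)
    have hx: "0 \<le> h x" "h x \<le> 1" using homeo_in[OF h x] by auto
    have fl: "of_int \<lfloor>h x * 2 ^ (2 * B)\<rfloor> = h x * 2 ^ (2 * B)" using int by (rule of_int_floor)
    have "0 \<le> \<lfloor>h x * 2 ^ (2 * B)\<rfloor>" using hx by simp
    then have rv: "real (v i) = h x * 2 ^ (2 * B)" unfolding v_def x_def[symmetric] using fl by simp
    then show "real (v i) = h (real i / 2 ^ B) * 2 ^ (2 * B)" by (simp add: x_def)
    have "h x * 2 ^ (2 * B) \<le> 1 * 2 ^ (2 * B)" using hx by (intro mult_right_mono) auto
    then have "real (v i) \<le> real (2 ^ (2 * B))" using rv by simp
    then show "v i \<le> 2 ^ (2 * B)" by (simp only: of_nat_le_iff)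
  qed
  have Y: "node_y ps i = h (real i / 2 ^ B)" if "i \<le> 2 ^ B" for i
    using nth[OF that] v(1)[OF that] by (simp add: node_y_def dyadic_def)
  have "describes ps (restrict h {0..1})"
    unfolding describes_iff
  proof (intro conjI allI impI)
    show "restrict h {0..1} \<in> thompson_F" by (rule homeo_thompson_F[OF h])
    show "ps \<noteq> []" using len by auto
    show "node_x ps 0 = 0" "node_x ps (length ps - 1) = 1" using X[of 0] X[of "2 ^ B"] len by simp_all
    fix i
    show "i < length ps \<Longrightarrow> restrict h {0..1} (node_x ps i) = node_y ps i" using X[of i] Y[of i] mem[of i] len by simp
    assume i: "Suc i < length ps"
    then have i': "i \<le> 2 ^ B" "Suc i \<le> 2 ^ B" using len by auto
    show "node_x ps i < node_x ps (Suc i)" unfolding X[OF i'(1)] X[OF i'(2)] by (simp add: divide_strict_right_mono)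
    obtain j c where jc: "\<And>x. x \<in> {0..1} \<Longrightarrow> in_cell B (int i) x \<Longrightarrow> h x = 2 powi j * x + c" using levelE[OF L] by metis
    have "restrict h {0..1} x = 2 powi j * x + c" if x: "x \<in> {node_x ps i..node_x ps (Suc i)}" for x
    proof -
      have "x \<in> {0..1}" using x mem[OF i'(1)] mem[OF i'(2)] unfolding X[OF i'(1)] X[OF i'(2)] atLeastAtMost_iff by linarith
      moreover have "in_cell B (int i) x" using x unfolding X[OF i'(1)] X[OF i'(2)] in_cell_iff by (simp add: add.commute)
      ultimately show ?thesis using jc by simp
    qed
    then show "affine_piece (restrict h {0..1}) (node_x ps i) (node_x ps (Suc i))" unfolding affine_piece_def by blast
  qed
  then have "codes (encode_description ps) (restrict h {0..1})" unfolding codes_def by blast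
  moreover have "encode_description ps \<le> code_bound B"
  proof -
    define E where "E = npair (npair (2 ^ B) B) (npair (2 ^ (2 * B)) (2 * B))"
    let ?xs = "map (\<lambda>(p, q). prod_encode (prod_encode p, prod_encode q)) ps"
    have "e \<le> E" if "e \<in> set ?xs" for e
    proof -
      obtain i where i: "i < length ps" "e = (\<lambda>(p, q). prod_encode (prod_encode p, prod_encode q)) (ps ! i)"
        using \<open>e \<in> set ?xs\<close> by (auto simp: in_set_conv_nth)
      then have i': "i \<le> 2 ^ B" using len by simp
      have "e = npair (npair i B) (npair (v i) (2 * B))" using i(2) nth[OF i'] by (simp add: npair_def)
      then show ?thesis unfolding E_def using npair_mono i' v(2)[OF i'] by simp
    qed
    then have "list_encode ?xs \<le> rec_nat 0 (\<lambda>m r. Suc (npair E r)) (length ?xs)" by (intro list_encode_bound) blast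
    then show ?thesis unfolding encode_description_def code_bound_def E_def length_map len .
  qed
  ultimately show ?thesis by blast
qed

text \<open>
  A code \<open>u\<close> bounds the level of its map by \<open>2 * u\<close> and the level of the inverse by \<open>4 * u\<close>, so
  \<open>bounded_conjugator\<close> applies with \<open>N = 4 * x + 1\<close> to the given pairs together with their inverses.
\<close>

lemma bounded_conjugator_code:
  assumes ys: "\<And>i. i < k \<Longrightarrow> codes (u i) (ys ! i) \<and> u i \<le> x" and zs: "\<And>i. i < k \<Longrightarrow> codes (v i) (zs ! i) \<and> v i \<le> x"
    and g: "g \<in> thompson_F" "\<And>i t. i < k \<Longrightarrow> t \<in> {0..1} \<Longrightarrow> (ys ! i) (g t) = g ((zs ! i) t)"
  shows "\<exists>c\<le>code_bound (conjugator_bound (4 * x + 1)). \<exists>h. codes c h \<and> (\<forall>i<k. \<forall>t\<in>{0..1}. (ys ! i) (h t) = h ((zs ! i) t))"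
proof -
  let ?N = "4 * x + 1"
  define iv where "iv f = inv_into {0..1} f" for f :: "real \<Rightarrow> real"
  \<comment> \<open>\<open>bounded_conjugator\<close> needs a family that is closed under inverses\<close>
  define R where "R = (\<Union>i<k. {(zs ! i, ys ! i), (iv (zs ! i), iv (ys ! i))})"
  have hom2: "homeo (2 * x) (ys ! i)" "homeo (2 * x) (zs ! i)" if "i < k" for i
    using ys[OF that] zs[OF that] homeo_mono[OF codes_homeo] by (meson mult_le_mono2)+
  have inv: "iv f (f t) = t" "f (iv f t) = t" "iv f t \<in> {0..1}" if f: "homeo (2 * x) f" and t: "t \<in> {0..1}" for f t
  proof -
    have "inj_on f {0..1}" using level_eq_iff[OF homeo_level[OF f]] by (auto intro: inj_onI)
    then show "iv f (f t) = t" using t by (simp add: iv_def)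
    have "t \<in> f ` {0..1}" using homeo_image[OF f] t by simp
    then show "f (iv f t) = t" "iv f t \<in> {0..1}" unfolding iv_def by (rule f_inv_into_f, rule inv_into_into)
  qed
  have hominv: "homeo (4 * x) (iv f)" if f: "homeo (2 * x) f" for f
    using homeo_inverse[OF f, of "iv f"] inv[OF f] by (simp add: mult.assoc[symmetric])
  interpret conjugacy ?N R
  proof
    show "1 \<le> ?N" by simp
    show "homeo ?N z \<and> homeo ?N y" if "(z, y) \<in> R" for z y
    proof -
      obtain i where i: "i < k" "(z, y) = (zs ! i, ys ! i) \<or> (z, y) = (iv (zs ! i), iv (ys ! i))" using \<open>(z, y) \<in> R\<close> unfolding R_def by auto
      note h = hom2[OF i(1)]
      have le: "2 * x \<le> ?N" "4 * x \<le> ?N" by simp_all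
      show ?thesis using i(2) homeo_mono[OF h(1) le(1)] homeo_mono[OF h(2) le(1)] homeo_mono[OF hominv[OF h(1)] le(2)] homeo_mono[OF hominv[OF h(2)] le(2)]
        by (elim disjE) (simp_all only: prod.inject simp_thms)
    qed
    show "\<exists>z' y'. (z', y') \<in> R \<and> (\<forall>x\<in>{0..1}. z' (z x) = x \<and> z (z' x) = x \<and> y' (y x) = x \<and> y (y' x) = x)" if zy: "(z, y) \<in> R" for z y
    proof -
      obtain i where i: "i < k" "(z, y) = (zs ! i, ys ! i) \<or> (z, y) = (iv (zs ! i), iv (ys ! i))" using zy unfolding R_def by auto
      have "(zs ! i, ys ! i) \<in> R" "(iv (zs ! i), iv (ys ! i)) \<in> R" using i(1) unfolding R_def by auto
      note mem = this
      note iy = inv(1,2)[OF hom2(1)[OF i(1)]] and iz = inv(1,2)[OF hom2(2)[OF i(1)]]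
      from i(2) show ?thesis
      proof
        assume "(z, y) = (zs ! i, ys ! i)"
        then show ?thesis using mem(2) iy iz by (intro exI[of _ "iv (zs ! i)"] exI[of _ "iv (ys ! i)"]) simp
      next
        assume "(z, y) = (iv (zs ! i), iv (ys ! i))"
        then show ?thesis using mem(1) iy iz by (intro exI[of _ "zs ! i"] exI[of _ "ys ! i"]) simp
      qed
    qed
  qed
  obtain c0 where "codes c0 g" using thompson_F_has_code[OF g(1)] by blast
  then have hg: "homeo (2 * c0) g" by (rule codes_homeo)
  have "y (g t) = g (z t)" if zy: "(z, y) \<in> R" and t: "t \<in> {0..1}" for z y t
  proof -
    obtain i where i: "i < k" "(z, y) = (zs ! i, ys ! i) \<or> (z, y) = (iv (zs ! i), iv (ys ! i))" using zy unfolding R_def by auto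
    note iy = inv[OF hom2(1)[OF i(1)]] and iz = inv[OF hom2(2)[OF i(1)]]
    show ?thesis
    proof (cases "(z, y) = (zs ! i, ys ! i)")
      case True then show ?thesis using g(2)[OF i(1) t] by simp
    next
      case False
      then have e: "z = iv (zs ! i)" "y = iv (ys ! i)" using i(2) by auto
      have s: "iv (zs ! i) t \<in> {0..1}" by (rule iz(3)[OF t])
      have "(ys ! i) (g (iv (zs ! i) t)) = g t" using g(2)[OF i(1) s] iz(2)[OF t] by simp
      then have "iv (ys ! i) (g t) = iv (ys ! i) ((ys ! i) (g (iv (zs ! i) t)))" by simp
      also have "\<dots> = g (iv (zs ! i) t)" by (rule iy(1)[OF homeo_in[OF hg s]])
      finally show ?thesis unfolding e .
    qed
  qed
  then have "conjugates R g" unfolding conjugates_def using hg by blast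
  from bounded_conjugator[OF this] obtain h where h: "homeo (conjugator_bound ?N) h" "\<And>z y t. (z, y) \<in> R \<Longrightarrow> t \<in> {0..1} \<Longrightarrow> y (h t) = h (z t)"
    by blast
  obtain c where c: "c \<le> code_bound (conjugator_bound ?N)" "codes c (restrict h {0..1})" using homeo_code[OF h(1)] by blast
  have "(ys ! i) (restrict h {0..1} t) = restrict h {0..1} ((zs ! i) t)" if i: "i < k" and t: "t \<in> {0..1}" for i t
  proof -
    have "(zs ! i, ys ! i) \<in> R" using i unfolding R_def by auto
    then show ?thesis using h(2) t homeo_in[OF hom2(2)[OF i] t] by simp
  qed
  then show ?thesis using c by blast
qed

lemma computable_scaled [computable]:
  assumes "computable D" "computable c" "computable i"
  shows "computable (\<lambda>x. scaled_x (D x) (c x) (i x))" "computable (\<lambda>x. scaled_y (D x) (c x) (i x))"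
  unfolding scaled_x_def scaled_y_def x_num_def x_exp_def y_num_def y_exp_def by (intro computable assms)+

lemma computable_piece_index [computable]:
  assumes "computable D" "computable c" "computable X" shows "computable (\<lambda>x. piece_index (D x) (c x) (X x))"
  unfolding piece_index_def
proof (rule computable_LEAST)
  show "\<exists>i. X x \<le> scaled_x (D x) (c x) (Suc i) \<or> len (c x) \<le> i" for x by (rule exI[of _ "len (c x)"]) simp
qed (intro computable computable_comp[OF assms(1)] computable_comp[OF assms(2)] computable_comp[OF assms(3)])

lemma computable_eval_code [computable]:
  assumes "computable c" "computable p" shows "computable (\<lambda>x. eval_code (c x) (p x))"
  unfolding eval_code_def eval_piece_def by (intro computable assms)

lemma decidable_valid_code: "decidable valid_code"
  unfolding valid_code_def[abs_def] by (intro computable decidable_ball decidable_bex)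

lemma decidable_conjugator_code: "decidable (\<lambda>w. conjugator_code k (nfst w) (nsnd w))"
  unfolding conjugator_code_def same_value_def by (intro computable decidable_ball decidable_comp[OF decidable_valid_code])

lemma computable_conjugator_bound: "computable conjugator_bound"
proof -
  have "computable (\<lambda>N. rec_nat (N + slope_bound N) (\<lambda>m r. spread N r) (Suc (2 ^ N)))"
    unfolding spread_def slope_bound_def by (rule computable_rec_nat) (intro computable)+
  moreover have "rec_nat s (\<lambda>m r. f r) n = (f ^^ n) s" for s n and f :: "nat \<Rightarrow> nat" by (induction n) auto
  ultimately have "computable (\<lambda>N. (spread N ^^ Suc (2 ^ N)) (N + slope_bound N))" by simp
  from computable_comp2[OF computable2_add this, of "\<lambda>N. 2 * N + 2 * 2 ^ N"]
  show ?thesis unfolding conjugator_bound_def[abs_def] by (simp add: computable)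
qed

lemma computable_code_bound: "computable code_bound"
  unfolding code_bound_def[abs_def] by (rule computable_rec_nat) (intro computable)+

definition search_bound :: "nat \<Rightarrow> nat" where
  "search_bound x = Suc (code_bound (conjugator_bound (4 * x + 1)))"

definition conjugate_code :: "nat \<Rightarrow> nat \<Rightarrow> bool" where
  "conjugate_code k x \<longleftrightarrow> (\<exists>c<search_bound x. conjugator_code k c x)"

text \<open>
  The \<open>n\<close>-th output is \<open>n\<close> itself if it is the code of a conjugator, and the least such code
  otherwise. The second disjunct only ensures that the search terminates on all numbers.
\<close>

definition enumerate_code :: "nat \<Rightarrow> nat \<Rightarrow> nat \<Rightarrow> nat" where
  "enumerate_code k n x = (if \<not> conjugate_code k x then 0 else if conjugator_code k n x then Suc n
     else Suc (LEAST c. conjugator_code k c x \<or> \<not> conjugate_code k x))"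

lemma decidable_conjugate_code: "decidable (conjugate_code k)"
proof -
  have "computable search_bound" unfolding search_bound_def[abs_def]
    by (intro computable computable_comp[OF computable_code_bound] computable_comp[OF computable_conjugator_bound])
  then show ?thesis unfolding conjugate_code_def[abs_def] by (intro decidable_bex decidable_conjugator_code)
qed

lemma computable_enumerate_code: "computable (\<lambda>w. enumerate_code k (nfst w) (nsnd w))"
proof -
  note C = decidable_comp[OF decidable_conjugate_code]
  have L: "computable (\<lambda>x. LEAST c. conjugator_code k c x \<or> \<not> conjugate_code k x)"
  proof (rule computable_LEAST)
    show "decidable (\<lambda>w. conjugator_code k (nfst w) (nsnd w) \<or> \<not> conjugate_code k (nsnd w))" by (intro computable decidable_conjugator_code C)
    show "\<exists>c. conjugator_code k c x \<or> \<not> conjugate_code k x" for x unfolding conjugate_code_def by blast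
  qed
  show ?thesis unfolding enumerate_code_def by (intro computable C decidable_conjugator_code computable_comp[OF L])
qed

lemma instance_conjugator_code:
  assumes I: "instance_codes codes k cs ys zs"
  shows "conjugator_code k c (list_encode cs) \<longleftrightarrow> (\<exists>g\<in>conjugators thompson_group ys zs. codes c g)"
    and "conjugate_code k (list_encode cs) \<longleftrightarrow> conjugators thompson_group ys zs \<noteq> {}"
proof -
  define x where "x = list_encode cs"
  have l: "length ys = k" "length zs = k" and cd: "list_all2 codes cs (ys @ zs)" using I by (auto simp: instance_codes_def)
  have lc: "length cs = 2 * k" using list_all2_lengthD[OF cd] l by simp
  have nth: "codes (cs ! i) ((ys @ zs) ! i)" if "i < 2 * k" for i using list_all2_nthD[OF cd] lc that by simp
  have cy: "codes (entry x i) (ys ! i)" "codes (entry x (k + i)) (zs ! i)" and ule: "entry x i \<le> x" "entry x (k + i) \<le> x" if i: "i < k" for i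
  proof -
    have e: "entry x i = cs ! i" "entry x (k + i) = cs ! (k + i)" unfolding x_def using i lc by (simp_all add: entry_encode)
    show "codes (entry x i) (ys ! i)" "codes (entry x (k + i)) (zs ! i)" unfolding e using nth[of i] nth[of "k + i"] i l by (simp_all add: nth_append)
    have "cs ! i \<le> x" "cs ! (k + i) \<le> x" unfolding x_def using encode_ge i lc by simp_all
    then show "entry x i \<le> x" "entry x (k + i) \<le> x" unfolding e .
  qed
  have F: "f \<in> thompson_F" if "codes d f" for d f using that unfolding codes_iff describes_iff by blast
  have "ys ! i \<in> thompson_F" "zs ! i \<in> thompson_F" if "i < k" for i using F cy[OF that] by blast+
  then have sub: "set ys \<subseteq> thompson_F" "set zs \<subseteq> thompson_F" using l by (auto simp: in_set_conv_nth)
  have conj: "g \<in> conjugators thompson_group ys zs \<longleftrightarrow> g \<in> thompson_F \<and> (\<forall>i<k. \<forall>t\<in>{0..1}. (ys ! i) (g t) = g ((zs ! i) t))" for g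
    unfolding conjugators_iff[OF sub] list_all2_conv_all_nth l by blast
  have conjugator_code: "conjugator_code k c x \<longleftrightarrow> (\<exists>g\<in>conjugators thompson_group ys zs. codes c g)" for c
  proof
    assume G: "conjugator_code k c x"
    then obtain g where g: "codes c g" unfolding conjugator_code_def valid_code_codes by blast
    have "\<forall>i<k. \<forall>t\<in>{0..1}. (ys ! i) (g t) = g ((zs ! i) t)"
      using G commute_check[OF g cy ule] unfolding conjugator_code_def by blast
    then show "\<exists>g\<in>conjugators thompson_group ys zs. codes c g" using conj F[OF g] g by blast
  next
    assume "\<exists>g\<in>conjugators thompson_group ys zs. codes c g"
    then obtain g where g: "codes c g" "\<forall>i<k. \<forall>t\<in>{0..1}. (ys ! i) (g t) = g ((zs ! i) t)" using conj by blast
    then show "conjugator_code k c x" using commute_check[OF g(1) cy ule] unfolding conjugator_code_def valid_code_codes by blast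
  qed
  then show "conjugator_code k c (list_encode cs) \<longleftrightarrow> (\<exists>g\<in>conjugators thompson_group ys zs. codes c g)" by (simp add: x_def)
  have "\<exists>c<search_bound x. conjugator_code k c x" if g: "g \<in> conjugators thompson_group ys zs" for g
  proof -
    have gF: "g \<in> thompson_F" "\<And>i t. i < k \<Longrightarrow> t \<in> {0..1} \<Longrightarrow> (ys ! i) (g t) = g ((zs ! i) t)" using g conj by blast+
    obtain c h where c: "c \<le> code_bound (conjugator_bound (4 * x + 1))" "codes c h" "\<forall>i<k. \<forall>t\<in>{0..1}. (ys ! i) (h t) = h ((zs ! i) t)"
      using bounded_conjugator_code[of k "\<lambda>i. entry x i" ys x "\<lambda>i. entry x (k + i)" zs, OF _ _ gF] cy ule by blast
    then have "conjugator_code k c x" using conjugator_code conj F[OF c(2)] by blast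
    then show ?thesis using c(1) unfolding search_bound_def by (auto simp: less_Suc_eq_le)
  qed
  then show "conjugate_code k (list_encode cs) \<longleftrightarrow> conjugators thompson_group ys zs \<noteq> {}"
    unfolding conjugate_code_def x_def[symmetric] using conjugator_code by blast
qed

theorem theorem1p1:
  fixes k :: nat
  shows "(\<exists>p. decides_simultaneous_conjugacy thompson_group codes k p) \<and>
         (\<exists>p. solves_and_enumerates_simultaneous_conjugacy thompson_group codes k p)"
proof
  have len: "length cs = 2 * k" if "instance_codes codes k cs ys zs" for cs ys zs
    using that list_all2_lengthD unfolding instance_codes_def by fastforce
  obtain p where p: "\<And>cs. length cs = 2 * k \<Longrightarrow> run p cs = Some (if conjugate_code k (list_encode cs) then 1 else 0)"
    using computable_on_lists[OF decidable_conjugate_code[unfolded decidable_def]] by metis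
  have "run p cs = Some (if conjugators thompson_group ys zs = {} then 0 else 1)"
    if I: "instance_codes codes k cs ys zs" for cs ys zs
    using p[OF len[OF I]] instance_conjugator_code(2)[OF I] by simp
  then show "\<exists>p. decides_simultaneous_conjugacy thompson_group codes k p"
    unfolding decides_simultaneous_conjugacy_def by blast
  have "computable (\<lambda>w. enumerate_code k (nfst (w - 1)) (nsnd (w - 1)))"
    by (rule computable_comp[OF computable_enumerate_code, of "\<lambda>w. w - 1"]) (intro computable)
  then obtain q where q: "\<And>xs. length xs = Suc (2 * k) \<Longrightarrow>
      run q xs = Some (enumerate_code k (nfst (list_encode xs - 1)) (nsnd (list_encode xs - 1)))"
    using computable_on_lists by blast
  have run_q: "run q (n # cs) = Some (enumerate_code k n (list_encode cs))" if "instance_codes codes k cs ys zs" for n cs ys zs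
    using q[of "n # cs"] len[OF that] by (simp flip: npair_def)
  have "if conjugators thompson_group ys zs = {} then \<forall>n. run q (n # cs) = Some 0
     else (\<forall>n. \<exists>c. \<exists>g\<in>conjugators thompson_group ys zs. run q (n # cs) = Some (Suc c) \<and> codes c g) \<and>
          (\<forall>g\<in>conjugators thompson_group ys zs. \<exists>n c. run q (n # cs) = Some (Suc c) \<and> codes c g)"
    if I: "instance_codes codes k cs ys zs" for cs ys zs
  proof (cases "conjugators thompson_group ys zs = {}")
    case True
    then have "\<not> conjugate_code k (list_encode cs)" using instance_conjugator_code(2)[OF I] by simp
    then show ?thesis using True run_q[OF I] by (simp add: enumerate_code_def)
  next
    case False
    define x where "x = list_encode cs"
    have C: "conjugate_code k x" using instance_conjugator_code(2)[OF I] False by (simp add: x_def)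
    note G = instance_conjugator_code(1)[OF I, folded x_def] and rq = run_q[OF I, folded x_def]
    have ex: "conjugator_code k (LEAST c. conjugator_code k c x \<or> \<not> conjugate_code k x) x"
      using LeastI_ex[of "\<lambda>c. conjugator_code k c x \<or> \<not> conjugate_code k x"] C unfolding conjugate_code_def by blast
    have "\<exists>c. conjugator_code k c x \<and> run q (n # cs) = Some (Suc c)" for n
      using rq[of n] C ex unfolding enumerate_code_def by auto
    then have "\<forall>n. \<exists>c. \<exists>g\<in>conjugators thompson_group ys zs. run q (n # cs) = Some (Suc c) \<and> codes c g" using G by blast
    moreover have "\<exists>n c. run q (n # cs) = Some (Suc c) \<and> codes c g" if g: "g \<in> conjugators thompson_group ys zs" for g
    proof -
      have "g \<in> thompson_F" using g unfolding conjugators_def by (simp add: thompson_group_def)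
      then obtain c where c: "codes c g" using thompson_F_has_code by blast
      then have "conjugator_code k c x" using G g by blast
      then have "run q (c # cs) = Some (Suc c)" using rq[of c] C by (simp add: enumerate_code_def)
      then show ?thesis using c by blast
    qed
    ultimately show ?thesis using False by simp
  qed
  then show "\<exists>p. solves_and_enumerates_simultaneous_conjugacy thompson_group codes k p"
    unfolding solves_and_enumerates_simultaneous_conjugacy_def by blast
qed

end
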